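(* Let $(A,C,\psi_R,\psi_L)$ be an invertible weak entwining structure over $k$ with a $k$-projective algebra $A$ and a $k$-projective coalgebra $C$. Denote by $p_R$ the projection corresponding to $(A,C,\psi_R)$ and by $\mathfrak{C}=\mathrm{Im}\,p_R$ the corresponding $A$-coring. Suppose that (1) $A$ is a right weak entwined module (i.e. a weak entwined module over $(A,C,\psi_R)$) with action given by the product $\mu$ and coaction $\varrho^A$; (2) the map $\widetilde{\mathrm{can}}_A:A\otimes A\to\mathfrak{C}$, $a\otimes a'\mapsto a\varrho^A(a')$, is surjective; (3) $C$ is a coseparable coalgebra. Then $A$ is a weak coalgebra-Galois $C$-extension of the coinvariants $B=A^{\mathrm{co}C}$, and $A$ is $C$-equivariantly projective as a left $B$-module (i.e., $A$ is a projective left $B$-module and the multiplication map $B\otimes A\to A$ has a left $B$-linear, right $C$-colinear section).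
   Context: $k$ is a commutative ring with unit, algebras are associative unital $k$-algebras, coalgebras are coassociative counital $k$-coalgebras, $\otimes=\otimes_k$, $\Delta_C(c)=\sum c_{(1)}\otimes c_{(2)}$. A right-right weak entwining structure is $(A,C,\psi_R)$ with $A$ an algebra, $C$ a coalgebra and $\psi_R:C\otimes A\to A\otimes C$ $k$-linear such that, writing $\psi_R(c\otimes a)=\sum_\alpha a_\alpha\otimes c^\alpha$, for all $a,b\in A$, $c\in C$: $\sum_\alpha(ab)_\alpha\otimes c^\alpha=\sum_{\alpha,\beta}a_\alpha b_\beta\otimes c^{\alpha\beta}$; $\sum_\alpha a_\alpha\varepsilon_C(c^\alpha)=\sum_\alpha\varepsilon_C(c^\alpha)1_\alpha a$; $\sum_\alpha a_\alpha\otimes\Delta_C(c^\alpha)=\sum_{\alpha,\beta}a_{\alpha\beta}\otimes c_{(1)}{}^\beta\otimes c_{(2)}{}^\alpha$; $\sum_\alpha 1_\alpha\otimes c^\alpha=\sum_\alpha\varepsilon_C(c_{(1)}{}^\alpha)1_\alpha\otimes c_{(2)}$. A left-left weak entwining structure is $(A,C,\psi_L)$ with $\psi_L:A\otimes C\to C\otimes A$ $k$-linear such that, writing $\psi_L(a\otimes c)=\sum_E c_E\otimes a^E$: $\sum_E c_E\otimes(ab)^E=\sum_{E,F}c_{EF}\otimes a^Fb^E$; $\sum_E\varepsilon_C(c_E)a^E=\sum_E a\,\varepsilon_C(c_E)1^E$; $\sum_E\Delta_C(c_E)\otimes a^E=\sum_{E,F}c_{(1)E}\otimes c_{(2)F}\otimes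 a^{EF}$; $\sum_E c_E\otimes1^E=\sum_E c_{(1)}\otimes\varepsilon_C(c_{(2)E})1^E$. Associated projections: $p_R:A\otimes C\to A\otimes C$, $p_R(a\otimes c)=\sum_\alpha a1_\alpha\otimes c^\alpha$ and $p_L:C\otimes A\to C\otimes A$, $p_L(c\otimes a)=\sum_E c_E\otimes1^Ea$. An invertible weak entwining structure is a quadruple $(A,C,\psi_R,\psi_L)$ such that (a) $(A,C,\psi_R)$ is a right-right and $(A,C,\psi_L)$ a left-left weak entwining structure; (b) $\psi_R\circ\psi_L=p_R$ and $\psi_L\circ\psi_R=p_L$; (c) $\sum_E\varepsilon_C(c_E)1^E=\sum_\alpha1_\alpha\varepsilon_C(c^\alpha)$ for all $c\in C$. $\mathfrak{C}=\mathrm{Im}\,p_R$ is an $A$-coring with left action $a'(\sum_\alpha a1_\alpha\otimes c^\alpha)=\sum_\alpha a'a1_\alpha\otimes c^\alpha$, right action $(\sum_\alpha a'1_\alpha\otimes c^\alpha)a=\sum_{\alpha,\beta}a'1_\alpha a_\beta\otimes c^{\alpha\beta}$, coproduct $\sum_\alpha a1_\alpha\otimes c^\alpha\mapsto\sum_{\alpha,\beta}(a1_\alpha\otimes c_{(1)}{}^\alpha)\otimes_A(1_\beta\otimes c_{(2)}{}^\beta)$ and counit $(A\otimes\varepsilon_C)|_{\mathfrak{C}}$. A weak entwined module over $(A,C,\psi_R)$ is a right $A$-module and right $C$-comodule $M$ with $\varrho^M(ma)=\sum_\alpha m_{[0]}a_\alpha\otimes m_{[1]}{}^\alpha$ for all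 $m\in M$, $a\in A$, where $\varrho^M(m)=\sum m_{[0]}\otimes m_{[1]}$. For an algebra $A$ that is a right $C$-comodule with coaction $\varrho^A$, the coinvariants are the subalgebra $A^{\mathrm{co}C}=\{b\in A\mid\forall a\in A,\ \varrho^A(ba)=b\varrho^A(a)\}$. With $B=A^{\mathrm{co}C}$, the extension $B\subseteq A$ is a (right) weak coalgebra-Galois $C$-extension if the map $\overline{\mathrm{can}}:A\otimes_BA\to A\otimes C$, $a\otimes_Ba'\mapsto a\varrho^A(a')$, is a split monomorphism in the category of left $A$-modules and right $C$-comodules, where $A\otimes_BA$ is a left $A$-module via $\mu\otimes_BA$ and a right $C$-comodule via $A\otimes_B\varrho^A$, and $A\otimes C$ is a left $A$-module via $\mu\otimes C$ and a right $C$-comodule via $A\otimes\Delta_C$. The right $C$-coaction on $B\otimes A$ is $B\otimes\varrho^A$. A coalgebra $C$ is coseparable if $\Delta_C$ has a retraction in the category of $C$-bicomodules; equivalently, there is a $k$-linear map $\delta:C\otimes C\to k$ (a cointegral) with $\sum c_{(1)}\delta(c_{(2)}\otimes c')=\sum\delta(c\otimes c'_{(1)})c'_{(2)}$ for all $c,c'\in C$ and $\delta\circ\Delta_C=\varepsilon_C$. *)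

theory Defs
  imports "HOL-Algebra.Module" "HOL-Algebra.Free_Abelian_Groups"
begin

section \<open>Modules, linear maps, projectivity\<close>

text \<open>Left modules over a not necessarily commutative ring; the locale \<open>module\<close> of the library
  is restricted to commutative base rings.\<close>

locale left_module = R?: ring R + M?: abelian_group M
  for R :: "('r, 'x) ring_scheme" (structure) and M :: "('r, 'm, 'z) module_scheme" (structure) +
  assumes smult_closed:
      "a \<in> carrier R \<Longrightarrow> x \<in> carrier M \<Longrightarrow> a \<odot>\<^bsub>M\<^esub> x \<in> carrier M"
    and smult_l_distr:
      "a \<in> carrier R \<Longrightarrow> b \<in> carrier R \<Longrightarrow> x \<in> carrier M \<Longrightarrow>
        (a \<oplus>\<^bsub>R\<^esub> b) \<odot>\<^bsub>M\<^esub> x = a \<odot>\<^bsub>M\<^esub> x \<oplus>\<^bsub>M\<^esub> b \<odot>\<^bsub>M\<^esub> x"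
    and smult_r_distr:
      "a \<in> carrier R \<Longrightarrow> x \<in> carrier M \<Longrightarrow> y \<in> carrier M \<Longrightarrow>
        a \<odot>\<^bsub>M\<^esub> (x \<oplus>\<^bsub>M\<^esub> y) = a \<odot>\<^bsub>M\<^esub> x \<oplus>\<^bsub>M\<^esub> a \<odot>\<^bsub>M\<^esub> y"
    and smult_assoc:
      "a \<in> carrier R \<Longrightarrow> b \<in> carrier R \<Longrightarrow> x \<in> carrier M \<Longrightarrow>
        (a \<otimes>\<^bsub>R\<^esub> b) \<odot>\<^bsub>M\<^esub> x = a \<odot>\<^bsub>M\<^esub> (b \<odot>\<^bsub>M\<^esub> x)"
    and smult_one:
      "x \<in> carrier M \<Longrightarrow> \<one>\<^bsub>R\<^esub> \<odot>\<^bsub>M\<^esub> x = x"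

definition linear_map ::
  "('r, 'x) ring_scheme \<Rightarrow> ('r, 'm, 'y) module_scheme \<Rightarrow> ('r, 'n, 'z) module_scheme \<Rightarrow> ('m \<Rightarrow> 'n) \<Rightarrow> bool"
  where "linear_map R M N f \<longleftrightarrow>
    f \<in> carrier M \<rightarrow> carrier N \<and>
    (\<forall>x \<in> carrier M. \<forall>y \<in> carrier M. f (x \<oplus>\<^bsub>M\<^esub> y) = f x \<oplus>\<^bsub>N\<^esub> f y) \<and>
    (\<forall>r \<in> carrier R. \<forall>x \<in> carrier M. f (r \<odot>\<^bsub>M\<^esub> x) = r \<odot>\<^bsub>N\<^esub> f x)"

definition regular_module :: "('r, 'x) ring_scheme \<Rightarrow> ('r, 'r) module"
  where "regular_module R =
    \<lparr>carrier = carrier R, monoid.mult = (\<otimes>\<^bsub>R\<^esub>), one = \<one>\<^bsub>R\<^esub>, ring.zero = \<zero>\<^bsub>R\<^esub>, add = (\<oplus>\<^bsub>R\<^esub>), smult = (\<otimes>\<^bsub>R\<^esub>)\<rparr>"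

text \<open>The free left module of finitely supported functions on \<open>I\<close>. The fields \<open>mult\<close> and \<open>one\<close>
  of a module record have no meaning for modules.\<close>

definition free_module :: "('r, 'x) ring_scheme \<Rightarrow> 'i set \<Rightarrow> ('r, 'i \<Rightarrow> 'r) module"
  where "free_module R I =
    \<lparr>carrier = {f \<in> I \<rightarrow>\<^sub>E carrier R. finite {i \<in> I. f i \<noteq> \<zero>\<^bsub>R\<^esub>}},
     monoid.mult = undefined, one = undefined,
     ring.zero = (\<lambda>i \<in> I. \<zero>\<^bsub>R\<^esub>),
     add = (\<lambda>f g. \<lambda>i \<in> I. f i \<oplus>\<^bsub>R\<^esub> g i),
     smult = (\<lambda>r f. \<lambda>i \<in> I. r \<otimes>\<^bsub>R\<^esub> f i)\<rparr>"

text \<open>Projective means: direct summand of a free module. An index set taken from the type of \<open>M\<close>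
  is no restriction: if \<open>M\<close> is a direct summand of any free module, then the canonical surjection
  from the free module on \<open>carrier M\<close> onto \<open>M\<close> splits.\<close>

definition projective :: "('r, 'x) ring_scheme \<Rightarrow> ('r, 'm, 'y) module_scheme \<Rightarrow> bool"
  where "projective R M \<longleftrightarrow>
    left_module R M \<and>
    (\<exists>(I :: 'm set) \<iota> \<pi>.
       linear_map R M (free_module R I) \<iota> \<and> linear_map R (free_module R I) M \<pi> \<and>
       (\<forall>m \<in> carrier M. \<pi> (\<iota> m) = m))"


section \<open>Tensor products\<close>

text \<open>The tensor product of \<open>M\<close> (with right action \<open>ra\<close>) and \<open>N\<close> (with left action \<open>la\<close>) balanced
  over the set \<open>S\<close> of scalars: the free abelian group on \<open>M \<times> N\<close> modulo the subgroup generated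
  by the usual relators. It carries the scalar multiplication induced by the one of \<open>M\<close>; the
  union in the last field is over equal cosets.\<close>

definition tensor_relators ::
  "'s set \<Rightarrow> ('m \<Rightarrow> 's \<Rightarrow> 'm) \<Rightarrow> ('s \<Rightarrow> 'n \<Rightarrow> 'n) \<Rightarrow>
   ('k, 'm, 'y) module_scheme \<Rightarrow> ('l, 'n, 'z) module_scheme \<Rightarrow> ('m \<times> 'n \<Rightarrow>\<^sub>0 int) set"
  where "tensor_relators S ra la M N =
    {frag_of (m \<oplus>\<^bsub>M\<^esub> m', n) - frag_of (m, n) - frag_of (m', n) | m m' n.
       m \<in> carrier M \<and> m' \<in> carrier M \<and> n \<in> carrier N} \<union>
    {frag_of (m, n \<oplus>\<^bsub>N\<^esub> n') - frag_of (m, n) - frag_of (m, n') | m n n'.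
       m \<in> carrier M \<and> n \<in> carrier N \<and> n' \<in> carrier N} \<union>
    {frag_of (ra m s, n) - frag_of (m, la s n) | m s n.
       m \<in> carrier M \<and> s \<in> S \<and> n \<in> carrier N}"

definition balanced_tensor ::
  "'s set \<Rightarrow> ('m \<Rightarrow> 's \<Rightarrow> 'm) \<Rightarrow> ('s \<Rightarrow> 'n \<Rightarrow> 'n) \<Rightarrow>
   ('k, 'm, 'y) module_scheme \<Rightarrow> ('l, 'n, 'z) module_scheme \<Rightarrow> ('k, ('m \<times> 'n \<Rightarrow>\<^sub>0 int) set) module"
  where "balanced_tensor S ra la M N =
    (let F = free_Abelian_group (carrier M \<times> carrier N);
         K = generate F (tensor_relators S ra la M N)
     in \<lparr>carrier = carrier (F Mod K), monoid.mult = undefined, one = undefined,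
         ring.zero = \<one>\<^bsub>F Mod K\<^esub>, add = (\<otimes>\<^bsub>F Mod K\<^esub>),
         smult = (\<lambda>r t. \<Union>x \<in> t. K #>\<^bsub>F\<^esub> frag_extend (\<lambda>(m, n). frag_of (r \<odot>\<^bsub>M\<^esub> m, n)) x)\<rparr>)"

text \<open>The tensor product of modules over a commutative ring.\<close>

definition tensor ::
  "('k, 'x) ring_scheme \<Rightarrow> ('k, 'm, 'y) module_scheme \<Rightarrow> ('k, 'n, 'z) module_scheme \<Rightarrow>
   ('k, ('m \<times> 'n \<Rightarrow>\<^sub>0 int) set) module"
  where "tensor k M N = balanced_tensor (carrier k) (\<lambda>m r. r \<odot>\<^bsub>M\<^esub> m) (smult N) M N"

text \<open>The pure tensor of \<open>m\<close> and \<open>n\<close> in the tensor product \<open>T\<close>, i.e. the class of the generator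
  \<open>(m, n)\<close>.\<close>

definition pure_tensor ::
  "('k, ('m \<times> 'n \<Rightarrow>\<^sub>0 int) set, 'z) module_scheme \<Rightarrow> 'm \<Rightarrow> 'n \<Rightarrow> ('m \<times> 'n \<Rightarrow>\<^sub>0 int) set"
    (infixl \<open>\<boxtimes>\<index>\<close> 72)
  where "m \<boxtimes>\<^bsub>T\<^esub> n = (THE t. t \<in> carrier T \<and> frag_of (m, n) \<in> t)"

text \<open>\<open>tsum G t f\<close> is the sum in \<open>G\<close> of the \<open>f m\<^sub>i n\<^sub>i\<close> for a tensor \<open>t\<close>, the sum of the pure tensors
  of \<open>m\<^sub>i\<close> and \<open>n\<^sub>i\<close>. In all uses below \<open>f\<close> is balanced, so that the value does not depend on the
  representative. It renders the implicit summations of the Sweedler-type notation.\<close>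

definition tsum ::
  "('g, 'z) ring_scheme \<Rightarrow> ('m \<times> 'n \<Rightarrow>\<^sub>0 int) set \<Rightarrow> ('m \<Rightarrow> 'n \<Rightarrow> 'g) \<Rightarrow> 'g"
  where "tsum G t f =
    (THE y. \<exists>x \<in> t. y =
       (\<Oplus>\<^bsub>G\<^esub>p \<in> Poly_Mapping.keys x. [Poly_Mapping.lookup x p] \<cdot>\<^bsub>G\<^esub> f (fst p) (snd p)))"


section \<open>Algebras and coalgebras\<close>

text \<open>Associative unital algebras; the locale \<open>algebra\<close> of the library requires commutativity.\<close>

locale assoc_algebra = module k A + ring A
  for k :: "('k, 'x) ring_scheme" (structure) and A :: "('k, 'a, 'z) module_scheme" (structure) +
  assumes smult_mult_left:
      "r \<in> carrier k \<Longrightarrow> a \<in> carrier A \<Longrightarrow> b \<in> carrier A \<Longrightarrow>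
        (r \<odot>\<^bsub>A\<^esub> a) \<otimes>\<^bsub>A\<^esub> b = r \<odot>\<^bsub>A\<^esub> (a \<otimes>\<^bsub>A\<^esub> b)"
    and smult_mult_right:
      "r \<in> carrier k \<Longrightarrow> a \<in> carrier A \<Longrightarrow> b \<in> carrier A \<Longrightarrow>
        a \<otimes>\<^bsub>A\<^esub> (r \<odot>\<^bsub>A\<^esub> b) = r \<odot>\<^bsub>A\<^esub> (a \<otimes>\<^bsub>A\<^esub> b)"

record ('k, 'c) coalgebra = "('k, 'c) module" +
  comult :: "'c \<Rightarrow> ('c \<times> 'c \<Rightarrow>\<^sub>0 int) set" (\<open>\<Delta>\<index>\<close>)
  counit :: "'c \<Rightarrow> 'k" (\<open>\<epsilon>\<index>\<close>)

definition is_coalgebra :: "('k, 'x) ring_scheme \<Rightarrow> ('k, 'c, 'z) coalgebra_scheme \<Rightarrow> bool"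
  where "is_coalgebra k C \<longleftrightarrow>
    (let CC = tensor k C C; CCC = tensor k CC C in
      module k C \<and>
      linear_map k C CC \<Delta>\<^bsub>C\<^esub> \<and>
      linear_map k C (regular_module k) \<epsilon>\<^bsub>C\<^esub> \<and>
      (\<forall>c \<in> carrier C.
        tsum CCC (\<Delta>\<^bsub>C\<^esub> c) (\<lambda>c1 c2. \<Delta>\<^bsub>C\<^esub> c1 \<boxtimes>\<^bsub>CCC\<^esub> c2) =
        tsum CCC (\<Delta>\<^bsub>C\<^esub> c) (\<lambda>c1 c2. tsum CCC (\<Delta>\<^bsub>C\<^esub> c2) (\<lambda>c21 c22.
          (c1 \<boxtimes>\<^bsub>CC\<^esub> c21) \<boxtimes>\<^bsub>CCC\<^esub> c22))) \<and>
      (\<forall>c \<in> carrier C.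
        tsum C (\<Delta>\<^bsub>C\<^esub> c) (\<lambda>c1 c2. \<epsilon>\<^bsub>C\<^esub> c1 \<odot>\<^bsub>C\<^esub> c2) = c \<and>
        tsum C (\<Delta>\<^bsub>C\<^esub> c) (\<lambda>c1 c2. \<epsilon>\<^bsub>C\<^esub> c2 \<odot>\<^bsub>C\<^esub> c1) = c))"

definition right_comodule ::
  "('k, 'x) ring_scheme \<Rightarrow> ('k, 'c, 'z) coalgebra_scheme \<Rightarrow> ('k, 'm, 'y) module_scheme \<Rightarrow>
   ('m \<Rightarrow> ('m \<times> 'c \<Rightarrow>\<^sub>0 int) set) \<Rightarrow> bool"
  where "right_comodule k C M \<rho> \<longleftrightarrow>
    (let MC = tensor k M C; MCC = tensor k MC C in
      module k M \<and>
      linear_map k M MC \<rho> \<and>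
      (\<forall>m \<in> carrier M.
        tsum MCC (\<rho> m) (\<lambda>m0 m1. \<rho> m0 \<boxtimes>\<^bsub>MCC\<^esub> m1) =
        tsum MCC (\<rho> m) (\<lambda>m0 m1. tsum MCC (\<Delta>\<^bsub>C\<^esub> m1) (\<lambda>c1 c2.
          (m0 \<boxtimes>\<^bsub>MC\<^esub> c1) \<boxtimes>\<^bsub>MCC\<^esub> c2))) \<and>
      (\<forall>m \<in> carrier M. tsum M (\<rho> m) (\<lambda>m0 m1. \<epsilon>\<^bsub>C\<^esub> m1 \<odot>\<^bsub>M\<^esub> m0) = m))"

definition right_colinear ::
  "('k, 'x) ring_scheme \<Rightarrow> ('k, 'c, 'z) coalgebra_scheme \<Rightarrow>
   ('k, 'm, 'y) module_scheme \<Rightarrow> ('m \<Rightarrow> ('m \<times> 'c \<Rightarrow>\<^sub>0 int) set) \<Rightarrow>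
   ('k, 'n, 'w) module_scheme \<Rightarrow> ('n \<Rightarrow> ('n \<times> 'c \<Rightarrow>\<^sub>0 int) set) \<Rightarrow> ('m \<Rightarrow> 'n) \<Rightarrow> bool"
  where "right_colinear k C M \<rho>\<^sub>M N \<rho>\<^sub>N f \<longleftrightarrow>
    linear_map k M N f \<and>
    (\<forall>m \<in> carrier M.
      \<rho>\<^sub>N (f m) = tsum (tensor k N C) (\<rho>\<^sub>M m) (\<lambda>m0 m1. f m0 \<boxtimes>\<^bsub>tensor k N C\<^esub> m1))"

definition left_colinear ::
  "('k, 'x) ring_scheme \<Rightarrow> ('k, 'c, 'z) coalgebra_scheme \<Rightarrow>
   ('k, 'm, 'y) module_scheme \<Rightarrow> ('m \<Rightarrow> ('c \<times> 'm \<Rightarrow>\<^sub>0 int) set) \<Rightarrow>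
   ('k, 'n, 'w) module_scheme \<Rightarrow> ('n \<Rightarrow> ('c \<times> 'n \<Rightarrow>\<^sub>0 int) set) \<Rightarrow> ('m \<Rightarrow> 'n) \<Rightarrow> bool"
  where "left_colinear k C M \<theta>\<^sub>M N \<theta>\<^sub>N f \<longleftrightarrow>
    linear_map k M N f \<and>
    (\<forall>m \<in> carrier M.
      \<theta>\<^sub>N (f m) = tsum (tensor k C N) (\<theta>\<^sub>M m) (\<lambda>c m0. c \<boxtimes>\<^bsub>tensor k C N\<^esub> f m0))"

text \<open>For a tensor product \<open>T\<close> of \<open>M\<close> and \<open>N\<close> (over the ground ring or over another ring), the right
  coaction \<open>M \<otimes> \<rho>\<close> induced by a right coaction \<open>\<rho>\<close> on \<open>N\<close>, and the left coaction \<open>\<theta> \<otimes> N\<close> induced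
  by a left coaction \<open>\<theta>\<close> on \<open>M\<close>.\<close>

definition tensor_right_coaction ::
  "('k, 'x) ring_scheme \<Rightarrow> ('k, 'c, 'z) coalgebra_scheme \<Rightarrow> ('k, ('m \<times> 'n \<Rightarrow>\<^sub>0 int) set) module \<Rightarrow>
   ('n \<Rightarrow> ('n \<times> 'c \<Rightarrow>\<^sub>0 int) set) \<Rightarrow>
   ('m \<times> 'n \<Rightarrow>\<^sub>0 int) set \<Rightarrow> (('m \<times> 'n \<Rightarrow>\<^sub>0 int) set \<times> 'c \<Rightarrow>\<^sub>0 int) set"
  where "tensor_right_coaction k C T \<rho> t =
    (let TC = tensor k T C in
      tsum TC t (\<lambda>m n. tsum TC (\<rho> n) (\<lambda>n0 n1. (m \<boxtimes>\<^bsub>T\<^esub> n0) \<boxtimes>\<^bsub>TC\<^esub> n1)))"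

definition tensor_left_coaction ::
  "('k, 'x) ring_scheme \<Rightarrow> ('k, 'c, 'z) coalgebra_scheme \<Rightarrow> ('k, ('m \<times> 'n \<Rightarrow>\<^sub>0 int) set) module \<Rightarrow>
   ('m \<Rightarrow> ('c \<times> 'm \<Rightarrow>\<^sub>0 int) set) \<Rightarrow>
   ('m \<times> 'n \<Rightarrow>\<^sub>0 int) set \<Rightarrow> ('c \<times> ('m \<times> 'n \<Rightarrow>\<^sub>0 int) set \<Rightarrow>\<^sub>0 int) set"
  where "tensor_left_coaction k C T \<theta> t =
    (let CT = tensor k C T in
      tsum CT t (\<lambda>m n. tsum CT (\<theta> m) (\<lambda>c m0. c \<boxtimes>\<^bsub>CT\<^esub> (m0 \<boxtimes>\<^bsub>T\<^esub> n))))"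

definition coseparable :: "('k, 'x) ring_scheme \<Rightarrow> ('k, 'c, 'z) coalgebra_scheme \<Rightarrow> bool"
  where "coseparable k C \<longleftrightarrow>
    (let CC = tensor k C C in
      \<exists>\<pi>. left_colinear k C CC (tensor_left_coaction k C CC \<Delta>\<^bsub>C\<^esub>) C \<Delta>\<^bsub>C\<^esub> \<pi> \<and>
          right_colinear k C CC (tensor_right_coaction k C CC \<Delta>\<^bsub>C\<^esub>) C \<Delta>\<^bsub>C\<^esub> \<pi> \<and>
          (\<forall>c \<in> carrier C. \<pi> (\<Delta>\<^bsub>C\<^esub> c) = c))"

text \<open>Left and right multiplication by \<open>a\<close> on a tensor product \<open>T\<close> whose first, respectively
  second, factor is \<open>A\<close> (or a subalgebra).\<close>

definition left_mult ::
  "('k, 'a, 'w) module_scheme \<Rightarrow> ('k, ('a \<times> 'n \<Rightarrow>\<^sub>0 int) set) module \<Rightarrow> 'a \<Rightarrow>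
   ('a \<times> 'n \<Rightarrow>\<^sub>0 int) set \<Rightarrow> ('a \<times> 'n \<Rightarrow>\<^sub>0 int) set"
  where "left_mult A T a t = tsum T t (\<lambda>x y. (a \<otimes>\<^bsub>A\<^esub> x) \<boxtimes>\<^bsub>T\<^esub> y)"

definition right_mult ::
  "('k, 'a, 'w) module_scheme \<Rightarrow> ('k, ('n \<times> 'a \<Rightarrow>\<^sub>0 int) set) module \<Rightarrow>
   ('n \<times> 'a \<Rightarrow>\<^sub>0 int) set \<Rightarrow> 'a \<Rightarrow> ('n \<times> 'a \<Rightarrow>\<^sub>0 int) set"
  where "right_mult A T t a = tsum T t (\<lambda>y x. y \<boxtimes>\<^bsub>T\<^esub> (x \<otimes>\<^bsub>A\<^esub> a))"


section \<open>Weak entwining structures\<close>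

definition rr_weak_entwining ::
  "('k, 'x) ring_scheme \<Rightarrow> ('k, 'a, 'y) module_scheme \<Rightarrow> ('k, 'c, 'z) coalgebra_scheme \<Rightarrow>
   (('c \<times> 'a \<Rightarrow>\<^sub>0 int) set \<Rightarrow> ('a \<times> 'c \<Rightarrow>\<^sub>0 int) set) \<Rightarrow> bool"
  where "rr_weak_entwining k A C \<psi> \<longleftrightarrow>
    (let AC = tensor k A C; CA = tensor k C A; ACC = tensor k AC C in
      assoc_algebra k A \<and> is_coalgebra k C \<and> linear_map k CA AC \<psi> \<and>
      (\<forall>a \<in> carrier A. \<forall>b \<in> carrier A. \<forall>c \<in> carrier C.
        \<psi> (c \<boxtimes>\<^bsub>CA\<^esub> (a \<otimes>\<^bsub>A\<^esub> b)) =
        tsum AC (\<psi> (c \<boxtimes>\<^bsub>CA\<^esub> a)) (\<lambda>a' c'.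
          tsum AC (\<psi> (c' \<boxtimes>\<^bsub>CA\<^esub> b)) (\<lambda>b' c''. (a' \<otimes>\<^bsub>A\<^esub> b') \<boxtimes>\<^bsub>AC\<^esub> c''))) \<and>
      (\<forall>a \<in> carrier A. \<forall>c \<in> carrier C.
        tsum A (\<psi> (c \<boxtimes>\<^bsub>CA\<^esub> a)) (\<lambda>a' c'. \<epsilon>\<^bsub>C\<^esub> c' \<odot>\<^bsub>A\<^esub> a') =
        tsum A (\<psi> (c \<boxtimes>\<^bsub>CA\<^esub> \<one>\<^bsub>A\<^esub>)) (\<lambda>e c'. \<epsilon>\<^bsub>C\<^esub> c' \<odot>\<^bsub>A\<^esub> (e \<otimes>\<^bsub>A\<^esub> a))) \<and>
      (\<forall>a \<in> carrier A. \<forall>c \<in> carrier C.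
        tsum ACC (\<psi> (c \<boxtimes>\<^bsub>CA\<^esub> a)) (\<lambda>a' c'.
          tsum ACC (\<Delta>\<^bsub>C\<^esub> c') (\<lambda>c1 c2. (a' \<boxtimes>\<^bsub>AC\<^esub> c1) \<boxtimes>\<^bsub>ACC\<^esub> c2)) =
        tsum ACC (\<Delta>\<^bsub>C\<^esub> c) (\<lambda>c1 c2.
          tsum ACC (\<psi> (c2 \<boxtimes>\<^bsub>CA\<^esub> a)) (\<lambda>a' c2'.
            tsum ACC (\<psi> (c1 \<boxtimes>\<^bsub>CA\<^esub> a')) (\<lambda>a'' c1'.
              (a'' \<boxtimes>\<^bsub>AC\<^esub> c1') \<boxtimes>\<^bsub>ACC\<^esub> c2')))) \<and>
      (\<forall>c \<in> carrier C.
        \<psi> (c \<boxtimes>\<^bsub>CA\<^esub> \<one>\<^bsub>A\<^esub>) =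
        tsum AC (\<Delta>\<^bsub>C\<^esub> c) (\<lambda>c1 c2.
          tsum AC (\<psi> (c1 \<boxtimes>\<^bsub>CA\<^esub> \<one>\<^bsub>A\<^esub>)) (\<lambda>e c1'. (\<epsilon>\<^bsub>C\<^esub> c1' \<odot>\<^bsub>A\<^esub> e) \<boxtimes>\<^bsub>AC\<^esub> c2))))"

definition ll_weak_entwining ::
  "('k, 'x) ring_scheme \<Rightarrow> ('k, 'a, 'y) module_scheme \<Rightarrow> ('k, 'c, 'z) coalgebra_scheme \<Rightarrow>
   (('a \<times> 'c \<Rightarrow>\<^sub>0 int) set \<Rightarrow> ('c \<times> 'a \<Rightarrow>\<^sub>0 int) set) \<Rightarrow> bool"
  where "ll_weak_entwining k A C \<psi> \<longleftrightarrow>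
    (let AC = tensor k A C; CA = tensor k C A; CC = tensor k C C; CCA = tensor k CC A in
      assoc_algebra k A \<and> is_coalgebra k C \<and> linear_map k AC CA \<psi> \<and>
      (\<forall>a \<in> carrier A. \<forall>b \<in> carrier A. \<forall>c \<in> carrier C.
        \<psi> ((a \<otimes>\<^bsub>A\<^esub> b) \<boxtimes>\<^bsub>AC\<^esub> c) =
        tsum CA (\<psi> (b \<boxtimes>\<^bsub>AC\<^esub> c)) (\<lambda>c' b'.
          tsum CA (\<psi> (a \<boxtimes>\<^bsub>AC\<^esub> c')) (\<lambda>c'' a'. c'' \<boxtimes>\<^bsub>CA\<^esub> (a' \<otimes>\<^bsub>A\<^esub> b')))) \<and>
      (\<forall>a \<in> carrier A. \<forall>c \<in> carrier C.
        tsum A (\<psi> (a \<boxtimes>\<^bsub>AC\<^esub> c)) (\<lambda>c' a'. \<epsilon>\<^bsub>C\<^esub> c' \<odot>\<^bsub>A\<^esub> a') =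
        tsum A (\<psi> (\<one>\<^bsub>A\<^esub> \<boxtimes>\<^bsub>AC\<^esub> c)) (\<lambda>c' e. \<epsilon>\<^bsub>C\<^esub> c' \<odot>\<^bsub>A\<^esub> (a \<otimes>\<^bsub>A\<^esub> e))) \<and>
      (\<forall>a \<in> carrier A. \<forall>c \<in> carrier C.
        tsum CCA (\<psi> (a \<boxtimes>\<^bsub>AC\<^esub> c)) (\<lambda>c' a'. \<Delta>\<^bsub>C\<^esub> c' \<boxtimes>\<^bsub>CCA\<^esub> a') =
        tsum CCA (\<Delta>\<^bsub>C\<^esub> c) (\<lambda>c1 c2.
          tsum CCA (\<psi> (a \<boxtimes>\<^bsub>AC\<^esub> c1)) (\<lambda>c1' a'.
            tsum CCA (\<psi> (a' \<boxtimes>\<^bsub>AC\<^esub> c2)) (\<lambda>c2' a''.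
              (c1' \<boxtimes>\<^bsub>CC\<^esub> c2') \<boxtimes>\<^bsub>CCA\<^esub> a'')))) \<and>
      (\<forall>c \<in> carrier C.
        \<psi> (\<one>\<^bsub>A\<^esub> \<boxtimes>\<^bsub>AC\<^esub> c) =
        tsum CA (\<Delta>\<^bsub>C\<^esub> c) (\<lambda>c1 c2.
          tsum CA (\<psi> (\<one>\<^bsub>A\<^esub> \<boxtimes>\<^bsub>AC\<^esub> c2)) (\<lambda>c2' e. c1 \<boxtimes>\<^bsub>CA\<^esub> (\<epsilon>\<^bsub>C\<^esub> c2' \<odot>\<^bsub>A\<^esub> e)))))"

definition p_R ::
  "('k, 'x) ring_scheme \<Rightarrow> ('k, 'a, 'y) module_scheme \<Rightarrow> ('k, 'c, 'z) coalgebra_scheme \<Rightarrow>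
   (('c \<times> 'a \<Rightarrow>\<^sub>0 int) set \<Rightarrow> ('a \<times> 'c \<Rightarrow>\<^sub>0 int) set) \<Rightarrow>
   ('a \<times> 'c \<Rightarrow>\<^sub>0 int) set \<Rightarrow> ('a \<times> 'c \<Rightarrow>\<^sub>0 int) set"
  where "p_R k A C \<psi> t =
    (let AC = tensor k A C in
      tsum AC t (\<lambda>a c. left_mult A AC a (\<psi> (c \<boxtimes>\<^bsub>tensor k C A\<^esub> \<one>\<^bsub>A\<^esub>))))"

definition p_L ::
  "('k, 'x) ring_scheme \<Rightarrow> ('k, 'a, 'y) module_scheme \<Rightarrow> ('k, 'c, 'z) coalgebra_scheme \<Rightarrow>
   (('a \<times> 'c \<Rightarrow>\<^sub>0 int) set \<Rightarrow> ('c \<times> 'a \<Rightarrow>\<^sub>0 int) set) \<Rightarrow>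
   ('c \<times> 'a \<Rightarrow>\<^sub>0 int) set \<Rightarrow> ('c \<times> 'a \<Rightarrow>\<^sub>0 int) set"
  where "p_L k A C \<psi> t =
    (let CA = tensor k C A in
      tsum CA t (\<lambda>c a. right_mult A CA (\<psi> (\<one>\<^bsub>A\<^esub> \<boxtimes>\<^bsub>tensor k A C\<^esub> c)) a))"

definition invertible_weak_entwining ::
  "('k, 'x) ring_scheme \<Rightarrow> ('k, 'a, 'y) module_scheme \<Rightarrow> ('k, 'c, 'z) coalgebra_scheme \<Rightarrow>
   (('c \<times> 'a \<Rightarrow>\<^sub>0 int) set \<Rightarrow> ('a \<times> 'c \<Rightarrow>\<^sub>0 int) set) \<Rightarrow>
   (('a \<times> 'c \<Rightarrow>\<^sub>0 int) set \<Rightarrow> ('c \<times> 'a \<Rightarrow>\<^sub>0 int) set) \<Rightarrow> bool"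
  where "invertible_weak_entwining k A C \<psi>\<^sub>R \<psi>\<^sub>L \<longleftrightarrow>
    (let AC = tensor k A C; CA = tensor k C A in
      rr_weak_entwining k A C \<psi>\<^sub>R \<and> ll_weak_entwining k A C \<psi>\<^sub>L \<and>
      (\<forall>t \<in> carrier AC. \<psi>\<^sub>R (\<psi>\<^sub>L t) = p_R k A C \<psi>\<^sub>R t) \<and>
      (\<forall>t \<in> carrier CA. \<psi>\<^sub>L (\<psi>\<^sub>R t) = p_L k A C \<psi>\<^sub>L t) \<and>
      (\<forall>c \<in> carrier C.
        tsum A (\<psi>\<^sub>L (\<one>\<^bsub>A\<^esub> \<boxtimes>\<^bsub>AC\<^esub> c)) (\<lambda>c' e. \<epsilon>\<^bsub>C\<^esub> c' \<odot>\<^bsub>A\<^esub> e) =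
        tsum A (\<psi>\<^sub>R (c \<boxtimes>\<^bsub>CA\<^esub> \<one>\<^bsub>A\<^esub>)) (\<lambda>e c'. \<epsilon>\<^bsub>C\<^esub> c' \<odot>\<^bsub>A\<^esub> e)))"

text \<open>The coring of a weak entwining structure, as a submodule of \<open>A \<otimes> C\<close>. Its bimodule and
  coring structure is not needed to say that a map onto it is surjective.\<close>

definition entwining_coring ::
  "('k, 'x) ring_scheme \<Rightarrow> ('k, 'a, 'y) module_scheme \<Rightarrow> ('k, 'c, 'z) coalgebra_scheme \<Rightarrow>
   (('c \<times> 'a \<Rightarrow>\<^sub>0 int) set \<Rightarrow> ('a \<times> 'c \<Rightarrow>\<^sub>0 int) set) \<Rightarrow> ('k, ('a \<times> 'c \<Rightarrow>\<^sub>0 int) set) module"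
  where "entwining_coring k A C \<psi> =
    (tensor k A C)\<lparr>carrier := p_R k A C \<psi> ` carrier (tensor k A C)\<rparr>"

definition right_algebra_module ::
  "('k, 'x) ring_scheme \<Rightarrow> ('k, 'a, 'y) module_scheme \<Rightarrow> ('k, 'm, 'z) module_scheme \<Rightarrow>
   ('m \<Rightarrow> 'a \<Rightarrow> 'm) \<Rightarrow> bool"
  where "right_algebra_module k A M act \<longleftrightarrow>
    module k M \<and>
    (\<forall>m \<in> carrier M. \<forall>a \<in> carrier A. act m a \<in> carrier M) \<and>
    (\<forall>m \<in> carrier M. \<forall>n \<in> carrier M. \<forall>a \<in> carrier A.
      act (m \<oplus>\<^bsub>M\<^esub> n) a = act m a \<oplus>\<^bsub>M\<^esub> act n a) \<and>
    (\<forall>m \<in> carrier M. \<forall>a \<in> carrier A. \<forall>b \<in> carrier A.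
      act m (a \<oplus>\<^bsub>A\<^esub> b) = act m a \<oplus>\<^bsub>M\<^esub> act m b) \<and>
    (\<forall>r \<in> carrier k. \<forall>m \<in> carrier M. \<forall>a \<in> carrier A.
      act (r \<odot>\<^bsub>M\<^esub> m) a = r \<odot>\<^bsub>M\<^esub> act m a \<and> act m (r \<odot>\<^bsub>A\<^esub> a) = r \<odot>\<^bsub>M\<^esub> act m a) \<and>
    (\<forall>m \<in> carrier M. \<forall>a \<in> carrier A. \<forall>b \<in> carrier A. act m (a \<otimes>\<^bsub>A\<^esub> b) = act (act m a) b) \<and>
    (\<forall>m \<in> carrier M. act m \<one>\<^bsub>A\<^esub> = m)"

definition weak_entwined_module ::
  "('k, 'x) ring_scheme \<Rightarrow> ('k, 'a, 'y) module_scheme \<Rightarrow> ('k, 'c, 'z) coalgebra_scheme \<Rightarrow>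
   (('c \<times> 'a \<Rightarrow>\<^sub>0 int) set \<Rightarrow> ('a \<times> 'c \<Rightarrow>\<^sub>0 int) set) \<Rightarrow>
   ('k, 'm, 'w) module_scheme \<Rightarrow> ('m \<Rightarrow> 'a \<Rightarrow> 'm) \<Rightarrow> ('m \<Rightarrow> ('m \<times> 'c \<Rightarrow>\<^sub>0 int) set) \<Rightarrow> bool"
  where "weak_entwined_module k A C \<psi> M act \<rho> \<longleftrightarrow>
    (let MC = tensor k M C in
      right_algebra_module k A M act \<and>
      right_comodule k C M \<rho> \<and>
      (\<forall>m \<in> carrier M. \<forall>a \<in> carrier A.
        \<rho> (act m a) =
        tsum MC (\<rho> m) (\<lambda>m0 m1.
          tsum MC (\<psi> (m1 \<boxtimes>\<^bsub>tensor k C A\<^esub> a)) (\<lambda>a' m1'. act m0 a' \<boxtimes>\<^bsub>MC\<^esub> m1'))))"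


section \<open>Weak coalgebra-Galois extensions and equivariant projectivity\<close>

definition coinvariants ::
  "('k, 'x) ring_scheme \<Rightarrow> ('k, 'a) module \<Rightarrow> ('k, 'c, 'z) coalgebra_scheme \<Rightarrow>
   ('a \<Rightarrow> ('a \<times> 'c \<Rightarrow>\<^sub>0 int) set) \<Rightarrow> ('k, 'a) module"
  where "coinvariants k A C \<rho> =
    A\<lparr>carrier := {b \<in> carrier A. \<forall>a \<in> carrier A.
        \<rho> (b \<otimes>\<^bsub>A\<^esub> a) = left_mult A (tensor k A C) b (\<rho> a)}\<rparr>"

text \<open>The map \<open>a \<otimes> a' \<mapsto> a \<rho>(a')\<close> into \<open>A \<otimes> C\<close>, on \<open>A \<otimes> A\<close> as well as on \<open>A \<otimes>\<^sub>B A\<close>.\<close>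

definition canonical_map ::
  "('k, 'x) ring_scheme \<Rightarrow> ('k, 'a, 'y) module_scheme \<Rightarrow> ('k, 'c, 'z) coalgebra_scheme \<Rightarrow>
   ('a \<Rightarrow> ('a \<times> 'c \<Rightarrow>\<^sub>0 int) set) \<Rightarrow> ('a \<times> 'a \<Rightarrow>\<^sub>0 int) set \<Rightarrow> ('a \<times> 'c \<Rightarrow>\<^sub>0 int) set"
  where "canonical_map k A C \<rho> t =
    (let AC = tensor k A C in tsum AC t (\<lambda>a a'. left_mult A AC a (\<rho> a')))"

definition left_linear_right_colinear ::
  "('k, 'x) ring_scheme \<Rightarrow> ('k, 'c, 'z) coalgebra_scheme \<Rightarrow> 's set \<Rightarrow>
   ('k, 'm, 'y) module_scheme \<Rightarrow> ('s \<Rightarrow> 'm \<Rightarrow> 'm) \<Rightarrow> ('m \<Rightarrow> ('m \<times> 'c \<Rightarrow>\<^sub>0 int) set) \<Rightarrow>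
   ('k, 'n, 'w) module_scheme \<Rightarrow> ('s \<Rightarrow> 'n \<Rightarrow> 'n) \<Rightarrow> ('n \<Rightarrow> ('n \<times> 'c \<Rightarrow>\<^sub>0 int) set) \<Rightarrow>
   ('m \<Rightarrow> 'n) \<Rightarrow> bool"
  where "left_linear_right_colinear k C S M la\<^sub>M \<rho>\<^sub>M N la\<^sub>N \<rho>\<^sub>N f \<longleftrightarrow>
    right_colinear k C M \<rho>\<^sub>M N \<rho>\<^sub>N f \<and>
    (\<forall>s \<in> S. \<forall>m \<in> carrier M. f (la\<^sub>M s m) = la\<^sub>N s (f m))"

definition weak_coalgebra_galois ::
  "('k, 'x) ring_scheme \<Rightarrow> ('k, 'a) module \<Rightarrow> ('k, 'c, 'z) coalgebra_scheme \<Rightarrow>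
   ('a \<Rightarrow> ('a \<times> 'c \<Rightarrow>\<^sub>0 int) set) \<Rightarrow> bool"
  where "weak_coalgebra_galois k A C \<rho> \<longleftrightarrow>
    (let B = coinvariants k A C \<rho>;
         AA = balanced_tensor (carrier B) (\<otimes>\<^bsub>A\<^esub>) (\<otimes>\<^bsub>A\<^esub>) A A;
         AC = tensor k A C;
         \<rho>AA = tensor_right_coaction k C AA \<rho>;
         \<rho>AC = tensor_right_coaction k C AC \<Delta>\<^bsub>C\<^esub>;
         can = canonical_map k A C \<rho>
     in assoc_algebra k A \<and> is_coalgebra k C \<and> right_comodule k C A \<rho> \<and>
        left_linear_right_colinear k C (carrier A)
          AA (left_mult A AA) \<rho>AA AC (left_mult A AC) \<rho>AC can \<and>
        (\<exists>\<sigma>. left_linear_right_colinear k C (carrier A)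
               AC (left_mult A AC) \<rho>AC AA (left_mult A AA) \<rho>AA \<sigma> \<and>
             (\<forall>t \<in> carrier AA. \<sigma> (can t) = t)))"

text \<open>As a module over the coinvariants \<open>B\<close>, \<open>regular_module A\<close> is \<open>A\<close> with \<open>B\<close> acting by left
  multiplication; its scalar multiplication is only evaluated at elements of \<open>B\<close>.\<close>

definition equivariantly_projective ::
  "('k, 'x) ring_scheme \<Rightarrow> ('k, 'a) module \<Rightarrow> ('k, 'c, 'z) coalgebra_scheme \<Rightarrow>
   ('a \<Rightarrow> ('a \<times> 'c \<Rightarrow>\<^sub>0 int) set) \<Rightarrow> bool"
  where "equivariantly_projective k A C \<rho> \<longleftrightarrow>
    (let B = coinvariants k A C \<rho>; BA = tensor k B A in
      projective B (regular_module A) \<and>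
      (\<exists>\<sigma>. left_linear_right_colinear k C (carrier B)
             A (\<otimes>\<^bsub>A\<^esub>) \<rho> BA (left_mult A BA) (tensor_right_coaction k C BA \<rho>) \<sigma> \<and>
           (\<forall>a \<in> carrier A. tsum A (\<sigma> a) (\<otimes>\<^bsub>A\<^esub>) = a)))"

end

theory Submission
  imports Defs
begin

text \<open>
  Write \<open>\<rho>(a) = a\<^sub>0 \<otimes> a\<^sub>1\<close>, let \<open>\<delta>\<close> be a cointegral of \<open>C\<close>, and let \<open>\<lambda>(a) = \<psi>\<^sub>L(a \<rho>(1))\<close> be the
  left coaction on \<open>A\<close> that the inverse entwining provides. Since \<open>C\<close> is projective, the linear map
  \<open>c \<mapsto> \<psi>\<^sub>R(c \<otimes> 1)\<close> into the coring lifts through the canonical map to a linear map from \<open>C\<close> to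
  \<open>A \<otimes> A\<close>. Averaging this lift with \<open>\<delta>\<close>, first on the right and then on the left, makes it a
  bicolinear lift \<open>\<kappa>\<close>.

  Put \<open>s(a) = a\<^sub>0 \<kappa>(a\<^sub>1)\<close>. Then \<open>\<mu>(s(a)) = a\<close>, and \<open>s\<close> is right colinear and linear over \<open>B\<close>. By left
  colinearity of \<open>\<kappa>\<close>, every slice \<open>b = (A \<otimes> f)(s(a))\<close> satisfies \<open>\<psi>\<^sub>L(\<rho>(b)) = \<psi>\<^sub>L(b \<rho>(1))\<close>; applying
  \<open>\<psi>\<^sub>R\<close> gives \<open>\<rho>(b) = b \<rho>(1)\<close>, so \<open>b\<close> lies in \<open>B\<close>. As \<open>A\<close> is projective, a dual basis turns \<open>s\<close>
  into a map to \<open>B \<otimes> A\<close>, which is the required section, and the slices form the dual basis of \<open>A\<close>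
  over \<open>B\<close>. Finally \<open>a \<otimes> c \<mapsto> a \<kappa>(c)\<close> splits the canonical map: on \<open>a \<otimes> a'\<close> the composite is
  \<open>a s(a')\<close>, whose coefficients in \<open>B\<close> can be moved across the tensor sign.
\<close>

section \<open>Linear maps and balanced tensor products\<close>

text \<open>The cointegral identity makes an averaged linear map between comodules colinear, and
  \<open>\<delta> \<circ> \<Delta> = \<epsilon>\<close> leaves a map unchanged that was colinear
  already. The canonical map and \<open>c \<mapsto> \<psi>\<^sub>R(c \<otimes> 1)\<close> are
  colinear on both sides, so averaging changes the lift but not its canonical image. The two
  averagings act on different tensor factors, so the second keeps what the first achieved.

  Weakness is the obstacle: the entwining maps are inverse only up to \<open>p_R\<close> and
  \<open>p_L\<close>, so each cancellation leaves an idempotent factor to be absorbed.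

  Projectivity also enters as flatness. It embeds \<open>B \<otimes> A\<close> in
  \<open>A \<otimes> A\<close> and \<open>B \<otimes> A \<otimes> C\<close> in
  \<open>A \<otimes> A \<otimes> C\<close>, so that identities for the section can be checked in the
  larger modules.

  Tensors are cosets in a free abelian group, and iterated tensor products carry a bracketing. Each
  axiom is therefore restated as an equality of sums of an arbitrary multilinear map
  \<open>F\<close>; Sweedler computations become chains of such equalities.\<close>

lemma linear_mapI:
  assumes "\<And>x. x \<in> carrier M \<Longrightarrow> f x \<in> carrier N"
    and "\<And>x y. x \<in> carrier M \<Longrightarrow> y \<in> carrier M \<Longrightarrow> f (x \<oplus>\<^bsub>M\<^esub> y) = f x \<oplus>\<^bsub>N\<^esub> f y"
    and "\<And>r x. r \<in> carrier k \<Longrightarrow> x \<in> carrier M \<Longrightarrow> f (r \<odot>\<^bsub>M\<^esub> x) = r \<odot>\<^bsub>N\<^esub> f x"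
  shows "linear_map k M N f"
  using assms unfolding linear_map_def by blast

lemma linear_map_closed: "linear_map k M N f \<Longrightarrow> x \<in> carrier M \<Longrightarrow> f x \<in> carrier N"
  and linear_map_add: "linear_map k M N f \<Longrightarrow> x \<in> carrier M \<Longrightarrow> y \<in> carrier M \<Longrightarrow>
    f (x \<oplus>\<^bsub>M\<^esub> y) = f x \<oplus>\<^bsub>N\<^esub> f y"
  and linear_map_smult: "linear_map k M N f \<Longrightarrow> r \<in> carrier k \<Longrightarrow> x \<in> carrier M \<Longrightarrow>
    f (r \<odot>\<^bsub>M\<^esub> x) = r \<odot>\<^bsub>N\<^esub> f x"
  unfolding linear_map_def by blast+

lemma linear_map_hom:
  assumes "linear_map k M N f" shows "f \<in> hom (add_monoid M) (add_monoid N)"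
  using assms by (auto simp: hom_def linear_map_def)

lemma linear_map_zero:
  assumes "linear_map k M N f" "abelian_group M" "abelian_group N" shows "f \<zero>\<^bsub>M\<^esub> = \<zero>\<^bsub>N\<^esub>"
  using hom_one[OF linear_map_hom[OF assms(1)]] abelian_group.a_group[OF assms(2)]
    abelian_group.a_group[OF assms(3)] by simp

lemma hom_add_monoid_minus:
  assumes "f \<in> hom (add_monoid M) (add_monoid N)" "abelian_group M" "abelian_group N"
    "x \<in> carrier M" "y \<in> carrier M"
  shows "f (x \<ominus>\<^bsub>M\<^esub> y) = f x \<ominus>\<^bsub>N\<^esub> f y"
proof -
  interpret M: abelian_group M by fact
  interpret N: abelian_group N by fact
  have "f (\<ominus>\<^bsub>M\<^esub> y) = \<ominus>\<^bsub>N\<^esub> f y"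
    using group_hom.hom_inv[of "add_monoid M" "add_monoid N" f y] assms
    by (simp add: a_inv_def group_hom_def group_hom_axioms_def M.a_group N.a_group)
  then show ?thesis
    using assms hom_mult[OF assms(1), of x "\<ominus>\<^bsub>M\<^esub> y"] by (simp add: a_minus_def)
qed

lemma linear_map_compose:
  assumes "linear_map k M N f" "linear_map k N P g" shows "linear_map k M P (\<lambda>x. g (f x))"
  using assms by (auto simp: linear_map_def Pi_iff)

lemma linear_map_cong:
  assumes "linear_map k M N f" "module k M" "\<And>x. x \<in> carrier M \<Longrightarrow> f x = g x"
  shows "linear_map k M N g"
proof -
  interpret module k M by fact
  show ?thesis using assms(1,3) by (simp add: linear_map_def Pi_iff)
qed

section \<open>Bilinear maps and the evaluation of formal sums of pairs\<close>

definition bilinear ::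
  "('k, 'x) ring_scheme \<Rightarrow> ('k, 'm, 'y) module_scheme \<Rightarrow> ('k, 'n, 'z) module_scheme \<Rightarrow>
   ('k, 'g, 'w) module_scheme \<Rightarrow> ('m \<Rightarrow> 'n \<Rightarrow> 'g) \<Rightarrow> bool"
  where "bilinear k M N G f \<longleftrightarrow>
    (\<forall>m \<in> carrier M. linear_map k N G (f m)) \<and> (\<forall>n \<in> carrier N. linear_map k M G (\<lambda>m. f m n))"

lemma bilinear_closed:
  "bilinear k M N G f \<Longrightarrow> m \<in> carrier M \<Longrightarrow> n \<in> carrier N \<Longrightarrow> f m n \<in> carrier G"
  by (auto simp: bilinear_def intro: linear_map_closed)

text \<open>The scalar multiplication of a balanced tensor product is itself computed by a
  \<open>tsum\<close>. Evaluation is therefore developed for additive groups first, and linearity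
  over \<open>k\<close> follows once \<open>module_T\<close> is available.\<close>

definition biadditive ::
  "('m, 'y) ring_scheme \<Rightarrow> ('n, 'z) ring_scheme \<Rightarrow> ('g, 'w) ring_scheme \<Rightarrow> ('m \<Rightarrow> 'n \<Rightarrow> 'g) \<Rightarrow> bool"
  where "biadditive M N G f \<longleftrightarrow>
    (\<forall>m \<in> carrier M. \<forall>n \<in> carrier N. f m n \<in> carrier G) \<and>
    (\<forall>m \<in> carrier M. \<forall>m' \<in> carrier M. \<forall>n \<in> carrier N. f (m \<oplus>\<^bsub>M\<^esub> m') n = f m n \<oplus>\<^bsub>G\<^esub> f m' n) \<and>
    (\<forall>m \<in> carrier M. \<forall>n \<in> carrier N. \<forall>n' \<in> carrier N. f m (n \<oplus>\<^bsub>N\<^esub> n') = f m n \<oplus>\<^bsub>G\<^esub> f m n')"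

lemma bilinear_biadditive: "bilinear k M N G f \<Longrightarrow> biadditive M N G f"
  unfolding bilinear_def linear_map_def biadditive_def by blast

text \<open>This is what \<open>tsum\<close> computes on a single representative. On the free
  abelian group it is a homomorphism, so independence of the representative reduces to its vanishing
  on the relators.\<close>

definition frag_sum ::
  "('g, 'z) ring_scheme \<Rightarrow> ('m \<Rightarrow> 'n \<Rightarrow> 'g) \<Rightarrow> ('m \<times> 'n \<Rightarrow>\<^sub>0 int) \<Rightarrow> 'g"
  where "frag_sum G f x =
    (\<Oplus>\<^bsub>G\<^esub>p \<in> Poly_Mapping.keys x. [Poly_Mapping.lookup x p] \<cdot>\<^bsub>G\<^esub> f (fst p) (snd p))"

context abelian_group begin

lemma minus_eq_zeroD: "x \<in> carrier G \<Longrightarrow> y \<in> carrier G \<Longrightarrow> x \<ominus> y = \<zero> \<Longrightarrow> x = y"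
  by (metis a_minus_def add.inv_closed add.inv_equality add.inv_inv)

lemma frag_sum_superset:
  assumes f: "\<And>m n. (m, n) \<in> P \<Longrightarrow> f m n \<in> carrier G"
    and U: "finite U" "Poly_Mapping.keys x \<subseteq> U" "U \<subseteq> P"
  shows "frag_sum G f x = (\<Oplus>p \<in> U. [Poly_Mapping.lookup x p] \<cdot> f (fst p) (snd p))"
  unfolding frag_sum_def
proof (rule add.finprod_mono_neutral_cong_left)
  show "(\<lambda>p. [Poly_Mapping.lookup x p] \<cdot> f (fst p) (snd p)) \<in> U \<rightarrow> carrier G"
    using f U by (auto intro!: add.int_pow_closed)
qed (use U f in \<open>auto simp: in_keys_iff add_pow_def int_pow_def nat_pow_def\<close>)

lemma frag_sum_hom:
  assumes f: "\<And>m n. (m, n) \<in> P \<Longrightarrow> f m n \<in> carrier G"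
  shows "frag_sum G f \<in> hom (free_Abelian_group P) (add_monoid G)"
proof (rule homI)
  fix x assume x: "x \<in> carrier (free_Abelian_group P)"
  then show "frag_sum G f x \<in> carrier (add_monoid G)"
    using f by (auto simp: frag_sum_def intro!: finsum_closed add.int_pow_closed)
  fix y assume y: "y \<in> carrier (free_Abelian_group P)"
  \<comment> \<open>Coefficients may cancel in \<open>x + y\<close>, so all three sums are taken
    over the union of the two supports.\<close>
  let ?U = "Poly_Mapping.keys x \<union> Poly_Mapping.keys y"
  have U: "finite ?U" "?U \<subseteq> P" using x y by auto
  have c: "(\<lambda>p. [i p] \<cdot> f (fst p) (snd p)) \<in> ?U \<rightarrow> carrier G" for i :: "_ \<Rightarrow> int"
    using f U by (auto intro!: add.int_pow_closed)
  have "frag_sum G f (x + y) = (\<Oplus>p \<in> ?U. [Poly_Mapping.lookup (x + y) p] \<cdot> f (fst p) (snd p))"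
    by (rule frag_sum_superset[OF f]) (use U Poly_Mapping.keys_add[of x y] in auto)
  also have "\<dots> = (\<Oplus>p \<in> ?U. [Poly_Mapping.lookup x p] \<cdot> f (fst p) (snd p) \<oplus>
      [Poly_Mapping.lookup y p] \<cdot> f (fst p) (snd p))"
  proof (rule finsum_cong')
    fix i assume "i \<in> ?U"
    then have "f (fst i) (snd i) \<in> carrier G" using U f[of "fst i" "snd i"] by auto
    then show "[Poly_Mapping.lookup (x + y) i] \<cdot> f (fst i) (snd i) =
        [Poly_Mapping.lookup x i] \<cdot> f (fst i) (snd i) \<oplus> [Poly_Mapping.lookup y i] \<cdot> f (fst i) (snd i)"
      by (simp add: Poly_Mapping.lookup_add add.int_pow_mult)
  qed (use c[of "Poly_Mapping.lookup x"] c[of "Poly_Mapping.lookup y"] in auto)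
  also have "\<dots> = (\<Oplus>p \<in> ?U. [Poly_Mapping.lookup x p] \<cdot> f (fst p) (snd p)) \<oplus>
      (\<Oplus>p \<in> ?U. [Poly_Mapping.lookup y p] \<cdot> f (fst p) (snd p))"
    by (rule finsum_addf) (rule c)+
  also have "\<dots> = frag_sum G f x \<oplus> frag_sum G f y"
    using U frag_sum_superset[of P f ?U x] frag_sum_superset[of P f ?U y] f by simp
  finally show "frag_sum G f (x \<otimes>\<^bsub>free_Abelian_group P\<^esub> y) = frag_sum G f x \<otimes>\<^bsub>add_monoid G\<^esub> frag_sum G f y"
    by simp
qed

lemma frag_sum_diff:
  assumes f: "\<And>m n. (m, n) \<in> P \<Longrightarrow> f m n \<in> carrier G"
    and u: "u \<in> carrier (free_Abelian_group P)" and v: "v \<in> carrier (free_Abelian_group P)"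
  shows "frag_sum G f (u - v) = frag_sum G f u \<ominus> frag_sum G f v"
proof -
  interpret h: group_hom "free_Abelian_group P" "add_monoid G" "frag_sum G f"
    using frag_sum_hom[OF f] by (simp add: group_hom_def group_hom_axioms_def a_group)
  have v': "- v \<in> carrier (free_Abelian_group P)" "inv\<^bsub>free_Abelian_group P\<^esub> v = - v"
    using v by simp_all
  show ?thesis
    using h.hom_mult[OF u v'(1)] h.hom_inv[OF v] unfolding v'(2) by (simp add: minus_eq a_inv_def)
qed

lemma frag_sum_of: "f m n \<in> carrier G \<Longrightarrow> frag_sum G f (frag_of (m, n)) = f m n"
  by (simp add: frag_sum_def)

end

lemma generate_hom_eq_one:
  assumes "group_hom G H h" "R \<subseteq> carrier G" "\<And>x. x \<in> R \<Longrightarrow> h x = \<one>\<^bsub>H\<^esub>" "x \<in> generate G R"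
  shows "h x = \<one>\<^bsub>H\<^esub>"
proof -
  interpret group_hom G H h by fact
  have "R \<subseteq> kernel G H h" using assms(2,3) by (auto simp: kernel_def)
  then have "generate G R \<subseteq> kernel G H h"
    by (rule G.generate_subgroup_incl[OF _ subgroup_kernel])
  then show ?thesis using assms(4) by (auto simp: kernel_def)
qed

text \<open>For a tensor \<open>t\<close> in \<open>M \<otimes> N\<close> this is all of \<open>M \<times> N\<close> (see \<open>tpairs_T\<close>), so the factors can be read
  off from \<open>t\<close>. Hence \<open>tsum_cong\<close> needs no side conditions, and the simplifier obtains membership of
  the bound variables in the carriers.\<close>

definition tpairs :: "('m \<times> 'n \<Rightarrow>\<^sub>0 int) set \<Rightarrow> ('m \<times> 'n) set"
  where "tpairs t = (\<Union>x \<in> t. Poly_Mapping.keys x)"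

lemma foldSetD_mono_cong:
  "(B, y) \<in> foldSetD D f e \<Longrightarrow> (\<And>x. x \<in> B \<Longrightarrow> f x = g x) \<Longrightarrow> (B, y) \<in> foldSetD D g e"
  by (induction B y rule: foldSetD.induct) (auto intro!: foldSetD.intros)

text \<open>The values need not lie in \<open>carrier G\<close>: the graph \<open>foldSetD\<close>
  of the fold sees only the values on the index set, so both descriptions select the same
  element.\<close>

lemma finsum_cong_raw: "(\<And>x. x \<in> B \<Longrightarrow> f x = g x) \<Longrightarrow> finsum G f B = finsum G g B"
proof -
  assume e: "\<And>x. x \<in> B \<Longrightarrow> f x = g x"
  have "(B, y) \<in> foldSetD (carrier G) (add G \<circ> f) \<zero>\<^bsub>G\<^esub> \<longleftrightarrow>
      (B, y) \<in> foldSetD (carrier G) (add G \<circ> g) \<zero>\<^bsub>G\<^esub>" for y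
    using foldSetD_mono_cong[of B y "carrier G" "add G \<circ> f" "\<zero>\<^bsub>G\<^esub>" "add G \<circ> g"]
      foldSetD_mono_cong[of B y "carrier G" "add G \<circ> g" "\<zero>\<^bsub>G\<^esub>" "add G \<circ> f"] e
    by auto
  then show ?thesis by (simp add: finsum_def finprod_def foldD_def)
qed

lemma tsum_cong:
  assumes "t = t'" "\<And>m n. (m, n) \<in> tpairs t' \<Longrightarrow> f m n = g m n"
  shows "tsum G t f = tsum G t' g"
proof -
  have "(\<Oplus>\<^bsub>G\<^esub>p \<in> Poly_Mapping.keys x. [Poly_Mapping.lookup x p] \<cdot>\<^bsub>G\<^esub> f (fst p) (snd p)) =
      (\<Oplus>\<^bsub>G\<^esub>p \<in> Poly_Mapping.keys x. [Poly_Mapping.lookup x p] \<cdot>\<^bsub>G\<^esub> g (fst p) (snd p))" if "x \<in> t'" for x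
    by (rule finsum_cong_raw) (use assms(2) that in \<open>fastforce simp: tpairs_def\<close>)
  then show ?thesis
    unfolding tsum_def assms(1) by (intro arg_cong[where f=The] ext) auto
qed

text \<open>One locale serves both kinds of tensor product: \<open>S\<close> is the carrier of
  \<open>k\<close> for \<open>tensor\<close>, and the carrier of the coinvariants for the tensor
  product over them. By \<open>scalar_in\<close> every scalar of \<open>k\<close> acts through an
  element of \<open>S\<close>, which lets scalars pass to the second factor.\<close>

locale balanced_pair =
  fixes k :: "('k, 'x) ring_scheme" and S :: "'s set" and ra :: "'m \<Rightarrow> 's \<Rightarrow> 'm" and la :: "'s \<Rightarrow> 'n \<Rightarrow> 'n"
    and M :: "('k, 'm, 'y) module_scheme" and N :: "('k, 'n, 'z) module_scheme"
  assumes module_left: "module k M" and module_right: "module k N"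
    and ra_closed: "m \<in> carrier M \<Longrightarrow> s \<in> S \<Longrightarrow> ra m s \<in> carrier M"
    and la_closed: "n \<in> carrier N \<Longrightarrow> s \<in> S \<Longrightarrow> la s n \<in> carrier N"
    and ra_smult: "r \<in> carrier k \<Longrightarrow> m \<in> carrier M \<Longrightarrow> s \<in> S \<Longrightarrow>
      ra (r \<odot>\<^bsub>M\<^esub> m) s = r \<odot>\<^bsub>M\<^esub> ra m s"
    and scalar_in: "r \<in> carrier k \<Longrightarrow>
      \<exists>s \<in> S. (\<forall>m \<in> carrier M. ra m s = r \<odot>\<^bsub>M\<^esub> m) \<and> (\<forall>n \<in> carrier N. la s n = r \<odot>\<^bsub>N\<^esub> n)"
begin

sublocale M: module k M by (rule module_left)
sublocale N: module k N by (rule module_right)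

abbreviation "F \<equiv> free_Abelian_group (carrier M \<times> carrier N)"
abbreviation "K \<equiv> generate F (tensor_relators S ra la M N)"
abbreviation "T \<equiv> balanced_tensor S ra la M N"
abbreviation "balanced f \<equiv> (\<forall>m \<in> carrier M. \<forall>s \<in> S. \<forall>n \<in> carrier N. f (ra m s) n = f m (la s n))"

sublocale F: comm_group F by (rule abelian_free_Abelian_group)

lemma relators_subset: "tensor_relators S ra la M N \<subseteq> carrier F"
proof -
  have d: "u - v \<in> carrier F" if "u \<in> carrier F" "v \<in> carrier F" for u v :: "_ \<Rightarrow>\<^sub>0 int"
    using that keys_diff[of u v] by auto
  show ?thesis
    unfolding tensor_relators_def by (intro Un_least subsetI; clarify; intro d)
      (simp_all add: ra_closed la_closed)
qed

lemma K_subgroup: "subgroup K F"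
  by (rule F.generate_is_subgroup[OF relators_subset])

sublocale K: normal K F
  by (rule F.subgroup_imp_normal[OF K_subgroup])

lemma abelian_group_T: "abelian_group T"
proof -
  interpret Q: comm_group "F Mod K" by (rule F.abelian_FactGroup[OF K_subgroup])
  have T: "carrier T = carrier (F Mod K)" "add T = monoid.mult (F Mod K)" "\<zero>\<^bsub>T\<^esub> = \<one>\<^bsub>F Mod K\<^esub>"
    by (simp_all add: balanced_tensor_def Let_def)
  note cl = Q.m_closed Q.one_closed Q.m_assoc Q.m_comm Q.l_one
  have inv: "\<exists>v \<in> carrier (F Mod K). v \<otimes>\<^bsub>F Mod K\<^esub> u = \<one>\<^bsub>F Mod K\<^esub>" if "u \<in> carrier (F Mod K)" for u
    using Q.l_inv[OF that] Q.inv_closed[OF that] by blast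
  show ?thesis
    by (rule abelian_groupI; unfold T) (fact cl inv)+
qed

sublocale T: abelian_group T by (rule abelian_group_T)

lemma carrier_T: "carrier T = (\<lambda>x. K #>\<^bsub>F\<^esub> x) ` carrier F"
  by (simp add: balanced_tensor_def Let_def carrier_FactGroup)

lemma add_T: "x \<in> carrier F \<Longrightarrow> y \<in> carrier F \<Longrightarrow>
   (K #>\<^bsub>F\<^esub> x) \<oplus>\<^bsub>T\<^esub> (K #>\<^bsub>F\<^esub> y) = K #>\<^bsub>F\<^esub> (x + y)"
  using K.rcos_sum[of x y] by (simp add: balanced_tensor_def Let_def FactGroup_def)

lemma coset_eqI: "x \<in> carrier F \<Longrightarrow> y \<in> carrier F \<Longrightarrow> x - y \<in> K \<Longrightarrow> K #>\<^bsub>F\<^esub> x = K #>\<^bsub>F\<^esub> y"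
proof -
  assume *: "x \<in> carrier F" "y \<in> carrier F" "x - y \<in> K"
  then have "x \<in> K #>\<^bsub>F\<^esub> y" unfolding r_coset_def by force
  then show ?thesis using F.repr_independence[OF _ *(2) K_subgroup] by simp
qed

lemma coset_eqD: "x \<in> carrier F \<Longrightarrow> y \<in> K #>\<^bsub>F\<^esub> x \<Longrightarrow> y \<in> carrier F \<and> y - x \<in> K \<and> K #>\<^bsub>F\<^esub> x = K #>\<^bsub>F\<^esub> y"
proof -
  assume x: "x \<in> carrier F" and y: "y \<in> K #>\<^bsub>F\<^esub> x"
  then have "K #>\<^bsub>F\<^esub> x = K #>\<^bsub>F\<^esub> y" using F.repr_independence[OF y x K_subgroup] by simp
  moreover have "y - x \<in> K" using y unfolding r_coset_def by auto
  moreover have "y \<in> carrier F" using F.r_coset_subset_G[OF K.subset x] y by blast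
  ultimately show ?thesis by blast
qed

text \<open>Distinct cosets of \<open>K\<close> are disjoint, so the definite description has
  exactly one solution.\<close>

lemma pure_tensor_eq:
  assumes "m \<in> carrier M" "n \<in> carrier N"
  shows "m \<boxtimes>\<^bsub>T\<^esub> n = K #>\<^bsub>F\<^esub> frag_of (m, n)"
  unfolding pure_tensor_def
proof (rule the_equality)
  have f: "frag_of (m, n) \<in> carrier F" using assms by simp
  show "K #>\<^bsub>F\<^esub> frag_of (m, n) \<in> carrier T \<and> frag_of (m, n) \<in> K #>\<^bsub>F\<^esub> frag_of (m, n)"
    using f F.rcos_self[OF f K_subgroup] by (simp add: carrier_T)
  fix t assume t: "t \<in> carrier T \<and> frag_of (m, n) \<in> t"
  then obtain x where x: "x \<in> carrier F" "t = K #>\<^bsub>F\<^esub> x"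
    unfolding carrier_T by blast
  then show "t = K #>\<^bsub>F\<^esub> frag_of (m, n)"
    using t coset_eqD[OF x(1)] by blast
qed

lemma pure_closed: "m \<in> carrier M \<Longrightarrow> n \<in> carrier N \<Longrightarrow> m \<boxtimes>\<^bsub>T\<^esub> n \<in> carrier T"
  by (simp add: pure_tensor_eq carrier_T)

lemma in_K: "x \<in> tensor_relators S ra la M N \<Longrightarrow> x \<in> K"
  by (rule generate.incl)

lemma pure_add_left:
  assumes "m \<in> carrier M" "m' \<in> carrier M" "n \<in> carrier N"
  shows "(m \<oplus>\<^bsub>M\<^esub> m') \<boxtimes>\<^bsub>T\<^esub> n = m \<boxtimes>\<^bsub>T\<^esub> n \<oplus>\<^bsub>T\<^esub> m' \<boxtimes>\<^bsub>T\<^esub> n"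
proof -
  have "frag_of (m \<oplus>\<^bsub>M\<^esub> m', n) - (frag_of (m, n) + frag_of (m', n)) \<in> K"
    using assms by (intro in_K) (auto simp: tensor_relators_def diff_diff_eq)
  then show ?thesis
    using assms by (simp add: pure_tensor_eq add_T)
      (rule coset_eqI, auto dest!: subsetD[OF keys_add])
qed

lemma pure_add_right:
  assumes "m \<in> carrier M" "n \<in> carrier N" "n' \<in> carrier N"
  shows "m \<boxtimes>\<^bsub>T\<^esub> (n \<oplus>\<^bsub>N\<^esub> n') = m \<boxtimes>\<^bsub>T\<^esub> n \<oplus>\<^bsub>T\<^esub> m \<boxtimes>\<^bsub>T\<^esub> n'"
proof -
  have "frag_of (m, n \<oplus>\<^bsub>N\<^esub> n') - (frag_of (m, n) + frag_of (m, n')) \<in> K"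
    using assms by (intro in_K) (auto simp: tensor_relators_def diff_diff_eq)
  then show ?thesis
    using assms by (simp add: pure_tensor_eq add_T)
      (rule coset_eqI, auto dest!: subsetD[OF keys_add])
qed

lemma pure_balanced:
  assumes "m \<in> carrier M" "s \<in> S" "n \<in> carrier N"
  shows "ra m s \<boxtimes>\<^bsub>T\<^esub> n = m \<boxtimes>\<^bsub>T\<^esub> la s n"
proof -
  have "frag_of (ra m s, n) - frag_of (m, la s n) \<in> K"
    using assms by (intro in_K) (auto simp: tensor_relators_def)
  then show ?thesis
    using assms ra_closed la_closed by (simp add: pure_tensor_eq)
      (rule coset_eqI, auto)
qed

lemma coset_diff:
  assumes "x \<in> carrier F" "y \<in> carrier F"
  shows "K #>\<^bsub>F\<^esub> (x - y) = (K #>\<^bsub>F\<^esub> x) \<ominus>\<^bsub>T\<^esub> (K #>\<^bsub>F\<^esub> y)"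
proof -
  have d: "x - y \<in> carrier F" using assms by (auto dest!: subsetD[OF keys_diff])
  have "(K #>\<^bsub>F\<^esub> (x - y)) \<oplus>\<^bsub>T\<^esub> (K #>\<^bsub>F\<^esub> y) = K #>\<^bsub>F\<^esub> x"
    using add_T[OF d assms(2)] by simp
  moreover have "K #>\<^bsub>F\<^esub> (x - y) \<in> carrier T" "K #>\<^bsub>F\<^esub> y \<in> carrier T" "K #>\<^bsub>F\<^esub> x \<in> carrier T"
    using assms d by (simp_all add: carrier_T)
  ultimately show ?thesis
    using T.add.inv_solve_right[of "K #>\<^bsub>F\<^esub> (x - y)" "K #>\<^bsub>F\<^esub> x" "K #>\<^bsub>F\<^esub> y"] by (simp add: T.minus_eq)
qed

text \<open>Closure under differences covers sums and negatives at once and matches the induction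
  rule of the free abelian group.\<close>

lemma tensor_induct [consumes 1, case_names pure diff]:
  assumes t: "t \<in> carrier T"
    and pure: "\<And>m n. m \<in> carrier M \<Longrightarrow> n \<in> carrier N \<Longrightarrow> P (m \<boxtimes>\<^bsub>T\<^esub> n)"
    and diff: "\<And>t u. t \<in> carrier T \<Longrightarrow> u \<in> carrier T \<Longrightarrow> P t \<Longrightarrow> P u \<Longrightarrow> P (t \<ominus>\<^bsub>T\<^esub> u)"
  shows "P t"
proof -
  \<comment> \<open>The zero tensor is obtained as the difference of a pure tensor with
    itself.\<close>
  have p0: "P (K #>\<^bsub>F\<^esub> 0)"
  proof -
    have "\<zero>\<^bsub>M\<^esub> \<boxtimes>\<^bsub>T\<^esub> \<zero>\<^bsub>N\<^esub> \<ominus>\<^bsub>T\<^esub> \<zero>\<^bsub>M\<^esub> \<boxtimes>\<^bsub>T\<^esub> \<zero>\<^bsub>N\<^esub> = K #>\<^bsub>F\<^esub> 0"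
      using coset_diff[of "frag_of (\<zero>\<^bsub>M\<^esub>, \<zero>\<^bsub>N\<^esub>)" "frag_of (\<zero>\<^bsub>M\<^esub>, \<zero>\<^bsub>N\<^esub>)"] by (simp add: pure_tensor_eq)
    moreover have "P (\<zero>\<^bsub>M\<^esub> \<boxtimes>\<^bsub>T\<^esub> \<zero>\<^bsub>N\<^esub> \<ominus>\<^bsub>T\<^esub> \<zero>\<^bsub>M\<^esub> \<boxtimes>\<^bsub>T\<^esub> \<zero>\<^bsub>N\<^esub>)"
      by (intro diff pure pure_closed) simp_all
    ultimately show ?thesis by simp
  qed
  have "P (K #>\<^bsub>F\<^esub> x)" if "Poly_Mapping.keys x \<subseteq> carrier M \<times> carrier N" for x
    using that
  proof (induction x rule: free_Abelian_group_induct[consumes 1])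
    case (2 x y)
    then show ?case using diff[of "K #>\<^bsub>F\<^esub> x" "K #>\<^bsub>F\<^esub> y"] by (simp add: coset_diff carrier_T)
  next
    case (3 a)
    then show ?case using pure[of "fst a" "snd a"] by (auto simp: pure_tensor_eq)
  qed (use p0 in simp)
  then show ?thesis using t by (auto simp: carrier_T)
qed

text \<open>The homomorphism \<open>frag_sum G f\<close> kills the three kinds of relators, hence
  the subgroup \<open>K\<close>, hence is constant on each coset. This gives the definite
  description in \<open>tsum\<close> its meaning.\<close>

lemma tsum_coset:
  assumes G: "abelian_group G" and f: "biadditive M N G f" and b: "balanced f" and x: "x \<in> carrier F"
  shows "tsum G (K #>\<^bsub>F\<^esub> x) f = frag_sum G f x"
proof -
  interpret G: abelian_group G by fact
  note c = f[unfolded biadditive_def, THEN conjunct1, rule_format]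
  note l = f[unfolded biadditive_def, THEN conjunct2, THEN conjunct1, rule_format]
  note r = f[unfolded biadditive_def, THEN conjunct2, THEN conjunct2, rule_format]
  have h: "frag_sum G f \<in> hom F (add_monoid G)" by (rule G.frag_sum_hom) (use c in auto)
  interpret h: group_hom F "add_monoid G" "frag_sum G f"
    using h by (simp add: group_hom_def group_hom_axioms_def G.a_group F.is_group)
  have d: "frag_sum G f (u - v) = frag_sum G f u \<ominus>\<^bsub>G\<^esub> frag_sum G f v"
    if "u \<in> carrier F" "v \<in> carrier F" for u v
    by (rule G.frag_sum_diff[OF _ that]) (use c in auto)
  have dc: "u - v \<in> carrier F" if "u \<in> carrier F" "v \<in> carrier F" for u v :: "_ \<Rightarrow>\<^sub>0 int"
    using that by (auto dest!: subsetD[OF keys_diff])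
  have c': "f m n \<in> carrier G" if "(m, n) \<in> carrier M \<times> carrier N" for m n
    using that c by auto
  have cancel: "u \<oplus>\<^bsub>G\<^esub> v \<ominus>\<^bsub>G\<^esub> u \<ominus>\<^bsub>G\<^esub> v = \<zero>\<^bsub>G\<^esub>" if "u \<in> carrier G" "v \<in> carrier G" for u v
    using that G.a_comm[of u v] G.a_assoc[of v u "\<ominus>\<^bsub>G\<^esub> u"] by (simp add: a_minus_def G.r_neg)
  have rel: "frag_sum G f y = \<zero>\<^bsub>G\<^esub>" if y: "y \<in> tensor_relators S ra la M N" for y
  proof -
    from y show ?thesis
      unfolding tensor_relators_def
    proof (elim UnE CollectE exE conjE)
      fix m m' n assume y: "y = frag_of (m \<oplus>\<^bsub>M\<^esub> m', n) - frag_of (m, n) - frag_of (m', n)"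
        and 1: "m \<in> carrier M" "m' \<in> carrier M" "n \<in> carrier N"
      have "frag_sum G f y = f (m \<oplus>\<^bsub>M\<^esub> m') n \<ominus>\<^bsub>G\<^esub> f m n \<ominus>\<^bsub>G\<^esub> f m' n"
        using dc[of "frag_of (m \<oplus>\<^bsub>M\<^esub> m', n)" "frag_of (m, n)"] 1 unfolding y
        by (simp add: d G.frag_sum_of c)
      then show ?thesis using 1 by (simp add: l cancel c)
    next
      fix m n n' assume y: "y = frag_of (m, n \<oplus>\<^bsub>N\<^esub> n') - frag_of (m, n) - frag_of (m, n')"
        and 1: "m \<in> carrier M" "n \<in> carrier N" "n' \<in> carrier N"
      have "frag_sum G f y = f m (n \<oplus>\<^bsub>N\<^esub> n') \<ominus>\<^bsub>G\<^esub> f m n \<ominus>\<^bsub>G\<^esub> f m n'"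
        using dc[of "frag_of (m, n \<oplus>\<^bsub>N\<^esub> n')" "frag_of (m, n)"] 1 unfolding y
        by (simp add: d G.frag_sum_of c)
      then show ?thesis using 1 by (simp add: r cancel c)
    next
      fix m s n assume y: "y = frag_of (ra m s, n) - frag_of (m, la s n)"
        and 1: "m \<in> carrier M" "s \<in> S" "n \<in> carrier N"
      have "frag_sum G f y = f (ra m s) n \<ominus>\<^bsub>G\<^esub> f m (la s n)"
        using 1 unfolding y by (simp add: d G.frag_sum_of c ra_closed la_closed)
      moreover have "f (ra m s) n = f m (la s n)" using b 1 by blast
      ultimately show ?thesis using c[OF 1(1) la_closed[OF 1(3,2)]] by (simp add: a_minus_def G.r_neg)
    qed
  qed
  have K0: "frag_sum G f y = \<zero>\<^bsub>G\<^esub>" if "y \<in> K" for y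
    using generate_hom_eq_one[OF h.group_hom_axioms relators_subset _ that] rel by simp
  have const: "frag_sum G f y = frag_sum G f x" if "y \<in> K #>\<^bsub>F\<^esub> x" for y
  proof -
    have y: "y \<in> carrier F" "y - x \<in> K" using coset_eqD[OF x that] by auto
    have "frag_sum G f y \<ominus>\<^bsub>G\<^esub> frag_sum G f x = \<zero>\<^bsub>G\<^esub>" using d[OF y(1) x] K0[OF y(2)] by simp
    then show ?thesis using G.minus_eq_zeroD h.hom_closed[OF x] h.hom_closed[OF y(1)] by simp
  qed
  show ?thesis
    unfolding tsum_def frag_sum_def[symmetric]
  proof (rule the_equality)
    show "\<exists>y \<in> K #>\<^bsub>F\<^esub> x. frag_sum G f x = frag_sum G f y"
      using F.rcos_self[OF x K_subgroup] by blast
  qed (use const in auto)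
qed

lemma tsum_pure:
  assumes "abelian_group G" "biadditive M N G f" "balanced f" "m \<in> carrier M" "n \<in> carrier N"
  shows "tsum G (m \<boxtimes>\<^bsub>T\<^esub> n) f = f m n"
  using assms tsum_coset[OF assms(1-3), of "frag_of (m, n)"] abelian_group.frag_sum_of[OF assms(1), of f m n]
  by (simp add: pure_tensor_eq biadditive_def)

lemma tsum_hom:
  assumes G: "abelian_group G" and f: "biadditive M N G f" and b: "balanced f"
  shows "(\<lambda>t. tsum G t f) \<in> hom (add_monoid T) (add_monoid G)"
proof -
  have "frag_sum G f \<in> hom F (add_monoid G)"
    by (rule abelian_group.frag_sum_hom[OF G]) (use f in \<open>auto simp: biadditive_def\<close>)
  then have h: "x \<in> carrier F \<Longrightarrow> frag_sum G f x \<in> carrier G"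
    "x \<in> carrier F \<Longrightarrow> y \<in> carrier F \<Longrightarrow> frag_sum G f (x + y) = frag_sum G f x \<oplus>\<^bsub>G\<^esub> frag_sum G f y" for x y
    unfolding hom_def by auto
  have cl: "x + y \<in> carrier F" if "x \<in> carrier F" "y \<in> carrier F" for x y :: "_ \<Rightarrow>\<^sub>0 int"
    using F.m_closed[OF that] by simp
  show ?thesis
  proof (rule homI)
    fix t u assume "t \<in> carrier (add_monoid T)" "u \<in> carrier (add_monoid T)"
    then obtain x y where "x \<in> carrier F" "t = K #>\<^bsub>F\<^esub> x" "y \<in> carrier F" "u = K #>\<^bsub>F\<^esub> y"
      by (auto simp: carrier_T simp del: carrier_free_Abelian_group_iff)
    then show "tsum G (t \<otimes>\<^bsub>add_monoid T\<^esub> u) f = tsum G t f \<otimes>\<^bsub>add_monoid G\<^esub> tsum G u f"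
      by (simp add: add_T tsum_coset[OF G f b] h cl del: carrier_free_Abelian_group_iff)
  next
    fix t assume "t \<in> carrier (add_monoid T)"
    then show "tsum G t f \<in> carrier (add_monoid G)"
      by (auto simp: carrier_T tsum_coset[OF G f b] h simp del: carrier_free_Abelian_group_iff)
  qed
qed

lemma hom_eqI:
  assumes "h \<in> hom (add_monoid T) (add_monoid G)" "h' \<in> hom (add_monoid T) (add_monoid G)"
    "abelian_group G" "t \<in> carrier T"
    and e: "\<And>m n. m \<in> carrier M \<Longrightarrow> n \<in> carrier N \<Longrightarrow> h (m \<boxtimes>\<^bsub>T\<^esub> n) = h' (m \<boxtimes>\<^bsub>T\<^esub> n)"
  shows "h t = h' t"
  using assms(4)
proof (induction t rule: tensor_induct)
  case (diff t u)
  then show ?case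
    using hom_add_monoid_minus[OF assms(1) abelian_group_T assms(3)]
      hom_add_monoid_minus[OF assms(2) abelian_group_T assms(3)] by simp
qed (use e in blast)

lemma scaled_pure_biadditive:
  assumes "r \<in> carrier k" shows "biadditive M N T (\<lambda>m n. (r \<odot>\<^bsub>M\<^esub> m) \<boxtimes>\<^bsub>T\<^esub> n)"
  using assms by (simp add: biadditive_def pure_closed pure_add_left pure_add_right M.smult_r_distr)

lemma scaled_pure_balanced:
  assumes "r \<in> carrier k" shows "balanced (\<lambda>m n. (r \<odot>\<^bsub>M\<^esub> m) \<boxtimes>\<^bsub>T\<^esub> n)"
proof clarify
  fix m s n assume "m \<in> carrier M" "s \<in> S" "n \<in> carrier N"
  then show "(r \<odot>\<^bsub>M\<^esub> ra m s) \<boxtimes>\<^bsub>T\<^esub> n = (r \<odot>\<^bsub>M\<^esub> m) \<boxtimes>\<^bsub>T\<^esub> la s n"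
    using assms pure_balanced[of "r \<odot>\<^bsub>M\<^esub> m" s n] by (simp add: ra_smult)
qed

text \<open>For every representative \<open>y\<close>, induction over the free group identifies the
  coset in the defining union with the \<open>frag_sum\<close> of the scaled pure tensors. That
  value is constant on \<open>t\<close>, so the union is over one and the same coset.\<close>

lemma smult_T:
  assumes r: "r \<in> carrier k" and t: "t \<in> carrier T"
  shows "r \<odot>\<^bsub>T\<^esub> t = tsum T t (\<lambda>m n. (r \<odot>\<^bsub>M\<^esub> m) \<boxtimes>\<^bsub>T\<^esub> n)"
proof -
  let ?f = "\<lambda>m n. (r \<odot>\<^bsub>M\<^esub> m) \<boxtimes>\<^bsub>T\<^esub> n"
  let ?s = "frag_extend (\<lambda>(m, n). frag_of (r \<odot>\<^bsub>M\<^esub> m, n)) :: _ \<Rightarrow> ('m \<times> 'n \<Rightarrow>\<^sub>0 int)"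
  obtain x where x: "x \<in> carrier F" "t = K #>\<^bsub>F\<^esub> x"
    using t unfolding carrier_T by blast
  have s: "?s y \<in> carrier F" if "y \<in> carrier F" for y
  proof -
    have "Poly_Mapping.keys ((\<lambda>(m, n). frag_of (r \<odot>\<^bsub>M\<^esub> m, n)) p) \<subseteq> carrier M \<times> carrier N"
      if "p \<in> Poly_Mapping.keys y" for p :: "'m \<times> 'n"
      using that \<open>y \<in> carrier F\<close> r by (cases p) auto
    then show ?thesis
      using keys_frag_extend[of "\<lambda>(m, n). frag_of (r \<odot>\<^bsub>M\<^esub> m, n)" y] by (fastforce)
  qed
  have sf: "K #>\<^bsub>F\<^esub> ?s y = frag_sum T ?f y" if "Poly_Mapping.keys y \<subseteq> carrier M \<times> carrier N" for y
    using that
  proof (induction y rule: free_Abelian_group_induct[consumes 1])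
    case 1
    have "K #>\<^bsub>F\<^esub> 0 = \<zero>\<^bsub>T\<^esub>"
      using F.coset_mult_one[OF K.subset] by (simp add: balanced_tensor_def Let_def)
    then show ?case by (simp add: frag_sum_def)
  next
    case (2 x y)
    then show ?case
      using s[of x] s[of y] T.frag_sum_diff[of "carrier M \<times> carrier N" ?f x y] r
      by (simp add: frag_extend_diff coset_diff pure_closed)
  next
    case (3 p)
    obtain m n where p: "p = (m, n)" by (cases p)
    then have mn: "r \<odot>\<^bsub>M\<^esub> m \<in> carrier M" "n \<in> carrier N" using 3 r by auto
    then have "frag_sum T ?f (frag_of p) = (r \<odot>\<^bsub>M\<^esub> m) \<boxtimes>\<^bsub>T\<^esub> n"
      unfolding p by (intro T.frag_sum_of pure_closed)
    then show ?case using mn by (simp add: p pure_tensor_eq)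
  qed
  note tc = tsum_coset[OF abelian_group_T scaled_pure_biadditive[OF r] scaled_pure_balanced[OF r]]
  have "K #>\<^bsub>F\<^esub> ?s y = tsum T t ?f" if "y \<in> t" for y
    using that coset_eqD[OF x(1)] x sf tc[of y] by simp
  moreover have "t \<noteq> {}" using F.rcos_self[OF x(1) K_subgroup] x by blast
  ultimately have "(\<Union>y \<in> t. K #>\<^bsub>F\<^esub> ?s y) = tsum T t ?f" by auto
  then show ?thesis by (simp add: balanced_tensor_def Let_def)
qed

lemma smult_T_hom: "r \<in> carrier k \<Longrightarrow> (\<lambda>t. r \<odot>\<^bsub>T\<^esub> t) \<in> hom (add_monoid T) (add_monoid T)"
  using tsum_hom[OF abelian_group_T scaled_pure_biadditive scaled_pure_balanced, of r]
  by (simp add: smult_T hom_def Pi_iff)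

lemma smult_pure: "r \<in> carrier k \<Longrightarrow> m \<in> carrier M \<Longrightarrow> n \<in> carrier N \<Longrightarrow>
    r \<odot>\<^bsub>T\<^esub> (m \<boxtimes>\<^bsub>T\<^esub> n) = (r \<odot>\<^bsub>M\<^esub> m) \<boxtimes>\<^bsub>T\<^esub> n"
  by (simp add: smult_T pure_closed tsum_pure[OF abelian_group_T scaled_pure_biadditive scaled_pure_balanced])

lemma smult_pure_right:
  assumes "r \<in> carrier k" "m \<in> carrier M" "n \<in> carrier N"
  shows "m \<boxtimes>\<^bsub>T\<^esub> (r \<odot>\<^bsub>N\<^esub> n) = (r \<odot>\<^bsub>M\<^esub> m) \<boxtimes>\<^bsub>T\<^esub> n"
  using scalar_in[OF assms(1)] pure_balanced assms by metis

lemma module_T: "module k T"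
proof (rule moduleI)
  show "cring k" by (rule M.R.is_cring)
  show "abelian_group T" by (rule abelian_group_T)
  note H = smult_T_hom[unfolded hom_def, simplified]
  show cl: "a \<odot>\<^bsub>T\<^esub> x \<in> carrier T" if "a \<in> carrier k" "x \<in> carrier T" for a x
    using H[OF that(1)] that(2) by blast
  show "a \<odot>\<^bsub>T\<^esub> (x \<oplus>\<^bsub>T\<^esub> y) = a \<odot>\<^bsub>T\<^esub> x \<oplus>\<^bsub>T\<^esub> a \<odot>\<^bsub>T\<^esub> y"
    if "a \<in> carrier k" "x \<in> carrier T" "y \<in> carrier T" for a x y
    using H[OF that(1)] that(2,3) by blast
  note add = this
  show "(a \<oplus>\<^bsub>k\<^esub> b) \<odot>\<^bsub>T\<^esub> x = a \<odot>\<^bsub>T\<^esub> x \<oplus>\<^bsub>T\<^esub> b \<odot>\<^bsub>T\<^esub> x"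
    if "a \<in> carrier k" "b \<in> carrier k" "x \<in> carrier T" for a b x
  proof (rule hom_eqI[OF smult_T_hom _ abelian_group_T that(3)])
    show "(\<lambda>x. a \<odot>\<^bsub>T\<^esub> x \<oplus>\<^bsub>T\<^esub> b \<odot>\<^bsub>T\<^esub> x) \<in> hom (add_monoid T) (add_monoid T)"
      using that by (auto simp: hom_def cl add T.a_ac)
  qed (use that in \<open>simp_all add: smult_pure M.smult_l_distr pure_add_left\<close>)
  show "(a \<otimes>\<^bsub>k\<^esub> b) \<odot>\<^bsub>T\<^esub> x = a \<odot>\<^bsub>T\<^esub> (b \<odot>\<^bsub>T\<^esub> x)"
    if "a \<in> carrier k" "b \<in> carrier k" "x \<in> carrier T" for a b x
  proof (rule hom_eqI[OF smult_T_hom _ abelian_group_T that(3)])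
    show "(\<lambda>x. a \<odot>\<^bsub>T\<^esub> (b \<odot>\<^bsub>T\<^esub> x)) \<in> hom (add_monoid T) (add_monoid T)"
      using that by (auto simp: hom_def cl add)
  qed (use that in \<open>simp_all add: smult_pure M.smult_assoc1\<close>)
  show "\<one>\<^bsub>k\<^esub> \<odot>\<^bsub>T\<^esub> x = x" if "x \<in> carrier T" for x
    by (rule hom_eqI[OF smult_T_hom _ abelian_group_T that]) (simp_all add: hom_def smult_pure)
qed

lemma bilinear_pure: "bilinear k M N T (\<lambda>m n. m \<boxtimes>\<^bsub>T\<^esub> n)"
  by (simp add: bilinear_def linear_map_def pure_closed pure_add_left pure_add_right smult_pure smult_pure_right)

lemma linear_eqI:
  assumes "linear_map k T G h" "linear_map k T G h'" "module k G" "t \<in> carrier T"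
    and "\<And>m n. m \<in> carrier M \<Longrightarrow> n \<in> carrier N \<Longrightarrow> h (m \<boxtimes>\<^bsub>T\<^esub> n) = h' (m \<boxtimes>\<^bsub>T\<^esub> n)"
  shows "h t = h' t"
  by (rule hom_eqI[OF linear_map_hom linear_map_hom]) (use assms module.axioms in blast)+

lemma linear_tsum:
  assumes "module k G" "bilinear k M N G f" "balanced f"
  shows "linear_map k T G (\<lambda>t. tsum G t f)"
proof -
  interpret G: module k G by fact
  interpret TM: module k T by (rule module_T)
  have G: "abelian_group G" by (rule G.abelian_group_axioms)
  note H = tsum_hom[OF G bilinear_biadditive[OF assms(2)] assms(3)]
  show ?thesis
  proof (rule linear_mapI)
    fix r t assume r: "r \<in> carrier k" and t: "t \<in> carrier T"
    show "tsum G (r \<odot>\<^bsub>T\<^esub> t) f = r \<odot>\<^bsub>G\<^esub> tsum G t f"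
    proof (rule hom_eqI[OF _ _ G t])
      show "(\<lambda>t. tsum G (r \<odot>\<^bsub>T\<^esub> t) f) \<in> hom (add_monoid T) (add_monoid G)"
        "(\<lambda>t. r \<odot>\<^bsub>G\<^esub> tsum G t f) \<in> hom (add_monoid T) (add_monoid G)"
        using H r by (auto simp: hom_def TM.smult_r_distr G.smult_r_distr Pi_iff)
      fix m n assume "m \<in> carrier M" "n \<in> carrier N"
      then show "tsum G (r \<odot>\<^bsub>T\<^esub> (m \<boxtimes>\<^bsub>T\<^esub> n)) f = r \<odot>\<^bsub>G\<^esub> tsum G (m \<boxtimes>\<^bsub>T\<^esub> n) f"
        using r assms(2)
        by (simp add: smult_pure tsum_pure[OF G bilinear_biadditive[OF assms(2)] assms(3)] bilinear_def linear_map_def)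
    qed
  qed (use H in \<open>auto simp: hom_def\<close>)
qed

text \<open>A representative can be changed by a relator, and a suitable relator brings in any
  prescribed pair.\<close>

lemma tpairs_T:
  assumes t: "t \<in> carrier T" shows "tpairs t = carrier M \<times> carrier N"
proof -
  obtain x where x: "x \<in> carrier F" "t = K #>\<^bsub>F\<^esub> x" using t unfolding carrier_T by blast
  have "p \<in> tpairs t" if "p \<in> carrier M \<times> carrier N" for p
  proof (cases "p \<in> Poly_Mapping.keys x")
    case True
    then show ?thesis using F.rcos_self[OF x(1) K_subgroup] x(2) unfolding tpairs_def by blast
  next
    case False
    obtain m n where p: "p = (m, n)" by (cases p)
    then have mn: "m \<in> carrier M" "n \<in> carrier N" using that by auto
    \<comment> \<open>The coefficient of this relator at \<open>(m, n)\<close> is -2, or -1 if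
      \<open>m\<close> is zero, so it is nonzero in both cases, while that of \<open>x\<close>
      vanishes.\<close>
    let ?y = "frag_of (m \<oplus>\<^bsub>M\<^esub> m, n) - frag_of (m, n) - frag_of (m, n)"
    have "?y \<in> tensor_relators S ra la M N"
      unfolding tensor_relators_def using mn by blast
    then have "?y + x \<in> t" unfolding x(2) r_coset_def using in_K by force
    moreover have "p \<in> Poly_Mapping.keys (?y + x)"
      using False by (auto simp: p in_keys_iff lookup_add lookup_minus lookup_single when_def)
    ultimately show ?thesis unfolding tpairs_def by blast
  qed
  moreover have "tpairs t \<subseteq> carrier M \<times> carrier N"
    using coset_eqD[OF x(1)] unfolding tpairs_def x(2) by fastforce
  ultimately show ?thesis by blast
qed

end

section \<open>Multilinear calculus for sums over tensors\<close>

text \<open>As a congruence rule with \<open>=simp=>\<close>, it makes the simplifier first reduce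
  membership in \<open>tpairs t'\<close> to membership in the two carriers, which then serves as a
  local hypothesis inside the summand.\<close>

lemma tsum_cong_simp:
  assumes "t = t'" "\<And>m n. (m, n) \<in> tpairs t' =simp=> f m n = g m n"
  shows "tsum G t f = tsum G t' g"
  using assms unfolding simp_implies_def by (rule tsum_cong)

lemma balanced_pair_tensor:
  assumes "module k M" "module k N"
  shows "balanced_pair k (carrier k) (\<lambda>m r. r \<odot>\<^bsub>M\<^esub> m) (smult N) M N"
proof -
  interpret M: module k M by fact
  interpret N: module k N by fact
  show ?thesis
    by unfold_locales (auto simp: M.smult_assoc1[symmetric] M.R.m_comm)
qed

lemma tensor_balanced:
  assumes "bilinear k M N G f" "m \<in> carrier M" "s \<in> carrier k" "n \<in> carrier N"
  shows "f (s \<odot>\<^bsub>M\<^esub> m) n = f m (s \<odot>\<^bsub>N\<^esub> n)"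
  using assms unfolding bilinear_def linear_map_def by metis

definition trilinear ::
  "('k, 'x) ring_scheme \<Rightarrow> ('k, 'm, 'y) module_scheme \<Rightarrow> ('k, 'n, 'z) module_scheme \<Rightarrow>
   ('k, 'p, 'v) module_scheme \<Rightarrow> ('k, 'g, 'w) module_scheme \<Rightarrow> ('m \<Rightarrow> 'n \<Rightarrow> 'p \<Rightarrow> 'g) \<Rightarrow> bool"
  where "trilinear k M N P G f \<longleftrightarrow>
    (\<forall>m \<in> carrier M. bilinear k N P G (f m)) \<and>
    (\<forall>n \<in> carrier N. \<forall>p \<in> carrier P. linear_map k M G (\<lambda>m. f m n p))"

text \<open>Linear maps are substituted into one slot at a time. In this form the simplifier can
  establish the linearity of nested expressions by recursion on their structure.\<close>

lemma bilinear_apply: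
  assumes "bilinear k M N G f"
  shows "m \<in> carrier M \<Longrightarrow> linear_map k X N g \<Longrightarrow> linear_map k X G (\<lambda>x. f m (g x))"
    and "n \<in> carrier N \<Longrightarrow> linear_map k X M h \<Longrightarrow> linear_map k X G (\<lambda>x. f (h x) n)"
    and "m \<in> carrier M \<Longrightarrow> n \<in> carrier N \<Longrightarrow> f m n \<in> carrier G"
  using assms linear_map_compose[of k X N g G "f m"] linear_map_compose[of k X M h G "\<lambda>m. f m n"]
  by (auto simp: bilinear_def intro: linear_map_closed)

lemma trilinear_apply:
  assumes "trilinear k M N P G f"
  shows "m \<in> carrier M \<Longrightarrow> n \<in> carrier N \<Longrightarrow> linear_map k X P g \<Longrightarrow> linear_map k X G (\<lambda>x. f m n (g x))"
    and "m \<in> carrier M \<Longrightarrow> p \<in> carrier P \<Longrightarrow> linear_map k X N h \<Longrightarrow> linear_map k X G (\<lambda>x. f m (h x) p)"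
    and "n \<in> carrier N \<Longrightarrow> p \<in> carrier P \<Longrightarrow> linear_map k X M i \<Longrightarrow> linear_map k X G (\<lambda>x. f (i x) n p)"
    and "m \<in> carrier M \<Longrightarrow> n \<in> carrier N \<Longrightarrow> p \<in> carrier P \<Longrightarrow> f m n p \<in> carrier G"
  using assms bilinear_apply(1)[of k N P G "f m" n X g] bilinear_apply(2)[of k N P G "f m" p X h]
    bilinear_apply(3)[of k N P G "f m" n p]
    linear_map_compose[of k X M i G "\<lambda>m. f m n p"]
  by (auto simp: trilinear_def)

context
  fixes k :: "('k, 'x) ring_scheme"
    and M :: "('k, 'm, 'y) module_scheme" and N :: "('k, 'n, 'z) module_scheme"
  assumes M: "module k M" and N: "module k N"
begin

interpretation balanced_pair k "carrier k" "\<lambda>m r. r \<odot>\<^bsub>M\<^esub> m" "smult N" M N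
  by (rule balanced_pair_tensor[OF M N])

lemma module_tensor: "module k (tensor k M N)"
  unfolding tensor_def by (rule module_T)

lemma pure_tensor_closed:
  "m \<in> carrier M \<Longrightarrow> n \<in> carrier N \<Longrightarrow> m \<boxtimes>\<^bsub>tensor k M N\<^esub> n \<in> carrier (tensor k M N)"
  unfolding tensor_def by (rule pure_closed)

lemma bilinear_pure_tensor: "bilinear k M N (tensor k M N) (\<lambda>m n. m \<boxtimes>\<^bsub>tensor k M N\<^esub> n)"
  unfolding tensor_def by (rule bilinear_pure)

lemmas linear_pure_tensor = bilinear_apply(1,2)[OF bilinear_pure_tensor]

lemma tensor_induct [consumes 1, case_names pure diff]:
  assumes "t \<in> carrier (tensor k M N)"
    and "\<And>m n. m \<in> carrier M \<Longrightarrow> n \<in> carrier N \<Longrightarrow> P (m \<boxtimes>\<^bsub>tensor k M N\<^esub> n)"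
    and "\<And>t u. t \<in> carrier (tensor k M N) \<Longrightarrow> u \<in> carrier (tensor k M N) \<Longrightarrow> P t \<Longrightarrow> P u \<Longrightarrow>
      P (t \<ominus>\<^bsub>tensor k M N\<^esub> u)"
  shows "P t"
  using assms unfolding tensor_def by (rule tensor_induct)

lemma tpairs_tensor: "t \<in> carrier (tensor k M N) \<Longrightarrow> tpairs t = carrier M \<times> carrier N"
  unfolding tensor_def by (rule tpairs_T)

lemma tensor_linear_eqI:
  assumes "linear_map k (tensor k M N) G h" "linear_map k (tensor k M N) G h'" "module k G"
    "\<And>m n. m \<in> carrier M \<Longrightarrow> n \<in> carrier N \<Longrightarrow>
      h (m \<boxtimes>\<^bsub>tensor k M N\<^esub> n) = h' (m \<boxtimes>\<^bsub>tensor k M N\<^esub> n)"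
    "t \<in> carrier (tensor k M N)"
  shows "h t = h' t"
  using linear_eqI[of G h h' t] assms unfolding tensor_def by blast

context
  fixes G :: "('k, 'g, 'w) module_scheme"
  assumes G: "module k G"
begin

lemma linear_tsum_tensor:
  "bilinear k M N G f \<Longrightarrow> linear_map k (tensor k M N) G (\<lambda>t. tsum G t f)"
  unfolding tensor_def by (rule linear_tsum[OF G]) (auto dest: tensor_balanced)

lemma tsum_pure_tensor:
  assumes "bilinear k M N G f" "m \<in> carrier M" "n \<in> carrier N"
  shows "tsum G (m \<boxtimes>\<^bsub>tensor k M N\<^esub> n) f = f m n"
proof -
  interpret G: module k G by (rule G)
  show ?thesis
    unfolding tensor_def using assms
    by (intro tsum_pure bilinear_biadditive[OF assms(1)] G.abelian_group_axioms)
      (auto dest: tensor_balanced)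
qed

lemma tsum_tensor_closed:
  "t \<in> carrier (tensor k M N) \<Longrightarrow> bilinear k M N G f \<Longrightarrow> tsum G t f \<in> carrier G"
  using linear_map_closed[OF linear_tsum_tensor] .

lemma linear_tsum_arg:
  "linear_map k X (tensor k M N) t \<Longrightarrow> bilinear k M N G f \<Longrightarrow> linear_map k X G (\<lambda>x. tsum G (t x) f)"
  using linear_map_compose[OF _ linear_tsum_tensor] .

text \<open>Both sides are linear in \<open>t\<close> and agree on pure tensors. The summand
  \<open>h\<close> is a variable of its own because it has to match the sum of \<open>f\<close> and
  \<open>g\<close> on the carriers only, as happens in \<open>linear_tsum_fun\<close>.\<close>

lemma tsum_add_fun:
  assumes t: "t \<in> carrier (tensor k M N)" and f: "bilinear k M N G f" and g: "bilinear k M N G g"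
    and fg: "bilinear k M N G h" "\<And>m n. m \<in> carrier M \<Longrightarrow> n \<in> carrier N \<Longrightarrow> h m n = f m n \<oplus>\<^bsub>G\<^esub> g m n"
  shows "tsum G t h = tsum G t f \<oplus>\<^bsub>G\<^esub> tsum G t g"
proof -
  interpret G: module k G by (rule G)
  note lf = linear_tsum_tensor[OF f] and lg = linear_tsum_tensor[OF g]
  have l: "linear_map k (tensor k M N) G (\<lambda>t. tsum G t f \<oplus>\<^bsub>G\<^esub> tsum G t g)"
    using lf lg unfolding linear_map_def by (auto simp: G.smult_r_distr G.a_ac Pi_iff)
  show ?thesis
    by (rule tensor_linear_eqI[OF linear_tsum_tensor[OF fg(1)] l G _ t])
      (simp add: tsum_pure_tensor f g fg)
qed

end

text \<open>Both sides are linear in \<open>t\<close> and agree on pure tensors. This is the main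
  tool for moving a map into a Sweedler sum or out of it.\<close>

lemma linear_map_push:
  assumes G: "module k G" and H: "module k H" and h: "linear_map k G H h"
    and f: "bilinear k M N G f" and t: "t \<in> carrier (tensor k M N)"
  shows "h (tsum G t f) = tsum H t (\<lambda>m n. h (f m n))"
proof (rule tensor_linear_eqI[OF _ _ H _ t])
  have hf: "bilinear k M N H (\<lambda>m n. h (f m n))"
    using f unfolding bilinear_def by (auto intro: linear_map_compose[OF _ h])
  show "linear_map k (tensor k M N) H (\<lambda>t. h (tsum G t f))"
    by (rule linear_map_compose[OF linear_tsum_tensor[OF G f] h])
  show "linear_map k (tensor k M N) H (\<lambda>t. tsum H t (\<lambda>m n. h (f m n)))"
    by (rule linear_tsum_tensor[OF H hf])
  show "h (tsum G (m \<boxtimes>\<^bsub>tensor k M N\<^esub> n) f) = tsum H (m \<boxtimes>\<^bsub>tensor k M N\<^esub> n) (\<lambda>m n. h (f m n))"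
    if "m \<in> carrier M" "n \<in> carrier N" for m n
    using that by (simp add: tsum_pure_tensor G H f hf)
qed

lemma linear_tsum_fun:
  assumes G: "module k G" and X: "module k X" and t: "t \<in> carrier (tensor k M N)"
    and f: "\<And>x. x \<in> carrier X \<Longrightarrow> bilinear k M N G (f x)"
    and fl: "\<And>m n. m \<in> carrier M \<Longrightarrow> n \<in> carrier N \<Longrightarrow> linear_map k X G (\<lambda>x. f x m n)"
  shows "linear_map k X G (\<lambda>x. tsum G t (f x))"
proof (rule linear_mapI)
  interpret X: module k X by (rule X)
  interpret G: module k G by (rule G)
  show "tsum G t (f x) \<in> carrier G" if "x \<in> carrier X" for x
    by (rule tsum_tensor_closed[OF G t f[OF that]])
  show "tsum G t (f (x \<oplus>\<^bsub>X\<^esub> y)) = tsum G t (f x) \<oplus>\<^bsub>G\<^esub> tsum G t (f y)"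
    if "x \<in> carrier X" "y \<in> carrier X" for x y
    by (rule tsum_add_fun[OF G t]) (use that linear_map_add[OF fl] in \<open>auto simp: f\<close>)
  show "tsum G t (f (r \<odot>\<^bsub>X\<^esub> x)) = r \<odot>\<^bsub>G\<^esub> tsum G t (f x)" if "r \<in> carrier k" "x \<in> carrier X" for r x
  proof -
    have l: "linear_map k G G (\<lambda>y. r \<odot>\<^bsub>G\<^esub> y)"
      using that by (intro linear_mapI) (auto simp: G.smult_r_distr G.smult_assoc1[symmetric] M.R.m_comm)
    have "tsum G t (f (r \<odot>\<^bsub>X\<^esub> x)) = tsum G t (\<lambda>m n. r \<odot>\<^bsub>G\<^esub> f x m n)"
      using that linear_map_smult[OF fl] by (intro tsum_cong) (auto simp: tpairs_tensor[OF t])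
    then show ?thesis using linear_map_push[OF G G l f[OF that(2)] t] by simp
  qed
qed

lemma tsum_pure_id:
  assumes t: "t \<in> carrier (tensor k M N)"
  shows "tsum (tensor k M N) t (\<lambda>m n. m \<boxtimes>\<^bsub>tensor k M N\<^esub> n) = t"
proof -
  have "linear_map k (tensor k M N) (tensor k M N) (\<lambda>t. t)"
    by (simp add: linear_map_def)
  from tensor_linear_eqI[OF linear_tsum_tensor[OF module_tensor bilinear_pure_tensor] this module_tensor _ t]
  show ?thesis by (simp add: tsum_pure_tensor[OF module_tensor bilinear_pure_tensor])
qed

end

text \<open>A Fubini rule: both sides are linear in \<open>t\<close>, and for a pure tensor
  \<open>t\<close> the outer or inner sum over it collapses to a single term.\<close>

lemma tsum_swap:
  assumes M: "module k M" and N: "module k N" and P: "module k P" and Q: "module k Q" and G: "module k G"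
    and t: "t \<in> carrier (tensor k M N)" and u: "u \<in> carrier (tensor k P Q)"
    and f: "\<And>m n. m \<in> carrier M \<Longrightarrow> n \<in> carrier N \<Longrightarrow> bilinear k P Q G (f m n)"
    and g: "\<And>p q. p \<in> carrier P \<Longrightarrow> q \<in> carrier Q \<Longrightarrow> bilinear k M N G (\<lambda>m n. f m n p q)"
  shows "tsum G t (\<lambda>m n. tsum G u (f m n)) = tsum G u (\<lambda>p q. tsum G t (\<lambda>m n. f m n p q))"
proof (rule tensor_linear_eqI[OF M N _ _ G _ t])
  have c: "f m n p q \<in> carrier G" if "m \<in> carrier M" "n \<in> carrier N" "p \<in> carrier P" "q \<in> carrier Q" for m n p q
    using bilinear_closed[OF f] that by blast
  have gl: "linear_map k P G (\<lambda>p. f m n p q)"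
    if "m \<in> carrier M" "n \<in> carrier N" "q \<in> carrier Q" for m n q
    using f that by (auto simp: bilinear_def)
  have gr: "linear_map k Q G (\<lambda>q. f m n p q)"
    if "m \<in> carrier M" "n \<in> carrier N" "p \<in> carrier P" for m n p
    using f that by (auto simp: bilinear_def)
  have fl: "linear_map k M G (\<lambda>m. f m n p q)"
    if "n \<in> carrier N" "p \<in> carrier P" "q \<in> carrier Q" for n p q
    using g that by (auto simp: bilinear_def)
  have fr: "linear_map k N G (\<lambda>n. f m n p q)"
    if "m \<in> carrier M" "p \<in> carrier P" "q \<in> carrier Q" for m p q
    using g that by (auto simp: bilinear_def)
  have bl: "bilinear k M N G (\<lambda>m n. tsum G u (f m n))"
    unfolding bilinear_def
    by (intro conjI ballI linear_tsum_fun[OF P Q G _ u] M N f fl fr)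
  show "linear_map k (tensor k M N) G (\<lambda>t. tsum G t (\<lambda>m n. tsum G u (f m n)))"
    by (rule linear_tsum_tensor[OF M N G bl])
  have gb: "bilinear k P Q G (\<lambda>p q. tsum G t (\<lambda>m n. f m n p q))" if "t \<in> carrier (tensor k M N)" for t
    unfolding bilinear_def
    by (intro conjI ballI linear_tsum_fun[OF M N G _ that] P Q g gl gr)
  show "linear_map k (tensor k M N) G (\<lambda>t. tsum G u (\<lambda>p q. tsum G t (\<lambda>m n. f m n p q)))"
    by (intro linear_tsum_fun[OF P Q G module_tensor[OF M N] u] gb linear_tsum_tensor[OF M N G] g)
  fix m n assume mn: "m \<in> carrier M" "n \<in> carrier N"
  then show "tsum G (m \<boxtimes>\<^bsub>tensor k M N\<^esub> n) (\<lambda>m n. tsum G u (f m n)) =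
      tsum G u (\<lambda>p q. tsum G (m \<boxtimes>\<^bsub>tensor k M N\<^esub> n) (\<lambda>m n. f m n p q))"
    by (subst tsum_pure_tensor[OF M N G bl mn])
      (auto intro!: tsum_cong simp: tpairs_tensor[OF P Q u] tsum_pure_tensor[OF M N G g])
qed

lemma tsum_tsum:
  assumes "module k M" "module k N" "module k P" "module k Q" "module k G"
    and "t \<in> carrier (tensor k M N)" "bilinear k M N (tensor k P Q) f" "bilinear k P Q G g"
  shows "tsum G (tsum (tensor k P Q) t f) g = tsum G t (\<lambda>m n. tsum G (f m n) g)"
  by (rule linear_map_push) (use assms in \<open>auto intro: module_tensor linear_tsum_tensor\<close>)

lemma tsum_smult:
  assumes "module k M" "module k N" "module k G"
    and "r \<in> carrier k" "t \<in> carrier (tensor k M N)" "bilinear k M N G f"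
  shows "tsum G (r \<odot>\<^bsub>tensor k M N\<^esub> t) f = r \<odot>\<^bsub>G\<^esub> tsum G t f"
  by (rule linear_map_smult[OF linear_tsum_tensor[OF assms(1-3,6)] assms(4,5)])

lemma smult_tsum:
  assumes "module k M" "module k N" "module k G"
    and "r \<in> carrier k" "t \<in> carrier (tensor k M N)" "bilinear k M N G f"
  shows "r \<odot>\<^bsub>G\<^esub> tsum G t f = tsum G t (\<lambda>m n. r \<odot>\<^bsub>G\<^esub> f m n)"
proof (rule linear_map_push[OF assms(1,2,3,3) _ assms(6,5)])
  interpret G: module k G by fact
  show "linear_map k G G (\<lambda>x. r \<odot>\<^bsub>G\<^esub> x)"
    using assms(4) by (auto simp: linear_map_def G.smult_r_distr G.smult_assoc1[symmetric] G.R.m_comm)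
qed

lemma trilinear_smult:
  assumes "trilinear k M N P G f" "r \<in> carrier k" "m \<in> carrier M" "n \<in> carrier N" "p \<in> carrier P"
  shows "f (r \<odot>\<^bsub>M\<^esub> m) n p = r \<odot>\<^bsub>G\<^esub> f m n p" "f m (r \<odot>\<^bsub>N\<^esub> n) p = r \<odot>\<^bsub>G\<^esub> f m n p"
    "f m n (r \<odot>\<^bsub>P\<^esub> p) = r \<odot>\<^bsub>G\<^esub> f m n p"
  using assms by (auto simp: trilinear_def bilinear_def linear_map_smult[of k M G "\<lambda>m. f m n p"]
    linear_map_smult[of k N G "\<lambda>n. f m n p"] linear_map_smult[of k P G "f m n"])

lemma bilinear_smult:
  assumes "bilinear k M N G f" "r \<in> carrier k" "m \<in> carrier M" "n \<in> carrier N"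
  shows "f (r \<odot>\<^bsub>M\<^esub> m) n = r \<odot>\<^bsub>G\<^esub> f m n" "f m (r \<odot>\<^bsub>N\<^esub> n) = r \<odot>\<^bsub>G\<^esub> f m n"
  using assms by (auto simp: bilinear_def linear_map_smult[of k M G "\<lambda>m. f m n"] linear_map_smult[of k N G "f m"])

lemma carrier_regular_module [simp]: "carrier (regular_module R) = carrier R"
  and add_regular_module [simp]: "add (regular_module R) = add R"
  and smult_regular_module [simp]: "smult (regular_module R) = monoid.mult R"
  and zero_regular_module [simp]: "\<zero>\<^bsub>regular_module R\<^esub> = \<zero>\<^bsub>R\<^esub>"
  by (simp_all add: regular_module_def)

lemma module_regular:
  assumes "cring k" shows "module k (regular_module k)"
proof -
  interpret cring k by fact
  show ?thesis
    by (rule moduleI; (intro abelian_groupI)?)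
      (auto simp: l_distr r_distr m_assoc a_ac is_cring intro: exI[of _ "\<ominus>\<^bsub>k\<^esub> _"] l_neg)
qed

lemma linear_smult:
  assumes "module k M"
  shows "r \<in> carrier k \<Longrightarrow> linear_map k X M g \<Longrightarrow> linear_map k X M (\<lambda>x. r \<odot>\<^bsub>M\<^esub> g x)"
    and "m \<in> carrier M \<Longrightarrow> linear_map k X (regular_module k) h \<Longrightarrow> linear_map k X M (\<lambda>x. h x \<odot>\<^bsub>M\<^esub> m)"
proof -
  interpret M: module k M by fact
  show "r \<in> carrier k \<Longrightarrow> linear_map k X M g \<Longrightarrow> linear_map k X M (\<lambda>x. r \<odot>\<^bsub>M\<^esub> g x)"
    by (auto simp: linear_map_def Pi_iff M.smult_r_distr M.smult_assoc1[symmetric] M.R.m_comm)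
  show "m \<in> carrier M \<Longrightarrow> linear_map k X (regular_module k) h \<Longrightarrow> linear_map k X M (\<lambda>x. h x \<odot>\<^bsub>M\<^esub> m)"
    by (auto simp: linear_map_def Pi_iff M.smult_l_distr M.smult_assoc1)
qed

lemma linear_id: "linear_map k M M (\<lambda>x. x)"
  by (simp add: linear_map_def)

section \<open>Dual bases\<close>

lemma module_left_module:
  assumes "module k M" shows "left_module k M"
proof -
  interpret module k M by fact
  show ?thesis by unfold_locales (auto simp: smult_l_distr smult_r_distr smult_assoc1)
qed

context left_module begin

lemma smult_zero_left: "x \<in> carrier M \<Longrightarrow> \<zero>\<^bsub>R\<^esub> \<odot>\<^bsub>M\<^esub> x = \<zero>\<^bsub>M\<^esub>"
  using smult_l_distr[of "\<zero>\<^bsub>R\<^esub>" "\<zero>\<^bsub>R\<^esub>" x] smult_closed[of "\<zero>\<^bsub>R\<^esub>" x]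
  by (metis M.add.r_cancel_one' R.zero_closed R.r_zero)

lemma smult_zero_right: "r \<in> carrier R \<Longrightarrow> r \<odot>\<^bsub>M\<^esub> \<zero>\<^bsub>M\<^esub> = \<zero>\<^bsub>M\<^esub>"
  using smult_r_distr[of r "\<zero>\<^bsub>M\<^esub>" "\<zero>\<^bsub>M\<^esub>"] smult_closed[of r "\<zero>\<^bsub>M\<^esub>"]
  by (metis M.add.r_cancel_one' M.zero_closed M.r_zero)

lemma smult_finsum:
  assumes "finite U" "\<And>i. i \<in> U \<Longrightarrow> x i \<in> carrier M" "r \<in> carrier R"
  shows "r \<odot>\<^bsub>M\<^esub> (\<Oplus>\<^bsub>M\<^esub>i \<in> U. x i) = (\<Oplus>\<^bsub>M\<^esub>i \<in> U. r \<odot>\<^bsub>M\<^esub> x i)"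
  using assms
proof (induction U rule: finite_induct)
  case (insert i U)
  then have "x \<in> U \<rightarrow> carrier M" "(\<lambda>i. r \<odot>\<^bsub>M\<^esub> x i) \<in> U \<rightarrow> carrier M" by (auto simp: smult_closed)
  then show ?case
    using insert by (simp add: M.finsum_insert smult_r_distr smult_closed)
qed (simp add: smult_zero_right)

lemma support_sum_superset:
  assumes "finite U" "{i \<in> I. f i \<noteq> \<zero>\<^bsub>R\<^esub>} \<subseteq> U" "U \<subseteq> I"
    "\<And>i. i \<in> I \<Longrightarrow> f i \<in> carrier R" "\<And>i. i \<in> I \<Longrightarrow> x i \<in> carrier M"
  shows "(\<Oplus>\<^bsub>M\<^esub>i \<in> {i \<in> I. f i \<noteq> \<zero>\<^bsub>R\<^esub>}. f i \<odot>\<^bsub>M\<^esub> x i) = (\<Oplus>\<^bsub>M\<^esub>i \<in> U. f i \<odot>\<^bsub>M\<^esub> x i)"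
  by (rule M.add.finprod_mono_neutral_cong_left)
    (use assms in \<open>auto simp: subset_iff smult_zero_left smult_closed\<close>)

text \<open>The index set varies with \<open>n\<close>, so additivity is compared over the union of
  the two supports. Of \<open>N\<close> only closure is asked, so that the lemma applies to
  \<open>free_module\<close> directly; \<open>R\<close> may be noncommutative because it will also
  be the ring of coinvariants.\<close>

lemma linear_support_sum:
  assumes f: "\<And>i. i \<in> I \<Longrightarrow> linear_map R N (regular_module R) (f i)"
    and fin: "\<And>n. n \<in> carrier N \<Longrightarrow> finite {i \<in> I. f i n \<noteq> \<zero>\<^bsub>R\<^esub>}"
    and x: "\<And>i. i \<in> I \<Longrightarrow> x i \<in> carrier M"
    and N: "\<And>n n'. n \<in> carrier N \<Longrightarrow> n' \<in> carrier N \<Longrightarrow> n \<oplus>\<^bsub>N\<^esub> n' \<in> carrier N"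
      "\<And>r n. r \<in> carrier R \<Longrightarrow> n \<in> carrier N \<Longrightarrow> r \<odot>\<^bsub>N\<^esub> n \<in> carrier N"
  shows "linear_map R N M (\<lambda>n. \<Oplus>\<^bsub>M\<^esub>i \<in> {i \<in> I. f i n \<noteq> \<zero>\<^bsub>R\<^esub>}. f i n \<odot>\<^bsub>M\<^esub> x i)"
proof (rule linear_mapI)
  let ?S = "\<lambda>n. {i \<in> I. f i n \<noteq> \<zero>\<^bsub>R\<^esub>}"
  have fc: "f i n \<in> carrier R" if "i \<in> I" "n \<in> carrier N" for i n
    using linear_map_closed[OF f] that by simp
  have cl: "(\<lambda>i. f i n \<odot>\<^bsub>M\<^esub> x i) \<in> U \<rightarrow> carrier M" if "U \<subseteq> I" "n \<in> carrier N" for U n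
  proof (rule Pi_I)
    fix i assume "i \<in> U"
    then have "i \<in> I" using that by blast
    then show "f i n \<odot>\<^bsub>M\<^esub> x i \<in> carrier M" using fc x that by (intro smult_closed)
  qed
  show "(\<Oplus>\<^bsub>M\<^esub>i \<in> ?S n. f i n \<odot>\<^bsub>M\<^esub> x i) \<in> carrier M" if "n \<in> carrier N" for n
    by (rule M.finsum_closed) (use cl[OF _ that] in blast)
  show "(\<Oplus>\<^bsub>M\<^esub>i \<in> ?S (n \<oplus>\<^bsub>N\<^esub> n'). f i (n \<oplus>\<^bsub>N\<^esub> n') \<odot>\<^bsub>M\<^esub> x i) =
      (\<Oplus>\<^bsub>M\<^esub>i \<in> ?S n. f i n \<odot>\<^bsub>M\<^esub> x i) \<oplus>\<^bsub>M\<^esub> (\<Oplus>\<^bsub>M\<^esub>i \<in> ?S n'. f i n' \<odot>\<^bsub>M\<^esub> x i)"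
    if n: "n \<in> carrier N" "n' \<in> carrier N" for n n'
  proof -
    let ?U = "?S n \<union> ?S n'"
    have U: "finite ?U" "?U \<subseteq> I" using fin n by auto
    have e: "f i (n \<oplus>\<^bsub>N\<^esub> n') = f i n \<oplus>\<^bsub>R\<^esub> f i n'" if "i \<in> I" for i
      using linear_map_add[OF f[OF that] n] by simp
    have "(\<Oplus>\<^bsub>M\<^esub>i \<in> ?S (n \<oplus>\<^bsub>N\<^esub> n'). f i (n \<oplus>\<^bsub>N\<^esub> n') \<odot>\<^bsub>M\<^esub> x i) = (\<Oplus>\<^bsub>M\<^esub>i \<in> ?U. f i (n \<oplus>\<^bsub>N\<^esub> n') \<odot>\<^bsub>M\<^esub> x i)"
      by (rule support_sum_superset) (use U fc x N n in \<open>auto simp: e\<close>)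
    also have "\<dots> = (\<Oplus>\<^bsub>M\<^esub>i \<in> ?U. f i n \<odot>\<^bsub>M\<^esub> x i \<oplus>\<^bsub>M\<^esub> f i n' \<odot>\<^bsub>M\<^esub> x i)"
      by (rule M.finsum_cong') (use U fc x n in \<open>auto simp: e smult_l_distr smult_closed\<close>)
    also have "\<dots> = (\<Oplus>\<^bsub>M\<^esub>i \<in> ?U. f i n \<odot>\<^bsub>M\<^esub> x i) \<oplus>\<^bsub>M\<^esub> (\<Oplus>\<^bsub>M\<^esub>i \<in> ?U. f i n' \<odot>\<^bsub>M\<^esub> x i)"
      by (rule M.finsum_addf; rule cl[OF U(2)]; fact n)
    also have "(\<Oplus>\<^bsub>M\<^esub>i \<in> ?U. f i n \<odot>\<^bsub>M\<^esub> x i) = (\<Oplus>\<^bsub>M\<^esub>i \<in> ?S n. f i n \<odot>\<^bsub>M\<^esub> x i)"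
      by (rule support_sum_superset[symmetric]) (use U fc x n in auto)
    also have "(\<Oplus>\<^bsub>M\<^esub>i \<in> ?U. f i n' \<odot>\<^bsub>M\<^esub> x i) = (\<Oplus>\<^bsub>M\<^esub>i \<in> ?S n'. f i n' \<odot>\<^bsub>M\<^esub> x i)"
      by (rule support_sum_superset[symmetric]) (use U fc x n in auto)
    finally show ?thesis .
  qed
  show "(\<Oplus>\<^bsub>M\<^esub>i \<in> ?S (r \<odot>\<^bsub>N\<^esub> n). f i (r \<odot>\<^bsub>N\<^esub> n) \<odot>\<^bsub>M\<^esub> x i) = r \<odot>\<^bsub>M\<^esub> (\<Oplus>\<^bsub>M\<^esub>i \<in> ?S n. f i n \<odot>\<^bsub>M\<^esub> x i)"
    if n: "n \<in> carrier N" and r: "r \<in> carrier R" for n r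
  proof -
    have e: "f i (r \<odot>\<^bsub>N\<^esub> n) = r \<otimes>\<^bsub>R\<^esub> f i n" if "i \<in> I" for i
      using linear_map_smult[OF f[OF that] r n] by simp
    have "(\<Oplus>\<^bsub>M\<^esub>i \<in> ?S (r \<odot>\<^bsub>N\<^esub> n). f i (r \<odot>\<^bsub>N\<^esub> n) \<odot>\<^bsub>M\<^esub> x i) = (\<Oplus>\<^bsub>M\<^esub>i \<in> ?S n. f i (r \<odot>\<^bsub>N\<^esub> n) \<odot>\<^bsub>M\<^esub> x i)"
      by (rule support_sum_superset) (use fin[OF n] fc x N n r in \<open>auto simp: e\<close>)
    also have "\<dots> = (\<Oplus>\<^bsub>M\<^esub>i \<in> ?S n. r \<odot>\<^bsub>M\<^esub> (f i n \<odot>\<^bsub>M\<^esub> x i))"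
      by (rule M.finsum_cong') (use fc x n r in \<open>auto simp: e smult_assoc smult_closed\<close>)
    also have "\<dots> = r \<odot>\<^bsub>M\<^esub> (\<Oplus>\<^bsub>M\<^esub>i \<in> ?S n. f i n \<odot>\<^bsub>M\<^esub> x i)"
      by (rule smult_finsum[symmetric]) (use fin[OF n] fc x n r in \<open>auto simp: smult_closed\<close>)
    finally show ?thesis .
  qed
qed

end

lemma linear_map_finsum:
  assumes f: "linear_map k M N f" and M: "abelian_group M" and N: "abelian_group N"
    and U: "finite U" "\<And>i. i \<in> U \<Longrightarrow> x i \<in> carrier M"
  shows "f (\<Oplus>\<^bsub>M\<^esub>i \<in> U. x i) = (\<Oplus>\<^bsub>N\<^esub>i \<in> U. f (x i))"
proof -
  interpret M: abelian_group M by fact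
  interpret N: abelian_group N by fact
  show ?thesis
    using U
  proof (induction U rule: finite_induct)
    case (insert i U)
    then have "x \<in> U \<rightarrow> carrier M" "(\<lambda>i. f (x i)) \<in> U \<rightarrow> carrier N" using linear_map_closed[OF f] by auto
    then show ?case
      using insert linear_map_closed[OF f]
        by (simp add: M.finsum_insert N.finsum_insert linear_map_add[OF f])
  qed (simp add: linear_map_zero[OF f M N])
qed

lemma linear_finsum:
  assumes M: "module k M" and N: "module k N" and U: "finite U"
    and f: "\<And>i. i \<in> U \<Longrightarrow> linear_map k M N (f i)"
  shows "linear_map k M N (\<lambda>m. \<Oplus>\<^bsub>N\<^esub>i \<in> U. f i m)"
  using U f
proof (induction U rule: finite_induct)
  interpret N: module k N by fact
  case empty
  then show ?case by (simp add: linear_map_def)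
next
  interpret N: module k N by fact
  case (insert i U)
  have c: "f j m \<in> carrier N" if "j \<in> insert i U" "m \<in> carrier M" for j m
    using linear_map_closed[OF insert.prems] that by blast
  have l: "linear_map k M N (\<lambda>m. f i m \<oplus>\<^bsub>N\<^esub> (\<Oplus>\<^bsub>N\<^esub>j \<in> U. f j m))"
    using insert.IH insert.prems unfolding linear_map_def
    by (auto simp: N.a_ac N.smult_r_distr Pi_iff)
  have e: "(\<Oplus>\<^bsub>N\<^esub>j \<in> insert i U. f j m) = f i m \<oplus>\<^bsub>N\<^esub> (\<Oplus>\<^bsub>N\<^esub>j \<in> U. f j m)" if "m \<in> carrier M" for m
    by (rule N.finsum_insert) (use insert.hyps c that in auto)
  show ?case by (rule linear_map_cong[OF l M e[symmetric]])
qed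

section \<open>Dual bases of projective modules and the expansion of tensors along them\<close>

definition dual_basis ::
  "('k, 'x) ring_scheme \<Rightarrow> ('k, 'n, 'z) module_scheme \<Rightarrow> 'i set \<Rightarrow> ('i \<Rightarrow> 'n \<Rightarrow> 'k) \<Rightarrow> ('i \<Rightarrow> 'n) \<Rightarrow> bool"
  where "dual_basis k N I f e \<longleftrightarrow>
    (\<forall>i \<in> I. linear_map k N (regular_module k) (f i) \<and> e i \<in> carrier N) \<and>
    (\<forall>n \<in> carrier N. finite {i \<in> I. f i n \<noteq> \<zero>\<^bsub>k\<^esub>} \<and>
      (\<Oplus>\<^bsub>N\<^esub>i \<in> {i \<in> I. f i n \<noteq> \<zero>\<^bsub>k\<^esub>}. f i n \<odot>\<^bsub>N\<^esub> e i) = n)"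

text \<open>The functionals are the coordinates of the embedding \<open>\<iota>\<close>, and the
  vectors are the images under \<open>\<pi>\<close> of the unit vectors.\<close>

lemma projective_dual_basis:
  assumes P: "projective k N"
  obtains I :: "'n set" and f and e where "dual_basis k (N :: ('k, 'n, 'z) module_scheme) I f e"
proof -
  interpret left_module k N using P by (simp add: projective_def)
  obtain I :: "'n set" and \<iota> \<pi> where io: "linear_map k N (free_module k I) \<iota>"
    and pi: "linear_map k (free_module k I) N \<pi>" and pio: "\<And>n. n \<in> carrier N \<Longrightarrow> \<pi> (\<iota> n) = n"
    using P unfolding projective_def by blast
  let ?F = "free_module k I"
  define u where "u i = (\<lambda>j \<in> I. if j = i then \<one>\<^bsub>k\<^esub> else \<zero>\<^bsub>k\<^esub>)" for i
  have u: "u i \<in> carrier ?F" if "i \<in> I" for i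
  proof -
    have "{j \<in> I. u i j \<noteq> \<zero>\<^bsub>k\<^esub>} \<subseteq> {i}" unfolding u_def by auto
    then show ?thesis using finite_subset by (auto simp: free_module_def u_def)
  qed
  have pu: "\<pi> (u i) \<in> carrier N" if "i \<in> I" for i using linear_map_closed[OF pi u[OF that]] .
  \<comment> \<open>Since \<open>U\<close> need only contain the support and \<open>g\<close> is
    arbitrary, the induction can remove one index from \<open>U\<close> and pass to a function that
    vanishes there.\<close>
  have *: "\<pi> g = (\<Oplus>\<^bsub>N\<^esub>i \<in> U. g i \<odot>\<^bsub>N\<^esub> \<pi> (u i))"
    if "finite U" "U \<subseteq> I" "g \<in> carrier ?F" "\<And>i. i \<in> I \<Longrightarrow> i \<notin> U \<Longrightarrow> g i = \<zero>\<^bsub>k\<^esub>" for U g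
    using that
  proof (induction U arbitrary: g rule: finite_induct)
    case empty
    \<comment> \<open>Written as a multiple by zero, the zero function has its image determined by
      \<open>linear_map_smult\<close>, with no appeal to a group structure on the free
      module.\<close>
    then have g: "g = \<zero>\<^bsub>k\<^esub> \<odot>\<^bsub>?F\<^esub> g" by (auto simp: free_module_def PiE_def extensional_def fun_eq_iff)
    have "\<pi> (\<zero>\<^bsub>k\<^esub> \<odot>\<^bsub>?F\<^esub> g) = \<zero>\<^bsub>N\<^esub>"
      using linear_map_smult[OF pi, of "\<zero>\<^bsub>k\<^esub>" g] empty linear_map_closed[OF pi, of g] smult_zero_left
        by simp
    then show ?case using g by simp
  next
    case (insert i U)
    define g' where "g' = (\<lambda>j \<in> I. if j = i then \<zero>\<^bsub>k\<^esub> else g j)"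
    have gc: "j \<in> I \<Longrightarrow> g j \<in> carrier k" for j using insert.prems by (auto simp: free_module_def)
    have "{j \<in> I. g' j \<noteq> \<zero>\<^bsub>k\<^esub>} \<subseteq> {j \<in> I. g j \<noteq> \<zero>\<^bsub>k\<^esub>}" unfolding g'_def by auto
    moreover have "finite {j \<in> I. g j \<noteq> \<zero>\<^bsub>k\<^esub>}" using insert.prems(2) by (simp add: free_module_def)
    ultimately have "finite {j \<in> I. g' j \<noteq> \<zero>\<^bsub>k\<^esub>}" by (rule finite_subset)
    moreover have "g' \<in> I \<rightarrow>\<^sub>E carrier k" using gc by (auto simp: g'_def)
    ultimately have g': "g' \<in> carrier ?F" by (simp add: free_module_def)
    have i: "i \<in> I" and U: "U \<subseteq> I" using insert.prems by auto
    have gu: "g i \<odot>\<^bsub>?F\<^esub> u i \<in> carrier ?F"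
    proof -
      have "{j \<in> I. (g i \<odot>\<^bsub>?F\<^esub> u i) j \<noteq> \<zero>\<^bsub>k\<^esub>} \<subseteq> {i}" unfolding u_def using gc[OF i]
        by (auto simp: free_module_def)
      then show ?thesis using finite_subset gc[OF i] by (auto simp: free_module_def u_def)
    qed
    have "g = (g i \<odot>\<^bsub>?F\<^esub> u i) \<oplus>\<^bsub>?F\<^esub> g'"
      using insert.prems(2) gc i
      by (auto simp: free_module_def g'_def u_def PiE_def extensional_def fun_eq_iff)
    then have "\<pi> g = \<pi> (g i \<odot>\<^bsub>?F\<^esub> u i) \<oplus>\<^bsub>N\<^esub> \<pi> g'"
      using linear_map_add[OF pi gu g'] by simp
    also have "\<dots> = g i \<odot>\<^bsub>N\<^esub> \<pi> (u i) \<oplus>\<^bsub>N\<^esub> \<pi> g'"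
      using linear_map_smult[OF pi gc[OF i] u[OF i]] by simp
    also have "\<pi> g' = (\<Oplus>\<^bsub>N\<^esub>j \<in> U. g' j \<odot>\<^bsub>N\<^esub> \<pi> (u j))"
      by (rule insert.IH[OF U g']) (use insert.prems(3) in \<open>auto simp: g'_def\<close>)
    also have "\<dots> = (\<Oplus>\<^bsub>N\<^esub>j \<in> U. g j \<odot>\<^bsub>N\<^esub> \<pi> (u j))"
      by (rule finsum_cong_raw) (use insert.hyps U in \<open>auto simp: g'_def\<close>)
    also have "g i \<odot>\<^bsub>N\<^esub> \<pi> (u i) \<oplus>\<^bsub>N\<^esub> \<dots> = (\<Oplus>\<^bsub>N\<^esub>j \<in> insert i U. g j \<odot>\<^bsub>N\<^esub> \<pi> (u j))"
      by (rule M.finsum_insert[symmetric]) (use insert.hyps i U gc pu in \<open>auto intro!: smult_closed\<close>)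
    finally show ?case .
  qed
  have "dual_basis k N I (\<lambda>i n. \<iota> n i) (\<lambda>i. \<pi> (u i))"
    unfolding dual_basis_def
  proof (intro conjI ballI)
    fix i assume i: "i \<in> I"
    show "linear_map k N (regular_module k) (\<lambda>n. \<iota> n i)"
      using io i unfolding linear_map_def by (auto simp: free_module_def Pi_iff)
    show "\<pi> (u i) \<in> carrier N" by (rule pu[OF i])
  next
    fix n assume n: "n \<in> carrier N"
    have "\<iota> n \<in> carrier ?F" by (rule linear_map_closed[OF io n])
    then show fin: "finite {i \<in> I. \<iota> n i \<noteq> \<zero>\<^bsub>k\<^esub>}" by (simp add: free_module_def)
    show "(\<Oplus>\<^bsub>N\<^esub>i \<in> {i \<in> I. \<iota> n i \<noteq> \<zero>\<^bsub>k\<^esub>}. \<iota> n i \<odot>\<^bsub>N\<^esub> \<pi> (u i)) = n"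
      using *[OF fin _ linear_map_closed[OF io n]] pio[OF n] by simp
  qed
  then show thesis by (rule that)
qed

lemma dual_basisD:
  assumes "dual_basis k N I f e"
  shows "i \<in> I \<Longrightarrow> linear_map k N (regular_module k) (f i)" "i \<in> I \<Longrightarrow> e i \<in> carrier N"
    "n \<in> carrier N \<Longrightarrow> finite {i \<in> I. f i n \<noteq> \<zero>\<^bsub>k\<^esub>}"
    "i \<in> I \<Longrightarrow> n \<in> carrier N \<Longrightarrow> f i n \<in> carrier k"
  using assms linear_map_closed[of k N "regular_module k" "f i" n] by (auto simp: dual_basis_def)

lemma dual_basis_expand:
  assumes N: "module k N" and d: "dual_basis k N I f e"
    and n: "n \<in> carrier N" and U: "finite U" "{i \<in> I. f i n \<noteq> \<zero>\<^bsub>k\<^esub>} \<subseteq> U" "U \<subseteq> I"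
  shows "(\<Oplus>\<^bsub>N\<^esub>i \<in> U. f i n \<odot>\<^bsub>N\<^esub> e i) = n"
proof -
  interpret left_module k N by (rule module_left_module[OF N])
  show ?thesis
    using support_sum_superset[OF U, of e] dual_basisD[OF d] n d by (auto simp: dual_basis_def)
qed

text \<open>Only finitely many slices of a tensor are nonzero, and the tensor is recovered from them.\<close>

lemma tensor_expand:
  assumes M: "module k M" and N: "module k N" and d: "dual_basis k N I f e"
    and t: "t \<in> carrier (tensor k M N)"
  shows "\<exists>V. finite V \<and> V \<subseteq> I \<and> (\<forall>i \<in> I - V. tsum M t (\<lambda>m n. f i n \<odot>\<^bsub>M\<^esub> m) = \<zero>\<^bsub>M\<^esub>) \<and>
    (\<forall>U. finite U \<longrightarrow> V \<subseteq> U \<longrightarrow> U \<subseteq> I \<longrightarrow>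
      (\<Oplus>\<^bsub>tensor k M N\<^esub>i \<in> U. tsum M t (\<lambda>m n. f i n \<odot>\<^bsub>M\<^esub> m) \<boxtimes>\<^bsub>tensor k M N\<^esub> e i) = t)"
proof -
  let ?T = "tensor k M N"
  interpret M: module k M by fact
  interpret N: module k N by fact
  interpret T: module k "?T" by (rule module_tensor[OF M N])
  note D = dual_basisD[OF d]
  have b: "bilinear k M N M (\<lambda>m n. f i n \<odot>\<^bsub>M\<^esub> m)" if "i \<in> I" for i
    unfolding bilinear_def
    using that by (auto intro!: linear_smult[OF M] linear_id D)
  note ls = linear_tsum_tensor[OF M N M b]
  define L where "L U t = (\<Oplus>\<^bsub>?T\<^esub>i \<in> U. tsum M t (\<lambda>m n. f i n \<odot>\<^bsub>M\<^esub> m) \<boxtimes>\<^bsub>?T\<^esub> e i)" for U t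
  have L: "linear_map k (?T) (?T) (L U)" if "finite U" "U \<subseteq> I" for U
    unfolding L_def
    using that by (intro linear_finsum module_tensor M N linear_pure_tensor(2)[OF M N] ls D) auto
  let ?P = "\<lambda>t V. finite V \<and> V \<subseteq> I \<and> (\<forall>i \<in> I - V. tsum M t (\<lambda>m n. f i n \<odot>\<^bsub>M\<^esub> m) = \<zero>\<^bsub>M\<^esub>) \<and>
    (\<forall>U. finite U \<longrightarrow> V \<subseteq> U \<longrightarrow> U \<subseteq> I \<longrightarrow> L U t = t)"
  have "\<exists>V. ?P t V"
    using t
  proof (induction t rule: tensor_induct[OF M N, consumes 1, case_names pure diff])
    case (pure m n)
    let ?V = "{i \<in> I. f i n \<noteq> \<zero>\<^bsub>k\<^esub>}"
    have "L U (m \<boxtimes>\<^bsub>?T\<^esub> n) = m \<boxtimes>\<^bsub>?T\<^esub> n" if U: "finite U" "?V \<subseteq> U" "U \<subseteq> I" for U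
    proof -
      have ei: "i \<in> U \<Longrightarrow> f i n \<odot>\<^bsub>N\<^esub> e i \<in> carrier N" for i using U D pure by auto
      have "L U (m \<boxtimes>\<^bsub>?T\<^esub> n) = (\<Oplus>\<^bsub>?T\<^esub>i \<in> U. m \<boxtimes>\<^bsub>?T\<^esub> (f i n \<odot>\<^bsub>N\<^esub> e i))"
        unfolding L_def
      proof (rule finsum_cong_raw)
        fix i assume "i \<in> U"
        then have i: "i \<in> I" using U by blast
        show "tsum M (m \<boxtimes>\<^bsub>?T\<^esub> n) (\<lambda>m n. f i n \<odot>\<^bsub>M\<^esub> m) \<boxtimes>\<^bsub>?T\<^esub> e i =
          m \<boxtimes>\<^bsub>?T\<^esub> (f i n \<odot>\<^bsub>N\<^esub> e i)"
          using pure i D bilinear_smult[OF bilinear_pure_tensor[OF M N], of "f i n" m "e i"]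
          by (simp add: tsum_pure_tensor[OF M N M b])
      qed
      also have "\<dots> = m \<boxtimes>\<^bsub>?T\<^esub> (\<Oplus>\<^bsub>N\<^esub>i \<in> U. f i n \<odot>\<^bsub>N\<^esub> e i)"
        by (rule linear_map_finsum[symmetric, OF linear_pure_tensor(1)[OF M N pure(1) linear_id]
          N.abelian_group_axioms T.abelian_group_axioms U(1) ei])
      finally show ?thesis by (simp add: dual_basis_expand[OF N d pure(2) U])
    qed
    moreover have "tsum M (m \<boxtimes>\<^bsub>?T\<^esub> n) (\<lambda>m n. f i n \<odot>\<^bsub>M\<^esub> m) = \<zero>\<^bsub>M\<^esub>" if "i \<in> I - ?V" for i
      using that pure by (simp add: tsum_pure_tensor[OF M N M b])
    ultimately have "?P (m \<boxtimes>\<^bsub>?T\<^esub> n) ?V" using D(3)[OF pure(2)] by simp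
    then show ?case by (rule exI)
  next
    case (diff t u)
    from diff(3) obtain V where V: "?P t V" by (elim exE)
    from diff(4) obtain W where W: "?P u W" by (elim exE)
    note V' = V[THEN conjunct2, THEN conjunct2, THEN conjunct1, rule_format]
      V[THEN conjunct2, THEN conjunct2, THEN conjunct2, rule_format]
    note W' = W[THEN conjunct2, THEN conjunct2, THEN conjunct1, rule_format]
      W[THEN conjunct2, THEN conjunct2, THEN conjunct2, rule_format]
    \<comment> \<open>The expansion was required for every finite superset of \<open>V\<close>,
      precisely so that the union of two index sets serves both tensors.\<close>
    have "?P (t \<ominus>\<^bsub>?T\<^esub> u) (V \<union> W)"
    proof (intro conjI allI impI ballI)
      fix i assume i: "i \<in> I - (V \<union> W)"
      then have "tsum M t (\<lambda>m n. f i n \<odot>\<^bsub>M\<^esub> m) = \<zero>\<^bsub>M\<^esub>" "tsum M u (\<lambda>m n. f i n \<odot>\<^bsub>M\<^esub> m) = \<zero>\<^bsub>M\<^esub>"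
        by (simp_all add: V'(1) W'(1))
      then show "tsum M (t \<ominus>\<^bsub>?T\<^esub> u) (\<lambda>m n. f i n \<odot>\<^bsub>M\<^esub> m) = \<zero>\<^bsub>M\<^esub>"
        using hom_add_monoid_minus[OF linear_map_hom[OF ls] T.abelian_group_axioms M.abelian_group_axioms diff(1,2), of i] i
        by (simp add: a_minus_def)
    next
      fix U assume U: "finite U" "V \<union> W \<subseteq> U" "U \<subseteq> I"
      then have "L U t = t" "L U u = u" by (simp_all add: V'(2) W'(2))
      then show "L U (t \<ominus>\<^bsub>?T\<^esub> u) = t \<ominus>\<^bsub>?T\<^esub> u"
        using hom_add_monoid_minus[OF linear_map_hom[OF L[OF U(1,3)]] T.abelian_group_axioms T.abelian_group_axioms diff(1,2)]
        by simp
    qed (use V[THEN conjunct1] W[THEN conjunct1] V[THEN conjunct2, THEN conjunct1] W[THEN conjunct2, THEN conjunct1] in simp_all)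
    then show ?case by (rule exI)
  qed
  then show ?thesis unfolding L_def .
qed

text \<open>Projective modules are flat, seen through coordinates: slicing commutes with the
  injective map \<open>g\<close>, so the image determines all slices of a tensor, and the slices
  determine the tensor.\<close>

lemma injective_tensor:
  assumes M: "module k M" and M': "module k M'" and N: "module k N" and d: "dual_basis k N I f e"
    and g: "linear_map k M' M g" "inj_on g (carrier M')"
  shows "inj_on (\<lambda>t. tsum (tensor k M N) t (\<lambda>m n. g m \<boxtimes>\<^bsub>tensor k M N\<^esub> n)) (carrier (tensor k M' N))"
proof (rule inj_onI)
  let ?T' = "tensor k M' N"
  let ?T = "tensor k M N"
  interpret M': module k M' by fact
  interpret T: module k "?T" by (rule module_tensor[OF M N])
  interpret T': module k "?T'" by (rule module_tensor[OF M' N])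
  note D = dual_basisD[OF d]
  let ?j = "\<lambda>t. tsum (?T) t (\<lambda>m n. g m \<boxtimes>\<^bsub>?T\<^esub> n)"
  fix t u assume t: "t \<in> carrier (?T')" and u: "u \<in> carrier (?T')" and e: "?j t =
    ?j u"
  have b: "bilinear k L N L (\<lambda>m n. f i n \<odot>\<^bsub>L\<^esub> m)" if "i \<in> I" "module k L" for i and L :: "('a, 'q, 'r) module_scheme"
    unfolding bilinear_def
    using that by (auto intro!: linear_smult linear_id D)
  have bg: "bilinear k M' N (?T) (\<lambda>m n. g m \<boxtimes>\<^bsub>?T\<^esub> n)"
    unfolding bilinear_def
    using linear_map_closed[OF g(1)] by (auto intro!: linear_pure_tensor[OF M N] linear_id g)
  have slice: "g (tsum M' v (\<lambda>m n. f i n \<odot>\<^bsub>M'\<^esub> m)) = tsum M (?j v) (\<lambda>m n. f i n \<odot>\<^bsub>M\<^esub> m)"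
    if "i \<in> I" "v \<in> carrier (?T')" for i v
  proof -
    have "g (tsum M' v (\<lambda>m n. f i n \<odot>\<^bsub>M'\<^esub> m)) = tsum M v (\<lambda>m n. g (f i n \<odot>\<^bsub>M'\<^esub> m))"
      by (rule linear_map_push[OF M' N M' M g(1) b[OF that(1) M'] that(2)])
    also have "\<dots> = tsum M v (\<lambda>m n. tsum M (g m \<boxtimes>\<^bsub>?T\<^esub> n) (\<lambda>m n. f i n \<odot>\<^bsub>M\<^esub> m))"
      by (rule tsum_cong[OF refl])
        (use that D linear_map_closed[OF g(1)] in
          \<open>simp add: tpairs_tensor[OF M' N] linear_map_smult[OF g(1)] tsum_pure_tensor[OF M N M b[OF _ M]]\<close>)
    also have "\<dots> = tsum M (?j v) (\<lambda>m n. f i n \<odot>\<^bsub>M\<^esub> m)"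
      by (rule tsum_tsum[symmetric, OF M' N M N M that(2) bg b[OF that(1) M]])
    finally show ?thesis .
  qed
  have same: "tsum M' t (\<lambda>m n. f i n \<odot>\<^bsub>M'\<^esub> m) = tsum M' u (\<lambda>m n. f i n \<odot>\<^bsub>M'\<^esub> m)" if "i \<in> I" for i
    using slice[OF that t] slice[OF that u] e
      tsum_tensor_closed[OF M' N M' t b[OF that M']] tsum_tensor_closed[OF M' N M' u b[OF that M']]
      inj_onD[OF g(2)] by simp
  obtain V where V: "finite V" "V \<subseteq> I" "\<And>U. finite U \<Longrightarrow> V \<subseteq> U \<Longrightarrow> U \<subseteq> I \<Longrightarrow>
      (\<Oplus>\<^bsub>?T'\<^esub>i \<in> U. tsum M' t (\<lambda>m n. f i n \<odot>\<^bsub>M'\<^esub> m) \<boxtimes>\<^bsub>?T'\<^esub> e i) = t"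
    using tensor_expand[OF M' N d t] by blast
  obtain W where W: "finite W" "W \<subseteq> I" "\<And>U. finite U \<Longrightarrow> W \<subseteq> U \<Longrightarrow> U \<subseteq> I \<Longrightarrow>
      (\<Oplus>\<^bsub>?T'\<^esub>i \<in> U. tsum M' u (\<lambda>m n. f i n \<odot>\<^bsub>M'\<^esub> m) \<boxtimes>\<^bsub>?T'\<^esub> e i) = u"
    using tensor_expand[OF M' N d u] by blast
  have "t = (\<Oplus>\<^bsub>?T'\<^esub>i \<in> V \<union> W. tsum M' t (\<lambda>m n. f i n \<odot>\<^bsub>M'\<^esub> m) \<boxtimes>\<^bsub>?T'\<^esub> e i)"
    by (rule V(3)[symmetric]) (use V W in auto)
  also have "\<dots> = (\<Oplus>\<^bsub>?T'\<^esub>i \<in> V \<union> W. tsum M' u (\<lambda>m n. f i n \<odot>\<^bsub>M'\<^esub> m) \<boxtimes>\<^bsub>?T'\<^esub> e i)"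
    by (rule finsum_cong_raw) (use V(2) W(2) same in auto)
  also have "\<dots> = u"
    by (rule W(3)) (use V W in auto)
  finally show "t = u" .
qed

text \<open>Once all slices lie in the submodule, the finite expansion of \<open>t\<close> can be
  formed in the tensor product of the submodule already.\<close>

lemma submodule_tensor:
  assumes M: "module k M" and M': "module k M'" and N: "module k N" and d: "dual_basis k N I f e"
    and g: "linear_map k M' M (\<lambda>m. m)"
    and t: "t \<in> carrier (tensor k M N)"
    and s: "\<And>i. i \<in> I \<Longrightarrow> tsum M t (\<lambda>m n. f i n \<odot>\<^bsub>M\<^esub> m) \<in> carrier M'"
  shows "\<exists>u \<in> carrier (tensor k M' N). tsum (tensor k M N) u (\<lambda>m n. m \<boxtimes>\<^bsub>tensor k M N\<^esub> n) = t"
proof -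
  let ?T' = "tensor k M' N"
  let ?T = "tensor k M N"
  interpret T: module k "?T" by (rule module_tensor[OF M N])
  interpret T': module k "?T'" by (rule module_tensor[OF M' N])
  note D = dual_basisD[OF d]
  obtain V where V: "finite V" "V \<subseteq> I" "\<And>U. finite U \<Longrightarrow> V \<subseteq> U \<Longrightarrow> U \<subseteq> I \<Longrightarrow>
      (\<Oplus>\<^bsub>?T\<^esub>i \<in> U. tsum M t (\<lambda>m n. f i n \<odot>\<^bsub>M\<^esub> m) \<boxtimes>\<^bsub>?T\<^esub> e i) = t"
    using tensor_expand[OF M N d t] by blast
  let ?x = "\<lambda>i. tsum M t (\<lambda>m n. f i n \<odot>\<^bsub>M\<^esub> m) \<boxtimes>\<^bsub>?T'\<^esub> e i"
  have x: "?x i \<in> carrier (?T')" if "i \<in> V" for i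
    using that V(2) s D by (auto intro!: pure_tensor_closed[OF M' N])
  have b: "bilinear k M' N (?T) (\<lambda>m n. m \<boxtimes>\<^bsub>?T\<^esub> n)"
    unfolding bilinear_def
    using linear_map_closed[OF g] by (auto intro!: linear_pure_tensor[OF M N] linear_id g)
  have "tsum (?T) (\<Oplus>\<^bsub>?T'\<^esub>i \<in> V. ?x i) (\<lambda>m n. m \<boxtimes>\<^bsub>?T\<^esub> n) =
      (\<Oplus>\<^bsub>?T\<^esub>i \<in> V. tsum (?T) (?x i) (\<lambda>m n. m \<boxtimes>\<^bsub>?T\<^esub> n))"
    by (rule linear_map_finsum[OF linear_tsum_tensor[OF M' N T.module_axioms b]
      T'.abelian_group_axioms T.abelian_group_axioms V(1) x])
  also have "\<dots> = (\<Oplus>\<^bsub>?T\<^esub>i \<in> V. tsum M t (\<lambda>m n. f i n \<odot>\<^bsub>M\<^esub> m) \<boxtimes>\<^bsub>?T\<^esub> e i)"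
    by (rule finsum_cong_raw) (use V(2) s D in \<open>auto simp: tsum_pure_tensor[OF M' N T.module_axioms b]\<close>)
  also have "\<dots> = t" using V by blast
  finally show ?thesis
    using T'.finsum_closed[of ?x V] x by blast
qed

section \<open>Invertible weak entwining structures\<close>

lemma linear_op:
  assumes "linear_map k M N f"
  shows "linear_map k M N f" "linear_map k X M g \<Longrightarrow> linear_map k X N (\<lambda>x. f (g x))"
    "m \<in> carrier M \<Longrightarrow> f m \<in> carrier N"
  using assms by (auto intro: linear_map_compose linear_map_closed)

text \<open>These are bundled so that one instantiation per pair of factors provides membership,
  closure, linearity and the flattening of nested sums.\<close>

lemma tensor_rules:
  assumes M: "module k M" and N: "module k N"
  shows "t \<in> carrier (tensor k M N) \<Longrightarrow> tpairs t = carrier M \<times> carrier N"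
    "module k G \<Longrightarrow> t \<in> carrier (tensor k M N) \<Longrightarrow> bilinear k M N G f \<Longrightarrow> tsum G t f \<in> carrier G"
    "module k G \<Longrightarrow> linear_map k X (tensor k M N) u \<Longrightarrow> bilinear k M N G f \<Longrightarrow>
      linear_map k X G (\<lambda>x. tsum G (u x) f)"
    "module k G \<Longrightarrow> module k X \<Longrightarrow> t \<in> carrier (tensor k M N) \<Longrightarrow>
      (\<And>x. x \<in> carrier X \<Longrightarrow> bilinear k M N G (g x)) \<Longrightarrow>
      (\<And>m n. m \<in> carrier M \<Longrightarrow> n \<in> carrier N \<Longrightarrow> linear_map k X G (\<lambda>x. g x m n)) \<Longrightarrow>
      linear_map k X G (\<lambda>x. tsum G t (g x))"
    "module k P \<Longrightarrow> module k Q \<Longrightarrow> module k G \<Longrightarrow> t \<in> carrier (tensor k M N) \<Longrightarrow>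
      bilinear k M N (tensor k P Q) h \<Longrightarrow> bilinear k P Q G i \<Longrightarrow>
      tsum G (tsum (tensor k P Q) t h) i = tsum G t (\<lambda>m n. tsum G (h m n) i)"
    "t \<in> carrier (tensor k M N) \<Longrightarrow> tsum (tensor k M N) t (\<lambda>m n. m \<boxtimes>\<^bsub>tensor k M N\<^esub> n) = t"
  by (fact tpairs_tensor[OF M N] tsum_tensor_closed[OF M N] linear_tsum_arg[OF M N]
    linear_tsum_fun[OF M N] tsum_tsum[OF M N] tsum_pure_id[OF M N])+

locale invertible_weak_entwined_algebra =
  fixes k :: "'k ring" and A :: "('k, 'a) module" and C :: "('k, 'c) coalgebra"
    and \<psi>\<^sub>R :: "('c \<times> 'a \<Rightarrow>\<^sub>0 int) set \<Rightarrow> ('a \<times> 'c \<Rightarrow>\<^sub>0 int) set"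
    and \<psi>\<^sub>L :: "('a \<times> 'c \<Rightarrow>\<^sub>0 int) set \<Rightarrow> ('c \<times> 'a \<Rightarrow>\<^sub>0 int) set"
    and \<rho> :: "'a \<Rightarrow> ('a \<times> 'c \<Rightarrow>\<^sub>0 int) set"
  assumes entwining: "invertible_weak_entwining k A C \<psi>\<^sub>R \<psi>\<^sub>L"
    and entwined: "weak_entwined_module k A C \<psi>\<^sub>R A (\<otimes>\<^bsub>A\<^esub>) \<rho>"
begin

abbreviation mult_A (infixl \<open>\<bullet>\<close> 70) where "(\<bullet>) \<equiv> (\<otimes>\<^bsub>A\<^esub>)"
abbreviation comult_C (\<open>\<Delta>\<^sub>C\<close>) where "\<Delta>\<^sub>C \<equiv> \<Delta>\<^bsub>C\<^esub>"
abbreviation counit_C (\<open>\<epsilon>\<^sub>C\<close>) where "\<epsilon>\<^sub>C \<equiv> \<epsilon>\<^bsub>C\<^esub>"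
abbreviation one_A (\<open>\<one>\<^sub>A\<close>) where "\<one>\<^sub>A \<equiv> \<one>\<^bsub>A\<^esub>"
abbreviation "AC \<equiv> tensor k A C"
abbreviation "CA \<equiv> tensor k C A"
abbreviation "CC \<equiv> tensor k C C"
abbreviation "AA \<equiv> tensor k A A"

section \<open>The axioms of the structure in Sweedler form\<close>

lemma rr: "rr_weak_entwining k A C \<psi>\<^sub>R" and ll: "ll_weak_entwining k A C \<psi>\<^sub>L"
  using entwining by (simp_all add: invertible_weak_entwining_def Let_def)

lemma assoc_algebra_A: "assoc_algebra k A" and is_coalgebra_C: "is_coalgebra k C"
  using rr by (simp_all add: rr_weak_entwining_def Let_def)

sublocale A: assoc_algebra k A by (rule assoc_algebra_A)

lemma module_A [simp]: "module k A" by (rule A.module_axioms)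
lemma module_C [simp]: "module k C" using is_coalgebra_C by (simp add: is_coalgebra_def Let_def)
lemma module_k [simp]: "module k (regular_module k)" by (rule module_regular[OF A.R.is_cring])

sublocale C: module k C by (rule module_C)

lemma comodule_A: "right_comodule k C A \<rho>"
  using entwined by (simp add: weak_entwined_module_def Let_def)

lemma linear_maps:
  "linear_map k A AC \<rho>" "linear_map k C CC \<Delta>\<^sub>C" "linear_map k C (regular_module k) \<epsilon>\<^sub>C"
  "linear_map k CA AC \<psi>\<^sub>R" "linear_map k AC CA \<psi>\<^sub>L"
  subgoal using comodule_A unfolding right_comodule_def Let_def by blast
  subgoal using is_coalgebra_C unfolding is_coalgebra_def Let_def by blast
  subgoal using is_coalgebra_C unfolding is_coalgebra_def Let_def by blast
  subgoal using rr unfolding rr_weak_entwining_def Let_def by blast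
  subgoal using ll unfolding ll_weak_entwining_def Let_def by blast
  done

lemma linear_mult:
  "a \<in> carrier A \<Longrightarrow> linear_map k X A f \<Longrightarrow> linear_map k X A (\<lambda>x. a \<bullet> f x)"
  "a \<in> carrier A \<Longrightarrow> linear_map k X A f \<Longrightarrow> linear_map k X A (\<lambda>x. f x \<bullet> a)"
  by (auto simp: linear_map_def Pi_iff A.r_distr A.l_distr A.smult_mult_left A.smult_mult_right)

text \<open>With these rules in the simpset, and with bilinearity and trilinearity unfolded into
  linearity in each slot, \<open>simp\<close> discharges the multilinearity conditions of the
  calculations below.\<close>

lemmas linear_ops = linear_maps[THEN linear_op(2)] linear_maps linear_mult linear_id
declare linear_ops [simp] linear_maps[THEN linear_op(3), simp]
declare linear_maps(3)[THEN linear_op(3), simplified, simp]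
declare module_tensor [simp] linear_smult [simp] linear_pure_tensor [simp] pure_tensor_closed [simp]
  tsum_pure_tensor [simp] tsum_smult [simp]
declare tensor_rules[OF module_A module_C, simp] tensor_rules[OF module_C module_A, simp]
  tensor_rules[OF module_C module_C, simp] tensor_rules[OF module_A module_A, simp]
  tsum_cong_simp [cong] bilinear_def [simp] trilinear_def [simp]

text \<open>A trilinear \<open>F\<close> induces a linear map on the bracketed triple tensor
  product, and this map is applied to the axiom. The bracketing disappears, so the equation can be
  used inside longer sums. The other axioms are treated in the same way.\<close>

lemma coassoc:
  assumes F: "trilinear k C C C G F" and G[simp]: "module k G" and c: "c \<in> carrier C"
  shows "tsum G (\<Delta>\<^sub>C c) (\<lambda>c1 c2. tsum G (\<Delta>\<^sub>C c1) (\<lambda>x y. F x y c2)) =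
    tsum G (\<Delta>\<^sub>C c) (\<lambda>c1 c2. tsum G (\<Delta>\<^sub>C c2) (\<lambda>x y. F c1 x y))"
proof -
  note [simp] = trilinear_apply[OF F] c
  let ?CCC = "tensor k CC C"
  have "tsum ?CCC (\<Delta>\<^sub>C c) (\<lambda>c1 c2. \<Delta>\<^sub>C c1 \<boxtimes>\<^bsub>?CCC\<^esub> c2) =
        tsum ?CCC (\<Delta>\<^sub>C c) (\<lambda>c1 c2. tsum ?CCC (\<Delta>\<^sub>C c2) (\<lambda>c21 c22.
          (c1 \<boxtimes>\<^bsub>CC\<^esub> c21) \<boxtimes>\<^bsub>?CCC\<^esub> c22))"
    using is_coalgebra_C c unfolding is_coalgebra_def Let_def by blast
  from arg_cong[OF this, where f = "\<lambda>t. tsum G t (\<lambda>u z. tsum G u (\<lambda>x y. F x y z))"]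
  show ?thesis by simp
qed

lemma counit:
  assumes "module k G" "linear_map k C G f" "c \<in> carrier C"
  shows "tsum G (\<Delta>\<^sub>C c) (\<lambda>c1 c2. \<epsilon>\<^sub>C c1 \<odot>\<^bsub>G\<^esub> f c2) = f c"
    and "tsum G (\<Delta>\<^sub>C c) (\<lambda>c1 c2. \<epsilon>\<^sub>C c2 \<odot>\<^bsub>G\<^esub> f c1) = f c"
proof -
  have *: "tsum C (\<Delta>\<^sub>C c) (\<lambda>c1 c2. \<epsilon>\<^sub>C c1 \<odot>\<^bsub>C\<^esub> c2) = c"
    "tsum C (\<Delta>\<^sub>C c) (\<lambda>c1 c2. \<epsilon>\<^sub>C c2 \<odot>\<^bsub>C\<^esub> c1) = c"
    using is_coalgebra_C assms(3) unfolding is_coalgebra_def Let_def by blast+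
  note [simp] = assms linear_map_smult[OF assms(2)]
  have "f (tsum C (\<Delta>\<^sub>C c) (\<lambda>c1 c2. \<epsilon>\<^sub>C c1 \<odot>\<^bsub>C\<^esub> c2)) =
      tsum G (\<Delta>\<^sub>C c) (\<lambda>c1 c2. f (\<epsilon>\<^sub>C c1 \<odot>\<^bsub>C\<^esub> c2))"
    "f (tsum C (\<Delta>\<^sub>C c) (\<lambda>c1 c2. \<epsilon>\<^sub>C c2 \<odot>\<^bsub>C\<^esub> c1)) =
      tsum G (\<Delta>\<^sub>C c) (\<lambda>c1 c2. f (\<epsilon>\<^sub>C c2 \<odot>\<^bsub>C\<^esub> c1))"
    by (rule linear_map_push[of k C C]; simp)+
  then show "tsum G (\<Delta>\<^sub>C c) (\<lambda>c1 c2. \<epsilon>\<^sub>C c1 \<odot>\<^bsub>G\<^esub> f c2) = f c"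
     "tsum G (\<Delta>\<^sub>C c) (\<lambda>c1 c2. \<epsilon>\<^sub>C c2 \<odot>\<^bsub>G\<^esub> f c1) = f c"
    unfolding * by simp_all
qed

lemma coaction_coassoc:
  assumes F: "trilinear k A C C G F" and G[simp]: "module k G" and a: "a \<in> carrier A"
  shows "tsum G (\<rho> a) (\<lambda>x c. tsum G (\<rho> x) (\<lambda>y d. F y d c)) =
    tsum G (\<rho> a) (\<lambda>x c. tsum G (\<Delta>\<^sub>C c) (\<lambda>d e. F x d e))"
proof -
  note [simp] = trilinear_apply[OF F] a
  let ?ACC = "tensor k AC C"
  have "tsum ?ACC (\<rho> a) (\<lambda>m0 m1. \<rho> m0 \<boxtimes>\<^bsub>?ACC\<^esub> m1) =
        tsum ?ACC (\<rho> a) (\<lambda>m0 m1. tsum ?ACC (\<Delta>\<^sub>C m1) (\<lambda>c1 c2.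
          (m0 \<boxtimes>\<^bsub>AC\<^esub> c1) \<boxtimes>\<^bsub>?ACC\<^esub> c2))"
    using comodule_A a unfolding right_comodule_def Let_def by blast
  from arg_cong[OF this, where f = "\<lambda>t. tsum G t (\<lambda>u z. tsum G u (\<lambda>x y. F x y z))"]
  show ?thesis by simp
qed

lemma coaction_counit:
  assumes a: "a \<in> carrier A"
  shows "tsum A (\<rho> a) (\<lambda>x c. \<epsilon>\<^sub>C c \<odot>\<^bsub>A\<^esub> x) = a"
  using comodule_A a unfolding right_comodule_def Let_def by blast

text \<open>The factor \<open>a\<close> is pulled out of the axiom, so that the remaining element,
  which depends on \<open>c\<close> alone, can be matched with the one in
  \<open>psiL_unit\<close>.\<close>

lemma psiR_counit:
  assumes "a \<in> carrier A" "c \<in> carrier C"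
  shows "tsum A (\<psi>\<^sub>R (c \<boxtimes>\<^bsub>CA\<^esub> a)) (\<lambda>a' c'. \<epsilon>\<^sub>C c' \<odot>\<^bsub>A\<^esub> a') =
        tsum A (\<psi>\<^sub>R (c \<boxtimes>\<^bsub>CA\<^esub> \<one>\<^sub>A)) (\<lambda>e c'. \<epsilon>\<^sub>C c' \<odot>\<^bsub>A\<^esub> e) \<bullet> a"
proof -
  note [simp] = assms
  have "tsum A (\<psi>\<^sub>R (c \<boxtimes>\<^bsub>CA\<^esub> \<one>\<^sub>A)) (\<lambda>e c'. \<epsilon>\<^sub>C c' \<odot>\<^bsub>A\<^esub> e) \<bullet> a =
    tsum A (\<psi>\<^sub>R (c \<boxtimes>\<^bsub>CA\<^esub> \<one>\<^sub>A)) (\<lambda>e c'. (\<epsilon>\<^sub>C c' \<odot>\<^bsub>A\<^esub> e) \<bullet> a)"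
    by (rule linear_map_push[of k A C]; simp)
  moreover have "tsum A (\<psi>\<^sub>R (c \<boxtimes>\<^bsub>CA\<^esub> a)) (\<lambda>a' c'. \<epsilon>\<^sub>C c' \<odot>\<^bsub>A\<^esub> a') =
        tsum A (\<psi>\<^sub>R (c \<boxtimes>\<^bsub>CA\<^esub> \<one>\<^sub>A)) (\<lambda>e c'. \<epsilon>\<^sub>C c' \<odot>\<^bsub>A\<^esub> (e \<bullet> a))"
    using rr assms unfolding rr_weak_entwining_def Let_def by blast
  ultimately show ?thesis by (simp add: A.smult_mult_left)
qed

lemma psiR_comult:
  assumes F: "trilinear k A C C G F" and G[simp]: "module k G" and a: "a \<in> carrier A" "c \<in> carrier C"
  shows "tsum G (\<psi>\<^sub>R (c \<boxtimes>\<^bsub>CA\<^esub> a)) (\<lambda>a' c'. tsum G (\<Delta>\<^sub>C c') (F a')) =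
     tsum G (\<Delta>\<^sub>C c) (\<lambda>c1 c2. tsum G (\<psi>\<^sub>R (c2 \<boxtimes>\<^bsub>CA\<^esub> a)) (\<lambda>a' c2'.
        tsum G (\<psi>\<^sub>R (c1 \<boxtimes>\<^bsub>CA\<^esub> a')) (\<lambda>a'' c1'. F a'' c1' c2')))"
proof -
  note [simp] = trilinear_apply[OF F] a
  let ?ACC = "tensor k AC C"
  have "tsum ?ACC (\<psi>\<^sub>R (c \<boxtimes>\<^bsub>CA\<^esub> a)) (\<lambda>a' c'.
          tsum ?ACC (\<Delta>\<^sub>C c') (\<lambda>c1 c2. (a' \<boxtimes>\<^bsub>AC\<^esub> c1) \<boxtimes>\<^bsub>?ACC\<^esub> c2)) =
        tsum ?ACC (\<Delta>\<^sub>C c) (\<lambda>c1 c2.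
          tsum ?ACC (\<psi>\<^sub>R (c2 \<boxtimes>\<^bsub>CA\<^esub> a)) (\<lambda>a' c2'.
            tsum ?ACC (\<psi>\<^sub>R (c1 \<boxtimes>\<^bsub>CA\<^esub> a')) (\<lambda>a'' c1'.
              (a'' \<boxtimes>\<^bsub>AC\<^esub> c1') \<boxtimes>\<^bsub>?ACC\<^esub> c2')))"
    using rr a unfolding rr_weak_entwining_def Let_def by blast
  from arg_cong[OF this, where f = "\<lambda>t. tsum G t (\<lambda>u z. tsum G u (\<lambda>x y. F x y z))"]
  show ?thesis by simp
qed

lemma psiR_unit:
  assumes F: "bilinear k A C G F" and G[simp]: "module k G" and c: "c \<in> carrier C"
  shows "tsum G (\<psi>\<^sub>R (c \<boxtimes>\<^bsub>CA\<^esub> \<one>\<^sub>A)) F =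
    tsum G (\<Delta>\<^sub>C c) (\<lambda>c1 c2. tsum G (\<psi>\<^sub>R (c1 \<boxtimes>\<^bsub>CA\<^esub> \<one>\<^sub>A)) (\<lambda>e c1'. F (\<epsilon>\<^sub>C c1' \<odot>\<^bsub>A\<^esub> e) c2))"
proof -
  note [simp] = bilinear_apply[OF F] c
  have "\<psi>\<^sub>R (c \<boxtimes>\<^bsub>CA\<^esub> \<one>\<^sub>A) =
        tsum AC (\<Delta>\<^sub>C c) (\<lambda>c1 c2.
          tsum AC (\<psi>\<^sub>R (c1 \<boxtimes>\<^bsub>CA\<^esub> \<one>\<^sub>A)) (\<lambda>e c1'. (\<epsilon>\<^sub>C c1' \<odot>\<^bsub>A\<^esub> e) \<boxtimes>\<^bsub>AC\<^esub> c2))"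
    using rr c unfolding rr_weak_entwining_def Let_def by blast
  from arg_cong[OF this, where f = "\<lambda>t. tsum G t F"]
  show ?thesis by simp
qed

lemma psiL_mult:
  assumes F: "bilinear k C A G F" and G[simp]: "module k G" and a: "a \<in> carrier A" "b \<in> carrier A" "c \<in> carrier C"
  shows "tsum G (\<psi>\<^sub>L ((a \<bullet> b) \<boxtimes>\<^bsub>AC\<^esub> c)) F = tsum G (\<psi>\<^sub>L (b \<boxtimes>\<^bsub>AC\<^esub> c)) (\<lambda>c' b'.
    tsum G (\<psi>\<^sub>L (a \<boxtimes>\<^bsub>AC\<^esub> c')) (\<lambda>c'' a'. F c'' (a' \<bullet> b')))"
proof -
  note [simp] = bilinear_apply[OF F] a
  have "\<psi>\<^sub>L ((a \<bullet> b) \<boxtimes>\<^bsub>AC\<^esub> c) =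
        tsum CA (\<psi>\<^sub>L (b \<boxtimes>\<^bsub>AC\<^esub> c)) (\<lambda>c' b'.
          tsum CA (\<psi>\<^sub>L (a \<boxtimes>\<^bsub>AC\<^esub> c')) (\<lambda>c'' a'. c'' \<boxtimes>\<^bsub>CA\<^esub> (a' \<bullet> b')))"
    using ll a unfolding ll_weak_entwining_def Let_def by blast
  from arg_cong[OF this, where f = "\<lambda>t. tsum G t F"]
  show ?thesis by simp
qed

lemma psiL_comult:
  assumes F: "trilinear k C C A G F" and G[simp]: "module k G" and a: "a \<in> carrier A" "c \<in> carrier C"
  shows "tsum G (\<psi>\<^sub>L (a \<boxtimes>\<^bsub>AC\<^esub> c)) (\<lambda>c' a'. tsum G (\<Delta>\<^sub>C c') (\<lambda>x y. F x y a')) =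
    tsum G (\<Delta>\<^sub>C c) (\<lambda>c1 c2. tsum G (\<psi>\<^sub>L (a \<boxtimes>\<^bsub>AC\<^esub> c1)) (\<lambda>c1' a'.
      tsum G (\<psi>\<^sub>L (a' \<boxtimes>\<^bsub>AC\<^esub> c2)) (\<lambda>c2' a''. F c1' c2' a'')))"
proof -
  note [simp] = trilinear_apply[OF F] a
  let ?CCA = "tensor k CC A"
  have "tsum ?CCA (\<psi>\<^sub>L (a \<boxtimes>\<^bsub>AC\<^esub> c)) (\<lambda>c' a'. \<Delta>\<^sub>C c' \<boxtimes>\<^bsub>?CCA\<^esub> a') =
        tsum ?CCA (\<Delta>\<^sub>C c) (\<lambda>c1 c2.
          tsum ?CCA (\<psi>\<^sub>L (a \<boxtimes>\<^bsub>AC\<^esub> c1)) (\<lambda>c1' a'.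
            tsum ?CCA (\<psi>\<^sub>L (a' \<boxtimes>\<^bsub>AC\<^esub> c2)) (\<lambda>c2' a''.
              (c1' \<boxtimes>\<^bsub>CC\<^esub> c2') \<boxtimes>\<^bsub>?CCA\<^esub> a'')))"
    using ll a unfolding ll_weak_entwining_def Let_def by blast
  from arg_cong[OF this, where f = "\<lambda>t. tsum G t (\<lambda>u z. tsum G u (\<lambda>x y. F x y z))"]
  show ?thesis by simp
qed

text \<open>Here the compatibility condition of the two counit expressions enters: it replaces the
  element that \<open>\<psi>\<^sub>L\<close> produces in the unit axiom by the one computed from
  \<open>\<psi>\<^sub>R\<close>.\<close>

lemma psiL_unit:
  assumes F: "bilinear k C A G F" and G[simp]: "module k G" and c: "c \<in> carrier C"
  shows "tsum G (\<psi>\<^sub>L (\<one>\<^sub>A \<boxtimes>\<^bsub>AC\<^esub> c)) F = tsum G (\<Delta>\<^sub>C c) (\<lambda>c1 c2.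
    F c1 (tsum A (\<psi>\<^sub>R (c2 \<boxtimes>\<^bsub>CA\<^esub> \<one>\<^sub>A)) (\<lambda>e c'. \<epsilon>\<^sub>C c' \<odot>\<^bsub>A\<^esub> e)))"
proof -
  note [simp] = bilinear_apply[OF F] c
  have eta: "tsum A (\<psi>\<^sub>R (c \<boxtimes>\<^bsub>CA\<^esub> \<one>\<^sub>A)) (\<lambda>e c'. \<epsilon>\<^sub>C c' \<odot>\<^bsub>A\<^esub> e) =
      tsum A (\<psi>\<^sub>L (\<one>\<^sub>A \<boxtimes>\<^bsub>AC\<^esub> c)) (\<lambda>c' e. \<epsilon>\<^sub>C c' \<odot>\<^bsub>A\<^esub> e)" if "c \<in> carrier C" for c
    using entwining that unfolding invertible_weak_entwining_def Let_def by metis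
  have push: "F b (tsum A (\<psi>\<^sub>L (\<one>\<^sub>A \<boxtimes>\<^bsub>AC\<^esub> c)) (\<lambda>c' e. \<epsilon>\<^sub>C c' \<odot>\<^bsub>A\<^esub> e)) =
      tsum G (\<psi>\<^sub>L (\<one>\<^sub>A \<boxtimes>\<^bsub>AC\<^esub> c)) (\<lambda>c' e. F b (\<epsilon>\<^sub>C c' \<odot>\<^bsub>A\<^esub> e))"
    if "b \<in> carrier C" "c \<in> carrier C" for b c
    by (rule linear_map_push[of k C A]) (use that in simp_all)
  have "\<psi>\<^sub>L (\<one>\<^sub>A \<boxtimes>\<^bsub>AC\<^esub> c) =
        tsum CA (\<Delta>\<^sub>C c) (\<lambda>c1 c2.
          tsum CA (\<psi>\<^sub>L (\<one>\<^sub>A \<boxtimes>\<^bsub>AC\<^esub> c2)) (\<lambda>c2' e. c1 \<boxtimes>\<^bsub>CA\<^esub> (\<epsilon>\<^sub>C c2' \<odot>\<^bsub>A\<^esub> e)))"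
    using ll c unfolding ll_weak_entwining_def Let_def by blast
  from arg_cong[OF this, where f = "\<lambda>t. tsum G t F"]
  show ?thesis by (simp add: eta push)
qed

lemma psiL_psiR:
  assumes F: "bilinear k C A G F" and G[simp]: "module k G" and c: "c \<in> carrier C" "a \<in> carrier A"
  shows "tsum G (\<psi>\<^sub>R (c \<boxtimes>\<^bsub>CA\<^esub> a)) (\<lambda>x y. tsum G (\<psi>\<^sub>L (x \<boxtimes>\<^bsub>AC\<^esub> y)) F) =
    tsum G (\<psi>\<^sub>L (\<one>\<^sub>A \<boxtimes>\<^bsub>AC\<^esub> c)) (\<lambda>y x. F y (x \<bullet> a))"
proof -
  note [simp] = bilinear_apply[OF F] c
  have "\<psi>\<^sub>L (\<psi>\<^sub>R (c \<boxtimes>\<^bsub>CA\<^esub> a)) = p_L k A C \<psi>\<^sub>L (c \<boxtimes>\<^bsub>CA\<^esub> a)"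
    using entwining c unfolding invertible_weak_entwining_def Let_def by simp
  also have "\<dots> = tsum CA (\<psi>\<^sub>L (\<one>\<^sub>A \<boxtimes>\<^bsub>AC\<^esub> c)) (\<lambda>y x. y \<boxtimes>\<^bsub>CA\<^esub> (x \<bullet> a))"
    by (simp add: p_L_def right_mult_def Let_def)
  finally have *: "\<psi>\<^sub>L (\<psi>\<^sub>R (c \<boxtimes>\<^bsub>CA\<^esub> a)) = tsum CA (\<psi>\<^sub>L (\<one>\<^sub>A \<boxtimes>\<^bsub>AC\<^esub> c)) (\<lambda>y x. y \<boxtimes>\<^bsub>CA\<^esub> (x \<bullet> a))" .
  have "tsum G (\<psi>\<^sub>L (tsum AC (\<psi>\<^sub>R (c \<boxtimes>\<^bsub>CA\<^esub> a)) (\<lambda>x y. x \<boxtimes>\<^bsub>AC\<^esub> y))) F =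
     tsum G (\<psi>\<^sub>R (c \<boxtimes>\<^bsub>CA\<^esub> a)) (\<lambda>x y. tsum G (\<psi>\<^sub>L (x \<boxtimes>\<^bsub>AC\<^esub> y)) F)"
    by (rule linear_map_push[of k A C]; simp)
  with arg_cong[OF *, where f = "\<lambda>t. tsum G t F"]
  show ?thesis by simp
qed

lemma psiR_psiL:
  assumes t: "t \<in> carrier AC"
  shows "\<psi>\<^sub>R (\<psi>\<^sub>L t) = p_R k A C \<psi>\<^sub>R t"
  using entwining t unfolding invertible_weak_entwining_def Let_def by blast

lemma p_R_eq:
  assumes "t \<in> carrier AC"
  shows "p_R k A C \<psi>\<^sub>R t = tsum AC t (\<lambda>a c. tsum AC (\<psi>\<^sub>R (c \<boxtimes>\<^bsub>CA\<^esub> \<one>\<^sub>A)) (\<lambda>x y. (a \<bullet> x) \<boxtimes>\<^bsub>AC\<^esub> y))"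
  by (simp add: p_R_def left_mult_def Let_def)

lemma coaction_mult:
  assumes F: "bilinear k A C G F" and G[simp]: "module k G" and a: "a \<in> carrier A" "b \<in> carrier A"
  shows "tsum G (\<rho> (a \<bullet> b)) F = tsum G (\<rho> a) (\<lambda>x c. tsum G (\<psi>\<^sub>R (c \<boxtimes>\<^bsub>CA\<^esub> b)) (\<lambda>b' c'. F (x \<bullet> b') c'))"
proof -
  note [simp] = bilinear_apply[OF F] a
  have "\<rho> (a \<bullet> b) = tsum AC (\<rho> a) (\<lambda>m0 m1.
          tsum AC (\<psi>\<^sub>R (m1 \<boxtimes>\<^bsub>CA\<^esub> b)) (\<lambda>a' m1'. (m0 \<bullet> a') \<boxtimes>\<^bsub>AC\<^esub> m1'))"
    using entwined a unfolding weak_entwined_module_def Let_def by blast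
  from arg_cong[OF this, where f = "\<lambda>t. tsum G t F"]
  show ?thesis by simp
qed

text \<open>The entwined module condition for the product of \<open>a\<close> and the unit gives
  this; it shows that \<open>\<rho>\<close> takes its values in the coring.\<close>

lemma p_R_coaction:
  assumes a: "a \<in> carrier A" shows "p_R k A C \<psi>\<^sub>R (\<rho> a) = \<rho> a"
  using coaction_mult[OF bilinear_pure_tensor, of a "\<one>\<^sub>A"] a by (simp add: p_R_eq)

text \<open>The left \<open>C\<close>-coaction \<open>a \<mapsto> \<psi>\<^sub>L(a \<rho>(1))\<close>.\<close>

definition lam :: "'a \<Rightarrow> ('c \<times> 'a \<Rightarrow>\<^sub>0 int) set"
  where "lam a = tsum CA (\<rho> \<one>\<^sub>A) (\<lambda>x c. \<psi>\<^sub>L ((a \<bullet> x) \<boxtimes>\<^bsub>AC\<^esub> c))"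

lemma linear_lam: "linear_map k A CA lam"
  unfolding lam_def by simp

declare linear_op(2,3)[OF linear_lam, simp]  linear_lam [simp]

lemma tsum_lam:
  assumes F: "bilinear k C A G F" and G[simp]: "module k G" and a: "a \<in> carrier A"
  shows "tsum G (lam a) F = tsum G (\<rho> \<one>\<^sub>A) (\<lambda>x c. tsum G (\<psi>\<^sub>L ((a \<bullet> x) \<boxtimes>\<^bsub>AC\<^esub> c)) F)"
  using F[simplified] a by (simp add: lam_def)

text \<open>Writing \<open>b\<close> as the product of the unit and \<open>b\<close> exposes
  \<open>\<psi>\<^sub>R(c \<otimes> b)\<close>, which \<open>\<psi>\<^sub>L\<close> cancels up to
  \<open>p_L\<close>. The outcome is \<open>\<psi>\<^sub>L(a \<rho>(b)) = \<lambda>(a) b\<close>,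
  the rule by which \<open>lam\<close> is carried through the canonical map.\<close>

lemma psiL_coaction:
  assumes F: "bilinear k C A G F" and G[simp]: "module k G" and a: "a \<in> carrier A" "b \<in> carrier A"
  shows "tsum G (\<rho> b) (\<lambda>x c. tsum G (\<psi>\<^sub>L ((a \<bullet> x) \<boxtimes>\<^bsub>AC\<^esub> c)) F) = tsum G (lam a) (\<lambda>c x. F c (x \<bullet> b))"
proof -
  note [simp] = bilinear_apply[OF F] a
  have "tsum G (\<rho> b) (\<lambda>x c. tsum G (\<psi>\<^sub>L ((a \<bullet> x) \<boxtimes>\<^bsub>AC\<^esub> c)) F) =
     tsum G (\<rho> (\<one>\<^sub>A \<bullet> b)) (\<lambda>x c. tsum G (\<psi>\<^sub>L ((a \<bullet> x) \<boxtimes>\<^bsub>AC\<^esub> c)) F)"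
    by simp
  also have "\<dots> = tsum G (\<rho> \<one>\<^sub>A) (\<lambda>x c. tsum G (\<psi>\<^sub>R (c \<boxtimes>\<^bsub>CA\<^esub> b)) (\<lambda>b' c'.
      tsum G (\<psi>\<^sub>L ((a \<bullet> (x \<bullet> b')) \<boxtimes>\<^bsub>AC\<^esub> c')) F))"
    by (rule coaction_mult) simp_all
  also have "\<dots> = tsum G (\<rho> \<one>\<^sub>A) (\<lambda>x c. tsum G (\<psi>\<^sub>R (c \<boxtimes>\<^bsub>CA\<^esub> b)) (\<lambda>b' c'.
      tsum G (\<psi>\<^sub>L (b' \<boxtimes>\<^bsub>AC\<^esub> c')) (\<lambda>d y. tsum G (\<psi>\<^sub>L ((a \<bullet> x) \<boxtimes>\<^bsub>AC\<^esub> d)) (\<lambda>d' y'. F d' (y' \<bullet> y)))))"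
    by (simp add: A.m_assoc[symmetric] psiL_mult)
  also have "\<dots> = tsum G (\<rho> \<one>\<^sub>A) (\<lambda>x c. tsum G (\<psi>\<^sub>L (\<one>\<^sub>A \<boxtimes>\<^bsub>AC\<^esub> c)) (\<lambda>d y.
      tsum G (\<psi>\<^sub>L ((a \<bullet> x) \<boxtimes>\<^bsub>AC\<^esub> d)) (\<lambda>d' y'. F d' (y' \<bullet> (y \<bullet> b)))))"
    by (simp add: psiL_psiR)
  \<comment> \<open>The idempotent factor \<open>\<psi>\<^sub>L(1 \<otimes> c)\<close> left by the
    cancellation is absorbed by reading multiplicativity backwards for a product with the
    unit.\<close>
  also have "\<dots> = tsum G (\<rho> \<one>\<^sub>A) (\<lambda>x c. tsum G (\<psi>\<^sub>L ((a \<bullet> x \<bullet> \<one>\<^sub>A) \<boxtimes>\<^bsub>AC\<^esub> c)) (\<lambda>d' y'. F d' (y' \<bullet> b)))"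
    by (simp add: psiL_mult A.m_assoc del: A.r_one)
  also have "\<dots> = tsum G (lam a) (\<lambda>c x. F c (x \<bullet> b))"
    by (simp add: tsum_lam)
  finally show ?thesis .
qed

lemma lam_mult:
  assumes F: "bilinear k C A G F" and G[simp]: "module k G" and a: "a \<in> carrier A" "b \<in> carrier A"
  shows "tsum G (lam (a \<bullet> b)) F =
    tsum G (lam b) (\<lambda>c x. tsum G (\<psi>\<^sub>L (a \<boxtimes>\<^bsub>AC\<^esub> c)) (\<lambda>c' a'. F c' (a' \<bullet> x)))"
proof -
  note [simp] = bilinear_apply[OF F] a
  show ?thesis by (simp add: tsum_lam A.m_assoc psiL_mult)
qed

text \<open>After \<open>psiL_comult\<close> the coproduct sits on the coaction of the unit.
  Coassociativity of \<open>\<rho>\<close> turns it into a second coaction, and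
  \<open>psiL_coaction\<close> recognises each half as \<open>lam\<close>.\<close>

lemma lam_coassoc:
  assumes F: "trilinear k C C A G F" and G[simp]: "module k G" and a: "a \<in> carrier A"
  shows "tsum G (lam a) (\<lambda>c x. tsum G (\<Delta>\<^sub>C c) (\<lambda>c1 c2. F c1 c2 x)) =
     tsum G (lam a) (\<lambda>c x. tsum G (lam x) (F c))"
proof -
  note [simp] = trilinear_apply[OF F] a
  have "tsum G (lam a) (\<lambda>c x. tsum G (\<Delta>\<^sub>C c) (\<lambda>c1 c2. F c1 c2 x)) =
    tsum G (\<rho> \<one>\<^sub>A) (\<lambda>x c. tsum G (\<Delta>\<^sub>C c) (\<lambda>c1 c2. tsum G (\<psi>\<^sub>L ((a \<bullet> x) \<boxtimes>\<^bsub>AC\<^esub> c1)) (\<lambda>c1' a'.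
      tsum G (\<psi>\<^sub>L (a' \<boxtimes>\<^bsub>AC\<^esub> c2)) (\<lambda>c2' a''. F c1' c2' a''))))"
    by (simp add: tsum_lam psiL_comult)
  also have "\<dots> = tsum G (\<rho> \<one>\<^sub>A) (\<lambda>x c. tsum G (\<rho> x) (\<lambda>y d. tsum G (\<psi>\<^sub>L ((a \<bullet> y) \<boxtimes>\<^bsub>AC\<^esub> d)) (\<lambda>c1' a'.
      tsum G (\<psi>\<^sub>L (a' \<boxtimes>\<^bsub>AC\<^esub> c)) (\<lambda>c2' a''. F c1' c2' a''))))"
    by (rule coaction_coassoc[symmetric]) simp_all
  also have "\<dots> = tsum G (\<rho> \<one>\<^sub>A) (\<lambda>x c. tsum G (lam a) (\<lambda>d y. tsum G (\<psi>\<^sub>L ((y \<bullet> x) \<boxtimes>\<^bsub>AC\<^esub> c)) (F d)))"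
    by (simp add: psiL_coaction)
  also have "\<dots> = tsum G (lam a) (\<lambda>d y. tsum G (\<rho> \<one>\<^sub>A) (\<lambda>x c. tsum G (\<psi>\<^sub>L ((y \<bullet> x) \<boxtimes>\<^bsub>AC\<^esub> c)) (F d)))"
    by (rule tsum_swap[of k A C C A]) simp_all
  also have "\<dots> = tsum G (lam a) (\<lambda>c x. tsum G (lam x) (F c))"
    by (simp add: tsum_lam)
  finally show ?thesis .
qed

text \<open>The unit axiom confines \<open>\<psi>\<^sub>R\<close> to the first leg of the coproduct
  and leaves the second leg free, so right colinearity of
  \<open>c \<mapsto> \<psi>\<^sub>R(c \<otimes> 1)\<close> becomes plain coassociativity.\<close>

lemma psiR_one_comult:
  assumes F: "trilinear k A C C G F" and G[simp]: "module k G" and c: "c \<in> carrier C"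
  shows "tsum G (\<psi>\<^sub>R (c \<boxtimes>\<^bsub>CA\<^esub> \<one>\<^sub>A)) (\<lambda>e d. tsum G (\<Delta>\<^sub>C d) (F e)) =
    tsum G (\<Delta>\<^sub>C c) (\<lambda>c1 c2. tsum G (\<psi>\<^sub>R (c1 \<boxtimes>\<^bsub>CA\<^esub> \<one>\<^sub>A)) (\<lambda>e d. F e d c2))"
proof -
  note [simp] = trilinear_apply[OF F] c
  have "tsum G (\<psi>\<^sub>R (c \<boxtimes>\<^bsub>CA\<^esub> \<one>\<^sub>A)) (\<lambda>e d. tsum G (\<Delta>\<^sub>C d) (F e)) =
    tsum G (\<Delta>\<^sub>C c) (\<lambda>c1 c2. tsum G (\<psi>\<^sub>R (c1 \<boxtimes>\<^bsub>CA\<^esub> \<one>\<^sub>A)) (\<lambda>e c1'.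
      tsum G (\<Delta>\<^sub>C c2) (F (\<epsilon>\<^sub>C c1' \<odot>\<^bsub>A\<^esub> e))))"
    by (rule psiR_unit) simp_all
  also have "\<dots> = tsum G (\<Delta>\<^sub>C c) (\<lambda>c1 c2. tsum G (\<Delta>\<^sub>C c2) (\<lambda>x y. tsum G (\<psi>\<^sub>R (c1 \<boxtimes>\<^bsub>CA\<^esub> \<one>\<^sub>A)) (\<lambda>e c1'.
      F (\<epsilon>\<^sub>C c1' \<odot>\<^bsub>A\<^esub> e) x y)))"
    by (rule tsum_cong[OF refl], rule tsum_swap[of k A C C C]) simp_all
  also have "\<dots> = tsum G (\<Delta>\<^sub>C c) (\<lambda>c1 c2. tsum G (\<Delta>\<^sub>C c1) (\<lambda>x y. tsum G (\<psi>\<^sub>R (x \<boxtimes>\<^bsub>CA\<^esub> \<one>\<^sub>A)) (\<lambda>e c1'.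
      F (\<epsilon>\<^sub>C c1' \<odot>\<^bsub>A\<^esub> e) y c2)))"
    by (rule coassoc[symmetric]) simp_all
  also have "\<dots> = tsum G (\<Delta>\<^sub>C c) (\<lambda>c1 c2. tsum G (\<psi>\<^sub>R (c1 \<boxtimes>\<^bsub>CA\<^esub> \<one>\<^sub>A)) (\<lambda>e d. F e d c2))"
    by (rule tsum_cong[OF refl], rule psiR_unit[symmetric]) simp_all
  finally show ?thesis .
qed

text \<open>This is left colinearity of \<open>c \<mapsto> \<psi>\<^sub>R(c \<otimes> 1)\<close>,
  where the coring carries the left coaction given by the coproduct followed by
  \<open>\<psi>\<^sub>L\<close>. The coproduct axiom produces two factors
  \<open>\<psi>\<^sub>R\<close>, one of which \<open>\<psi>\<^sub>L\<close> cancels up to an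
  idempotent.\<close>

lemma psiR_one_left_coaction:
  assumes F: "trilinear k C A C G F" and G[simp]: "module k G" and c: "c \<in> carrier C"
  shows "tsum G (\<psi>\<^sub>R (c \<boxtimes>\<^bsub>CA\<^esub> \<one>\<^sub>A)) (\<lambda>e d. tsum G (\<Delta>\<^sub>C d) (\<lambda>x y.
      tsum G (\<psi>\<^sub>L (e \<boxtimes>\<^bsub>AC\<^esub> x)) (\<lambda>z a. F z a y))) =
    tsum G (\<Delta>\<^sub>C c) (\<lambda>c1 c2. tsum G (\<psi>\<^sub>R (c2 \<boxtimes>\<^bsub>CA\<^esub> \<one>\<^sub>A)) (F c1))"
proof -
  note [simp] = trilinear_apply[OF F] trilinear_smult[OF F] c
  have push: "F x (tsum A (\<psi>\<^sub>R (y \<boxtimes>\<^bsub>CA\<^esub> a)) (\<lambda>a' y'. \<epsilon>\<^sub>C y' \<odot>\<^bsub>A\<^esub> a')) z =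
      tsum G (\<psi>\<^sub>R (y \<boxtimes>\<^bsub>CA\<^esub> a)) (\<lambda>a' y'. F x (\<epsilon>\<^sub>C y' \<odot>\<^bsub>A\<^esub> a') z)"
    if "x \<in> carrier C" "y \<in> carrier C" "a \<in> carrier A" "z \<in> carrier C" for x y a z
    by (rule linear_map_push[of k A C A G "\<lambda>a. F x a z"]) (use that in simp_all)
  have "tsum G (\<psi>\<^sub>R (c \<boxtimes>\<^bsub>CA\<^esub> \<one>\<^sub>A)) (\<lambda>e d. tsum G (\<Delta>\<^sub>C d) (\<lambda>x y.
      tsum G (\<psi>\<^sub>L (e \<boxtimes>\<^bsub>AC\<^esub> x)) (\<lambda>z a. F z a y))) =
    tsum G (\<Delta>\<^sub>C c) (\<lambda>c1 c2. tsum G (\<psi>\<^sub>R (c2 \<boxtimes>\<^bsub>CA\<^esub> \<one>\<^sub>A)) (\<lambda>a d. tsum G (\<psi>\<^sub>R (c1 \<boxtimes>\<^bsub>CA\<^esub> a)) (\<lambda>a' c1'.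
      tsum G (\<psi>\<^sub>L (a' \<boxtimes>\<^bsub>AC\<^esub> c1')) (\<lambda>z a. F z a d))))"
    by (rule psiR_comult) simp_all
  \<comment> \<open>The leftover \<open>\<psi>\<^sub>L(1 \<otimes> c1)\<close> becomes, by
    \<open>psiL_unit\<close>, an element of \<open>A\<close> multiplying \<open>a\<close> from the
    left; \<open>psiR_counit\<close> read backwards turns that product into the counit applied to
    \<open>\<psi>\<^sub>R(y \<otimes> a)\<close>.\<close>
  also have "\<dots> = tsum G (\<Delta>\<^sub>C c) (\<lambda>c1 c2. tsum G (\<psi>\<^sub>R (c2 \<boxtimes>\<^bsub>CA\<^esub> \<one>\<^sub>A)) (\<lambda>a d.
      tsum G (\<Delta>\<^sub>C c1) (\<lambda>x y. tsum G (\<psi>\<^sub>R (y \<boxtimes>\<^bsub>CA\<^esub> a)) (\<lambda>a' y'. F x (\<epsilon>\<^sub>C y' \<odot>\<^bsub>A\<^esub> a') d))))"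
    by (simp add: psiL_psiR psiL_unit psiR_counit[symmetric] push del: trilinear_smult[OF F])
  also have "\<dots> = tsum G (\<Delta>\<^sub>C c) (\<lambda>c1 c2. tsum G (\<Delta>\<^sub>C c1) (\<lambda>x y. tsum G (\<psi>\<^sub>R (c2 \<boxtimes>\<^bsub>CA\<^esub> \<one>\<^sub>A)) (\<lambda>a d.
      tsum G (\<psi>\<^sub>R (y \<boxtimes>\<^bsub>CA\<^esub> a)) (\<lambda>a' y'. F x (\<epsilon>\<^sub>C y' \<odot>\<^bsub>A\<^esub> a') d))))"
    by (rule tsum_cong[OF refl], rule tsum_swap[of k A C C C]) simp_all
  also have "\<dots> = tsum G (\<Delta>\<^sub>C c) (\<lambda>x w. tsum G (\<Delta>\<^sub>C w) (\<lambda>y c2. tsum G (\<psi>\<^sub>R (c2 \<boxtimes>\<^bsub>CA\<^esub> \<one>\<^sub>A)) (\<lambda>a d.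
      tsum G (\<psi>\<^sub>R (y \<boxtimes>\<^bsub>CA\<^esub> a)) (\<lambda>a' y'. F x (\<epsilon>\<^sub>C y' \<odot>\<^bsub>A\<^esub> a') d))))"
    by (rule coassoc) simp_all
  \<comment> \<open>The coproduct axiom read backwards merges the two factors
    \<open>\<psi>\<^sub>R\<close> again, and the counit now meets a coproduct.\<close>
  also have "\<dots> = tsum G (\<Delta>\<^sub>C c) (\<lambda>x w. tsum G (\<psi>\<^sub>R (w \<boxtimes>\<^bsub>CA\<^esub> \<one>\<^sub>A)) (\<lambda>a w'. tsum G (\<Delta>\<^sub>C w') (\<lambda>y d.
      F x (\<epsilon>\<^sub>C y \<odot>\<^bsub>A\<^esub> a) d)))"
    by (rule tsum_cong[OF refl], rule psiR_comult[symmetric]) simp_all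
  also have "\<dots> = tsum G (\<Delta>\<^sub>C c) (\<lambda>c1 c2. tsum G (\<psi>\<^sub>R (c2 \<boxtimes>\<^bsub>CA\<^esub> \<one>\<^sub>A)) (F c1))"
    by (simp add: counit)
  finally show ?thesis .
qed

section \<open>Existence of the lift and of the cointegral\<close>

lemma exists_lift:
  assumes C: "projective k C"
    and surj: "canonical_map k A C \<rho> ` carrier AA = carrier (entwining_coring k A C \<psi>\<^sub>R)"
  obtains \<tau>\<^sub>0 where "linear_map k C AA \<tau>\<^sub>0"
    "\<And>c. c \<in> carrier C \<Longrightarrow> tsum AC (\<tau>\<^sub>0 c) (\<lambda>a a'. left_mult A AC a (\<rho> a')) = \<psi>\<^sub>R (c \<boxtimes>\<^bsub>CA\<^esub> \<one>\<^sub>A)"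
proof -
  interpret AA: module k AA by simp
  interpret AC: module k AC by simp
  interpret L: left_module k AA by (rule module_left_module) simp
  let ?can = "\<lambda>t. tsum AC t (\<lambda>a a'. left_mult A AC a (\<rho> a'))"
  let ?\<phi> = "\<lambda>c. \<psi>\<^sub>R (c \<boxtimes>\<^bsub>CA\<^esub> \<one>\<^sub>A)"
  have can: "linear_map k AA AC ?can" unfolding left_mult_def by simp
  have phi: "linear_map k C AC ?\<phi>" by simp
  obtain J :: "'c set" and h d where D: "dual_basis k C J h d"
    by (rule projective_dual_basis[OF C])
  note D' = dual_basisD[OF D]
  \<comment> \<open>At \<open>1 \<otimes> c\<close> the projection \<open>p_R\<close> has the value
    \<open>\<psi>\<^sub>R(c \<otimes> 1)\<close>, so this element lies in the coring, which is the
    image of the canonical map.\<close>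
  have "\<exists>t \<in> carrier AA. ?can t = ?\<phi> c" if c: "c \<in> carrier C" for c
  proof -
    have "p_R k A C \<psi>\<^sub>R (\<one>\<^sub>A \<boxtimes>\<^bsub>AC\<^esub> c) = ?\<phi> c" using c by (simp add: p_R_eq)
    moreover have "\<one>\<^sub>A \<boxtimes>\<^bsub>AC\<^esub> c \<in> carrier AC" using c by simp
    ultimately have "?\<phi> c \<in> canonical_map k A C \<rho> ` carrier AA"
      unfolding surj by (force simp: entwining_coring_def)
    then show ?thesis by (auto simp: canonical_map_def Let_def)
  qed
  then have "\<forall>i \<in> J. \<exists>t. t \<in> carrier AA \<and> ?can t = ?\<phi> (d i)" using D'(2) by blast
  then obtain t where t: "\<And>i. i \<in> J \<Longrightarrow> t i \<in> carrier AA" "\<And>i. i \<in> J \<Longrightarrow> ?can (t i) = ?\<phi> (d i)"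
    by metis
  \<comment> \<open>Preimages are chosen at the dual basis vectors only and extended by the
    coordinate functionals; arbitrary choices at every \<open>c\<close> would not be linear.\<close>
  let ?\<tau> = "\<lambda>c. \<Oplus>\<^bsub>AA\<^esub>i \<in> {i \<in> J. h i c \<noteq> \<zero>\<^bsub>k\<^esub>}. h i c \<odot>\<^bsub>AA\<^esub> t i"
  have lin: "linear_map k C AA ?\<tau>"
    by (rule L.linear_support_sum) (use D' t in simp_all)
  have "?can (?\<tau> c) = ?\<phi> c" if c: "c \<in> carrier C" for c
  proof -
    let ?S = "{i \<in> J. h i c \<noteq> \<zero>\<^bsub>k\<^esub>}"
    have "?can (?\<tau> c) = (\<Oplus>\<^bsub>AC\<^esub>i \<in> ?S. ?can (h i c \<odot>\<^bsub>AA\<^esub> t i))"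
      by (rule linear_map_finsum[OF can AA.abelian_group_axioms AC.abelian_group_axioms])
        (use D' t c in simp_all)
    also have "\<dots> = (\<Oplus>\<^bsub>AC\<^esub>i \<in> ?S. ?\<phi> (h i c \<odot>\<^bsub>C\<^esub> d i))"
      by (rule finsum_cong_raw)
        (use D' t c in \<open>simp add: linear_map_smult[OF can] linear_map_smult[OF phi]\<close>)
    also have "\<dots> = ?\<phi> (\<Oplus>\<^bsub>C\<^esub>i \<in> ?S. h i c \<odot>\<^bsub>C\<^esub> d i)"
      by (rule linear_map_finsum[OF phi C.M.abelian_group_axioms AC.abelian_group_axioms, symmetric])
        (use D' c in simp_all)
    also have "\<dots> = ?\<phi> c"
      using D c by (simp add: dual_basis_def)
    finally show ?thesis .
  qed
  with lin show thesis by (rule that)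
qed

text \<open>The cointegral is the counit after the bicolinear retraction \<open>\<pi>\<close>. Left
  and right colinearity each recover \<open>\<pi>\<close> from it, by applying the counit to one
  leg, and equating the two expressions is the cointegral identity.\<close>

lemma exists_cointegral:
  assumes "coseparable k C"
  obtains \<delta> where "bilinear k C C (regular_module k) \<delta>"
    "\<And>c d. c \<in> carrier C \<Longrightarrow> d \<in> carrier C \<Longrightarrow>
      tsum C (\<Delta>\<^sub>C c) (\<lambda>c1 c2. \<delta> c2 d \<odot>\<^bsub>C\<^esub> c1) = tsum C (\<Delta>\<^sub>C d) (\<lambda>d1 d2. \<delta> c d1 \<odot>\<^bsub>C\<^esub> d2)"
    "\<And>c. c \<in> carrier C \<Longrightarrow> tsum (regular_module k) (\<Delta>\<^sub>C c) \<delta> = \<epsilon>\<^sub>C c"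
proof -
  obtain \<pi> where lc: "left_colinear k C CC (tensor_left_coaction k C CC \<Delta>\<^sub>C) C \<Delta>\<^sub>C \<pi>"
    and rc: "right_colinear k C CC (tensor_right_coaction k C CC \<Delta>\<^sub>C) C \<Delta>\<^sub>C \<pi>"
    and ret: "\<And>c. c \<in> carrier C \<Longrightarrow> \<pi> (\<Delta>\<^sub>C c) = c"
    using assms unfolding coseparable_def Let_def by blast
  have pi: "linear_map k CC C \<pi>" using lc by (simp add: left_colinear_def)
  note [simp] = linear_op[OF pi] tensor_rules[OF module_C module_tensor[OF module_C module_C]]
    tensor_rules[OF module_tensor[OF module_C module_C] module_C]
  define \<delta> where "\<delta> c d = \<epsilon>\<^sub>C (\<pi> (c \<boxtimes>\<^bsub>CC\<^esub> d))" for c d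
  have left: "\<pi> (c \<boxtimes>\<^bsub>CC\<^esub> d) = tsum C (\<Delta>\<^sub>C c) (\<lambda>c1 c2. \<delta> c2 d \<odot>\<^bsub>C\<^esub> c1)"
    if [simp]: "c \<in> carrier C" "d \<in> carrier C" for c d
  proof -
    have "\<Delta>\<^sub>C (\<pi> (c \<boxtimes>\<^bsub>CC\<^esub> d)) = tsum CC (tensor_left_coaction k C CC \<Delta>\<^sub>C (c \<boxtimes>\<^bsub>CC\<^esub> d)) (\<lambda>c m. c \<boxtimes>\<^bsub>CC\<^esub> \<pi> m)"
      using lc by (simp add: left_colinear_def)
    also have "\<dots> = tsum CC (\<Delta>\<^sub>C c) (\<lambda>c1 c2. c1 \<boxtimes>\<^bsub>CC\<^esub> \<pi> (c2 \<boxtimes>\<^bsub>CC\<^esub> d))"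
      by (simp add: tensor_left_coaction_def Let_def)
    finally have "tsum C (\<Delta>\<^sub>C (\<pi> (c \<boxtimes>\<^bsub>CC\<^esub> d))) (\<lambda>x y. \<epsilon>\<^sub>C y \<odot>\<^bsub>C\<^esub> x) =
      tsum C (tsum CC (\<Delta>\<^sub>C c) (\<lambda>c1 c2. c1 \<boxtimes>\<^bsub>CC\<^esub> \<pi> (c2 \<boxtimes>\<^bsub>CC\<^esub> d))) (\<lambda>x y. \<epsilon>\<^sub>C y \<odot>\<^bsub>C\<^esub> x)"
      by simp
    then show ?thesis by (simp add: counit(2)[OF module_C linear_id] \<delta>_def)
  qed
  have right: "\<pi> (c \<boxtimes>\<^bsub>CC\<^esub> d) = tsum C (\<Delta>\<^sub>C d) (\<lambda>d1 d2. \<delta> c d1 \<odot>\<^bsub>C\<^esub> d2)"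
    if [simp]: "c \<in> carrier C" "d \<in> carrier C" for c d
  proof -
    have "\<Delta>\<^sub>C (\<pi> (c \<boxtimes>\<^bsub>CC\<^esub> d)) = tsum CC (tensor_right_coaction k C CC \<Delta>\<^sub>C (c \<boxtimes>\<^bsub>CC\<^esub> d)) (\<lambda>m c. \<pi> m \<boxtimes>\<^bsub>CC\<^esub> c)"
      using rc by (simp add: right_colinear_def)
    also have "\<dots> = tsum CC (\<Delta>\<^sub>C d) (\<lambda>d1 d2. \<pi> (c \<boxtimes>\<^bsub>CC\<^esub> d1) \<boxtimes>\<^bsub>CC\<^esub> d2)"
      by (simp add: tensor_right_coaction_def Let_def)
    finally have "tsum C (\<Delta>\<^sub>C (\<pi> (c \<boxtimes>\<^bsub>CC\<^esub> d))) (\<lambda>x y. \<epsilon>\<^sub>C x \<odot>\<^bsub>C\<^esub> y) =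
      tsum C (tsum CC (\<Delta>\<^sub>C d) (\<lambda>d1 d2. \<pi> (c \<boxtimes>\<^bsub>CC\<^esub> d1) \<boxtimes>\<^bsub>CC\<^esub> d2)) (\<lambda>x y. \<epsilon>\<^sub>C x \<odot>\<^bsub>C\<^esub> y)"
      by simp
    then show ?thesis by (simp add: counit(1)[OF module_C linear_id] \<delta>_def)
  qed
  have bil: "bilinear k C C (regular_module k) \<delta>"
    unfolding \<delta>_def by simp
  have norm: "tsum (regular_module k) (\<Delta>\<^sub>C c) \<delta> = \<epsilon>\<^sub>C c" if [simp]: "c \<in> carrier C" for c
  proof -
    have "(\<lambda>t. \<epsilon>\<^sub>C (\<pi> t)) (tsum CC (\<Delta>\<^sub>C c) (\<lambda>x y. x \<boxtimes>\<^bsub>CC\<^esub> y)) =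
      tsum (regular_module k) (\<Delta>\<^sub>C c) (\<lambda>x y. \<epsilon>\<^sub>C (\<pi> (x \<boxtimes>\<^bsub>CC\<^esub> y)))"
      by (rule linear_map_push[of k C C CC]) simp_all
    then show ?thesis by (simp add: ret \<delta>_def[abs_def])
  qed
  show thesis
    by (rule that[OF bil _ norm]) (simp_all flip: left right)
qed

end

section \<open>The bicolinear lift and the coinvariants\<close>

locale cointegral_lift = invertible_weak_entwined_algebra k A C \<psi>\<^sub>R \<psi>\<^sub>L \<rho>
  for k :: "'k ring" and A :: "('k, 'a) module" and C :: "('k, 'c) coalgebra" and \<psi>\<^sub>R \<psi>\<^sub>L \<rho> +
  fixes \<delta> :: "'c \<Rightarrow> 'c \<Rightarrow> 'k" and \<tau>\<^sub>0 :: "'c \<Rightarrow> ('a \<times> 'a \<Rightarrow>\<^sub>0 int) set"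
  assumes bilinear_cointegral: "bilinear k C C (regular_module k) \<delta>"
    and cointegral: "c \<in> carrier C \<Longrightarrow> d \<in> carrier C \<Longrightarrow>
      tsum C (\<Delta>\<^sub>C c) (\<lambda>c1 c2. \<delta> c2 d \<odot>\<^bsub>C\<^esub> c1) = tsum C (\<Delta>\<^sub>C d) (\<lambda>d1 d2. \<delta> c d1 \<odot>\<^bsub>C\<^esub> d2)"
    and cointegral_comult: "c \<in> carrier C \<Longrightarrow> tsum (regular_module k) (\<Delta>\<^sub>C c) \<delta> = \<epsilon>\<^sub>C c"
    and linear_lift: "linear_map k C AA \<tau>\<^sub>0"
    and canonical_lift: "c \<in> carrier C \<Longrightarrow>
      tsum AC (\<tau>\<^sub>0 c) (\<lambda>a a'. left_mult A AC a (\<rho> a')) = \<psi>\<^sub>R (c \<boxtimes>\<^bsub>CA\<^esub> \<one>\<^sub>A)"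
begin

declare linear_op(2,3)[OF linear_lift, simp] linear_lift [simp]
declare bilinear_apply(1,2)[OF bilinear_cointegral, simp]
declare bilinear_apply(3)[OF bilinear_cointegral, simplified, simp]

lemma cointegral_gen:
  assumes f: "linear_map k C G f" and G[simp]: "module k G" and c: "c \<in> carrier C" "d \<in> carrier C"
  shows "tsum G (\<Delta>\<^sub>C c) (\<lambda>c1 c2. \<delta> c2 d \<odot>\<^bsub>G\<^esub> f c1) = tsum G (\<Delta>\<^sub>C d) (\<lambda>d1 d2. \<delta> c d1 \<odot>\<^bsub>G\<^esub> f d2)"
proof -
  note [simp] = f linear_op(2,3)[OF f] linear_map_smult[OF f] c
  have "f (tsum C (\<Delta>\<^sub>C c) (\<lambda>c1 c2. \<delta> c2 d \<odot>\<^bsub>C\<^esub> c1)) = tsum G (\<Delta>\<^sub>C c) (\<lambda>c1 c2. f (\<delta> c2 d \<odot>\<^bsub>C\<^esub> c1))"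
    "f (tsum C (\<Delta>\<^sub>C d) (\<lambda>d1 d2. \<delta> c d1 \<odot>\<^bsub>C\<^esub> d2)) = tsum G (\<Delta>\<^sub>C d) (\<lambda>d1 d2. f (\<delta> c d1 \<odot>\<^bsub>C\<^esub> d2))"
    by (rule linear_map_push[of k C C]; simp)+
  with cointegral[OF c] show ?thesis by simp
qed

lemma cointegral_comult_smult:
  assumes G[simp]: "module k G" and c: "c \<in> carrier C" "g \<in> carrier G"
  shows "tsum G (\<Delta>\<^sub>C c) (\<lambda>c1 c2. \<delta> c1 c2 \<odot>\<^bsub>G\<^esub> g) = \<epsilon>\<^sub>C c \<odot>\<^bsub>G\<^esub> g"
proof -
  note [simp] = c
  have "(\<lambda>r. r \<odot>\<^bsub>G\<^esub> g) (tsum (regular_module k) (\<Delta>\<^sub>C c) \<delta>) = tsum G (\<Delta>\<^sub>C c) (\<lambda>c1 c2. \<delta> c1 c2 \<odot>\<^bsub>G\<^esub> g)"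
    by (rule linear_map_push[of k C C]; simp)
  then show ?thesis by (simp add: cointegral_comult)
qed

lemma canonical_lift_gen:
  assumes F: "bilinear k A C G F" and G[simp]: "module k G" and c: "c \<in> carrier C"
  shows "tsum G (\<tau>\<^sub>0 c) (\<lambda>a a'. tsum G (\<rho> a') (\<lambda>x d. F (a \<bullet> x) d)) = tsum G (\<psi>\<^sub>R (c \<boxtimes>\<^bsub>CA\<^esub> \<one>\<^sub>A)) F"
proof -
  note [simp] = bilinear_apply[OF F] c
  from arg_cong[OF canonical_lift[OF c], where f = "\<lambda>t. tsum G t F"]
  show ?thesis by (simp add: left_mult_def)
qed

text \<open>Averaging the lift on the right with the cointegral makes it right colinear.\<close>

definition \<tau> :: "'c \<Rightarrow> ('a \<times> 'a \<Rightarrow>\<^sub>0 int) set"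
  where "\<tau> c = tsum AA (\<Delta>\<^sub>C c) (\<lambda>c1 c2. tsum AA (\<tau>\<^sub>0 c1) (\<lambda>x y. tsum AA (\<rho> y)
    (\<lambda>u d. \<delta> d c2 \<odot>\<^bsub>AA\<^esub> (x \<boxtimes>\<^bsub>AA\<^esub> u))))"

lemma linear_tau: "linear_map k C AA \<tau>"
  unfolding \<tau>_def by simp

declare linear_op(2,3)[OF linear_tau, simp] linear_tau [simp]

lemma tsum_tau:
  assumes F: "bilinear k A A G F" and G[simp]: "module k G" and c: "c \<in> carrier C"
  shows "tsum G (\<tau> c) F = tsum G (\<Delta>\<^sub>C c) (\<lambda>c1 c2. tsum G (\<tau>\<^sub>0 c1) (\<lambda>x y. tsum G (\<rho> y) (\<lambda>u d. \<delta> d c2 \<odot>\<^bsub>G\<^esub>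
    F x u)))"
proof -
  note [simp] = bilinear_apply[OF F] c
  show ?thesis by (simp add: \<tau>_def)
qed

text \<open>Right colinearity of the canonical map and of
  \<open>c \<mapsto> \<psi>\<^sub>R(c \<otimes> 1)\<close> brings the two arguments of
  \<open>\<delta>\<close> onto adjacent legs of the coproduct of \<open>c\<close>, where
  normalisation turns \<open>\<delta>\<close> into the counit.\<close>

lemma tau_canonical:
  assumes F: "bilinear k A C G F" and G[simp]: "module k G" and c: "c \<in> carrier C"
  shows "tsum G (\<tau> c) (\<lambda>a a'. tsum G (\<rho> a') (\<lambda>x d. F (a \<bullet> x) d)) = tsum G (\<psi>\<^sub>R (c \<boxtimes>\<^bsub>CA\<^esub> \<one>\<^sub>A)) F"
proof -
  note [simp] = bilinear_apply[OF F] c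
  have "tsum G (\<tau> c) (\<lambda>a a'. tsum G (\<rho> a') (\<lambda>x d. F (a \<bullet> x) d)) =
    tsum G (\<Delta>\<^sub>C c) (\<lambda>c1 c2. tsum G (\<tau>\<^sub>0 c1) (\<lambda>x y. tsum G (\<rho> y) (\<lambda>u d. tsum G (\<rho> u) (\<lambda>v e. \<delta> d c2 \<odot>\<^bsub>G\<^esub>
      F (x \<bullet> v) e))))"
    by (simp add: tsum_tau smult_tsum[of k A C])
  also have "\<dots> = tsum G (\<Delta>\<^sub>C c) (\<lambda>c1 c2. tsum G (\<tau>\<^sub>0 c1) (\<lambda>x y. tsum G (\<rho> y) (\<lambda>u d. tsum G (\<Delta>\<^sub>C d)
    (\<lambda>e d'. \<delta> d' c2 \<odot>\<^bsub>G\<^esub> F (x \<bullet> u) e))))"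
    by ((rule coaction_coassoc | rule tsum_cong[OF refl])+) simp_all
  also have "\<dots> = tsum G (\<Delta>\<^sub>C c) (\<lambda>c1 c2. tsum G (\<psi>\<^sub>R (c1 \<boxtimes>\<^bsub>CA\<^esub> \<one>\<^sub>A)) (\<lambda>u d. tsum G (\<Delta>\<^sub>C d)
    (\<lambda>e d'. \<delta> d' c2 \<odot>\<^bsub>G\<^esub> F u e)))"
    by ((rule canonical_lift_gen | rule tsum_cong[OF refl])+) simp_all
  also have "\<dots> = tsum G (\<Delta>\<^sub>C c) (\<lambda>c1 c2. tsum G (\<Delta>\<^sub>C c1) (\<lambda>p q. tsum G (\<psi>\<^sub>R (p \<boxtimes>\<^bsub>CA\<^esub> \<one>\<^sub>A)) (\<lambda>u e. \<delta> q c2 \<odot>\<^bsub>G\<^esub>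
    F u e)))"
    by ((rule psiR_one_comult | rule tsum_cong[OF refl])+) simp_all
  also have "\<dots> = tsum G (\<Delta>\<^sub>C c) (\<lambda>p r. tsum G (\<Delta>\<^sub>C r) (\<lambda>q c2. tsum G (\<psi>\<^sub>R (p \<boxtimes>\<^bsub>CA\<^esub> \<one>\<^sub>A)) (\<lambda>u e. \<delta> q c2 \<odot>\<^bsub>G\<^esub>
    F u e)))"
    by (rule coassoc) simp_all
  also have "\<dots> = tsum G (\<Delta>\<^sub>C c) (\<lambda>p r. tsum G (\<Delta>\<^sub>C r) (\<lambda>q c2. \<delta> q c2 \<odot>\<^bsub>G\<^esub> tsum G (\<psi>\<^sub>R (p \<boxtimes>\<^bsub>CA\<^esub> \<one>\<^sub>A)) F))"
    by (simp add: smult_tsum[of k A C])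
  also have "\<dots> = tsum G (\<psi>\<^sub>R (c \<boxtimes>\<^bsub>CA\<^esub> \<one>\<^sub>A)) F"
    by (simp add: cointegral_comult_smult counit)
  finally show ?thesis .
qed

text \<open>By coassociativity of \<open>\<rho>\<close> the free leg comes from the coaction on the
  lift; the cointegral identity transfers it to the coproduct of \<open>c2\<close>.\<close>

lemma tau_right_colinear:
  assumes F: "trilinear k A A C G F" and G[simp]: "module k G" and c: "c \<in> carrier C"
  shows "tsum G (\<tau> c) (\<lambda>x y. tsum G (\<rho> y) (F x)) = tsum G (\<Delta>\<^sub>C c) (\<lambda>c1 c2. tsum G (\<tau> c1) (\<lambda>x y.
    F x y c2))"
proof -
  note [simp] = trilinear_apply[OF F] c
  have "tsum G (\<tau> c) (\<lambda>x y. tsum G (\<rho> y) (F x)) =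
    tsum G (\<Delta>\<^sub>C c) (\<lambda>c1 c2. tsum G (\<tau>\<^sub>0 c1) (\<lambda>x y. tsum G (\<rho> y) (\<lambda>u d. tsum G (\<rho> u) (\<lambda>v e. \<delta> d c2 \<odot>\<^bsub>G\<^esub>
      F x v e))))"
    by (simp add: tsum_tau smult_tsum[of k A C])
  also have "\<dots> = tsum G (\<Delta>\<^sub>C c) (\<lambda>c1 c2. tsum G (\<tau>\<^sub>0 c1) (\<lambda>x y. tsum G (\<rho> y) (\<lambda>u d. tsum G (\<Delta>\<^sub>C d)
    (\<lambda>e d'. \<delta> d' c2 \<odot>\<^bsub>G\<^esub> F x u e))))"
    by ((rule coaction_coassoc | rule tsum_cong[OF refl])+) simp_all
  also have "\<dots> = tsum G (\<Delta>\<^sub>C c) (\<lambda>c1 c2. tsum G (\<tau>\<^sub>0 c1) (\<lambda>x y. tsum G (\<rho> y) (\<lambda>u d. tsum G (\<Delta>\<^sub>C c2)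
    (\<lambda>p q. \<delta> d p \<odot>\<^bsub>G\<^esub> F x u q))))"
    by ((rule cointegral_gen | rule tsum_cong[OF refl])+) simp_all
  also have "\<dots> = tsum G (\<Delta>\<^sub>C c) (\<lambda>c1 c2. tsum G (\<tau>\<^sub>0 c1) (\<lambda>x y. tsum G (\<Delta>\<^sub>C c2) (\<lambda>p q. tsum G (\<rho> y)
    (\<lambda>u d. \<delta> d p \<odot>\<^bsub>G\<^esub> F x u q))))"
    by ((rule tsum_swap[of k A C C C] | rule tsum_cong[OF refl])+) simp_all
  also have "\<dots> = tsum G (\<Delta>\<^sub>C c) (\<lambda>c1 c2. tsum G (\<Delta>\<^sub>C c2) (\<lambda>p q. tsum G (\<tau>\<^sub>0 c1) (\<lambda>x y. tsum G (\<rho> y)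
    (\<lambda>u d. \<delta> d p \<odot>\<^bsub>G\<^esub> F x u q))))"
    by ((rule tsum_swap[of k A A C C] | rule tsum_cong[OF refl])+) simp_all
  also have "\<dots> = tsum G (\<Delta>\<^sub>C c) (\<lambda>c1 c2. tsum G (\<Delta>\<^sub>C c1) (\<lambda>p q. tsum G (\<tau>\<^sub>0 p) (\<lambda>x y. tsum G (\<rho> y)
    (\<lambda>u d. \<delta> d q \<odot>\<^bsub>G\<^esub> F x u c2))))"
    by (rule coassoc[symmetric]) simp_all
  also have "\<dots> = tsum G (\<Delta>\<^sub>C c) (\<lambda>c1 c2. tsum G (\<tau> c1) (\<lambda>x y. F x y c2))"
    by (simp add: tsum_tau)
  finally show ?thesis .
qed

text \<open>The same on the left, with respect to \<open>lam\<close>; right colinearity is preserved.\<close>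

definition \<kappa> :: "'c \<Rightarrow> ('a \<times> 'a \<Rightarrow>\<^sub>0 int) set"
  where "\<kappa> c = tsum AA (\<Delta>\<^sub>C c) (\<lambda>c1 c2. tsum AA (\<tau> c2) (\<lambda>x y. tsum AA (lam x)
    (\<lambda>d u. \<delta> c1 d \<odot>\<^bsub>AA\<^esub> (u \<boxtimes>\<^bsub>AA\<^esub> y))))"

lemma linear_kappa: "linear_map k C AA \<kappa>"
  unfolding \<kappa>_def by simp

declare linear_op(2,3)[OF linear_kappa, simp] linear_kappa [simp]

lemma tsum_kappa:
  assumes F: "bilinear k A A G F" and G[simp]: "module k G" and c: "c \<in> carrier C"
  shows "tsum G (\<kappa> c) F = tsum G (\<Delta>\<^sub>C c) (\<lambda>c1 c2. tsum G (\<tau> c2) (\<lambda>x y. tsum G (lam x) (\<lambda>d u. \<delta> c1 d \<odot>\<^bsub>G\<^esub>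
    F u y)))"
proof -
  note [simp] = bilinear_apply[OF F] c
  show ?thesis by (simp add: \<kappa>_def)
qed

text \<open>Coassociativity of \<open>\<rho>\<close> at \<open>b\<close> followed by
  \<open>psiL_coaction\<close>: the canonical map carries \<open>lam\<close> on the first factor to
  the left coaction of the coring used in \<open>psiR_one_left_coaction\<close>.\<close>

lemma canonical_left_colinear:
  assumes F: "trilinear k C A C G F" and G[simp]: "module k G" and a: "a \<in> carrier A" "b \<in> carrier A"
  shows "tsum G (lam a) (\<lambda>d u. tsum G (\<rho> b) (\<lambda>v e. F d (u \<bullet> v) e)) =
    tsum G (\<rho> b) (\<lambda>v e. tsum G (\<Delta>\<^sub>C e) (\<lambda>p q. tsum G (\<psi>\<^sub>L ((a \<bullet> v) \<boxtimes>\<^bsub>AC\<^esub> p)) (\<lambda>d u. F d u q)))"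
proof -
  note [simp] = trilinear_apply[OF F] a
  have "tsum G (\<rho> b) (\<lambda>v e. tsum G (\<Delta>\<^sub>C e) (\<lambda>p q. tsum G (\<psi>\<^sub>L ((a \<bullet> v) \<boxtimes>\<^bsub>AC\<^esub> p)) (\<lambda>d u. F d u q))) =
    tsum G (\<rho> b) (\<lambda>v e. tsum G (\<rho> v) (\<lambda>w p. tsum G (\<psi>\<^sub>L ((a \<bullet> w) \<boxtimes>\<^bsub>AC\<^esub> p)) (\<lambda>d u. F d u e)))"
    by (rule coaction_coassoc[symmetric]) simp_all
  also have "\<dots> = tsum G (\<rho> b) (\<lambda>v e. tsum G (lam a) (\<lambda>d u. F d (u \<bullet> v) e))"
    by (simp add: psiL_coaction)
  also have "\<dots> = tsum G (lam a) (\<lambda>d u. tsum G (\<rho> b) (\<lambda>v e. F d (u \<bullet> v) e))"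
    by (rule tsum_swap[of k A C C A]) simp_all
  finally show ?thesis ..
qed

text \<open>The mirror image of \<open>tau_canonical\<close>, with left colinearity of the canonical
  map and of \<open>c \<mapsto> \<psi>\<^sub>R(c \<otimes> 1)\<close>.\<close>

lemma kappa_canonical:
  assumes F: "bilinear k A C G F" and G[simp]: "module k G" and c: "c \<in> carrier C"
  shows "tsum G (\<kappa> c) (\<lambda>a a'. tsum G (\<rho> a') (\<lambda>x d. F (a \<bullet> x) d)) = tsum G (\<psi>\<^sub>R (c \<boxtimes>\<^bsub>CA\<^esub> \<one>\<^sub>A)) F"
proof -
  note [simp] = bilinear_apply[OF F] c
  have "tsum G (\<kappa> c) (\<lambda>a a'. tsum G (\<rho> a') (\<lambda>x d. F (a \<bullet> x) d)) =
    tsum G (\<Delta>\<^sub>C c) (\<lambda>c1 c2. tsum G (\<tau> c2) (\<lambda>x y. tsum G (lam x) (\<lambda>d u. tsum G (\<rho> y) (\<lambda>v e. \<delta> c1 d \<odot>\<^bsub>G\<^esub>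
      F (u \<bullet> v) e))))"
    by (simp add: tsum_kappa smult_tsum[of k A C])
  also have "\<dots> = tsum G (\<Delta>\<^sub>C c) (\<lambda>c1 c2. tsum G (\<tau> c2) (\<lambda>x y. tsum G (\<rho> y) (\<lambda>v e. tsum G (\<Delta>\<^sub>C e) (\<lambda>p q.
      tsum G (\<psi>\<^sub>L ((x \<bullet> v) \<boxtimes>\<^bsub>AC\<^esub> p)) (\<lambda>d u. \<delta> c1 d \<odot>\<^bsub>G\<^esub> F u q)))))"
    by ((rule canonical_left_colinear | rule tsum_cong[OF refl])+) simp_all
  also have "\<dots> = tsum G (\<Delta>\<^sub>C c) (\<lambda>c1 c2. tsum G (\<psi>\<^sub>R (c2 \<boxtimes>\<^bsub>CA\<^esub> \<one>\<^sub>A)) (\<lambda>v e. tsum G (\<Delta>\<^sub>C e) (\<lambda>p q.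
      tsum G (\<psi>\<^sub>L (v \<boxtimes>\<^bsub>AC\<^esub> p)) (\<lambda>d u. \<delta> c1 d \<odot>\<^bsub>G\<^esub> F u q))))"
    by ((rule tau_canonical | rule tsum_cong[OF refl])+) simp_all
  also have "\<dots> = tsum G (\<Delta>\<^sub>C c) (\<lambda>c1 c2. tsum G (\<Delta>\<^sub>C c2) (\<lambda>p q. tsum G (\<psi>\<^sub>R (q \<boxtimes>\<^bsub>CA\<^esub> \<one>\<^sub>A)) (\<lambda>u e. \<delta> c1 p \<odot>\<^bsub>G\<^esub>
    F u e)))"
    by ((rule psiR_one_left_coaction | rule tsum_cong[OF refl])+) simp_all
  also have "\<dots> = tsum G (\<Delta>\<^sub>C c) (\<lambda>r q. tsum G (\<Delta>\<^sub>C r) (\<lambda>c1 p. tsum G (\<psi>\<^sub>R (q \<boxtimes>\<^bsub>CA\<^esub> \<one>\<^sub>A)) (\<lambda>u e. \<delta> c1 p \<odot>\<^bsub>G\<^esub>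
    F u e)))"
    by (rule coassoc[symmetric]) simp_all
  also have "\<dots> = tsum G (\<Delta>\<^sub>C c) (\<lambda>r q. tsum G (\<Delta>\<^sub>C r) (\<lambda>c1 p. \<delta> c1 p \<odot>\<^bsub>G\<^esub> tsum G (\<psi>\<^sub>R (q \<boxtimes>\<^bsub>CA\<^esub> \<one>\<^sub>A)) F))"
    by (simp add: smult_tsum[of k A C])
  also have "\<dots> = tsum G (\<psi>\<^sub>R (c \<boxtimes>\<^bsub>CA\<^esub> \<one>\<^sub>A)) F"
    by (simp add: cointegral_comult_smult counit)
  finally show ?thesis .
qed

text \<open>The left average involves the first factor of \<open>\<tau>\<close> and the first leg of
  \<open>c\<close>, so it commutes with the right coaction on the second factor.\<close>

lemma kappa_right_colinear:
  assumes F: "trilinear k A A C G F" and G[simp]: "module k G" and c: "c \<in> carrier C"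
  shows "tsum G (\<kappa> c) (\<lambda>x y. tsum G (\<rho> y) (F x)) = tsum G (\<Delta>\<^sub>C c) (\<lambda>c1 c2. tsum G (\<kappa> c1) (\<lambda>x y.
    F x y c2))"
proof -
  note [simp] = trilinear_apply[OF F] c
  have "tsum G (\<kappa> c) (\<lambda>x y. tsum G (\<rho> y) (F x)) =
    tsum G (\<Delta>\<^sub>C c) (\<lambda>c1 c2. tsum G (\<tau> c2) (\<lambda>x y. tsum G (lam x) (\<lambda>d u. tsum G (\<rho> y) (\<lambda>v e. \<delta> c1 d \<odot>\<^bsub>G\<^esub>
      F u v e))))"
    by (simp add: tsum_kappa smult_tsum[of k A C])
  also have "\<dots> = tsum G (\<Delta>\<^sub>C c) (\<lambda>c1 c2. tsum G (\<tau> c2) (\<lambda>x y. tsum G (\<rho> y) (\<lambda>v e. tsum G (lam x)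
    (\<lambda>d u. \<delta> c1 d \<odot>\<^bsub>G\<^esub> F u v e))))"
    by ((rule tsum_swap[of k C A A C] | rule tsum_cong[OF refl])+) simp_all
  also have "\<dots> = tsum G (\<Delta>\<^sub>C c) (\<lambda>c1 c2. tsum G (\<Delta>\<^sub>C c2) (\<lambda>p q. tsum G (\<tau> p) (\<lambda>x y. tsum G (lam x)
    (\<lambda>d u. \<delta> c1 d \<odot>\<^bsub>G\<^esub> F u y q))))"
    by ((rule tau_right_colinear | rule tsum_cong[OF refl])+) simp_all
  also have "\<dots> = tsum G (\<Delta>\<^sub>C c) (\<lambda>r q. tsum G (\<Delta>\<^sub>C r) (\<lambda>c1 p. tsum G (\<tau> p) (\<lambda>x y. tsum G (lam x)
    (\<lambda>d u. \<delta> c1 d \<odot>\<^bsub>G\<^esub> F u y q))))"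
    by (rule coassoc[symmetric]) simp_all
  also have "\<dots> = tsum G (\<Delta>\<^sub>C c) (\<lambda>c1 c2. tsum G (\<kappa> c1) (\<lambda>x y. F x y c2))"
    by (simp add: tsum_kappa)
  finally show ?thesis .
qed

text \<open>The mirror image of \<open>tau_right_colinear\<close>: coassociativity of
  \<open>lam\<close> supplies the free leg, and the cointegral identity transfers it to the
  coproduct of \<open>c1\<close>.\<close>

lemma kappa_left_colinear:
  assumes F: "trilinear k C A A G F" and G[simp]: "module k G" and c: "c \<in> carrier C"
  shows "tsum G (\<kappa> c) (\<lambda>x y. tsum G (lam x) (\<lambda>d u. F d u y)) = tsum G (\<Delta>\<^sub>C c) (\<lambda>c1 c2. tsum G (\<kappa> c2)
    (F c1))"
proof -
  note [simp] = trilinear_apply[OF F] c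
  have "tsum G (\<kappa> c) (\<lambda>x y. tsum G (lam x) (\<lambda>d u. F d u y)) =
    tsum G (\<Delta>\<^sub>C c) (\<lambda>c1 c2. tsum G (\<tau> c2) (\<lambda>x y. tsum G (lam x) (\<lambda>d u. tsum G (lam u) (\<lambda>e v. \<delta> c1 d \<odot>\<^bsub>G\<^esub>
      F e v y))))"
    by (simp add: tsum_kappa smult_tsum[of k C A])
  also have "\<dots> = tsum G (\<Delta>\<^sub>C c) (\<lambda>c1 c2. tsum G (\<tau> c2) (\<lambda>x y. tsum G (lam x) (\<lambda>d u. tsum G (\<Delta>\<^sub>C d)
    (\<lambda>p q. \<delta> c1 p \<odot>\<^bsub>G\<^esub> F q u y))))"
    by ((rule lam_coassoc[symmetric] | rule tsum_cong[OF refl])+) simp_all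
  also have "\<dots> = tsum G (\<Delta>\<^sub>C c) (\<lambda>c1 c2. tsum G (\<tau> c2) (\<lambda>x y. tsum G (lam x) (\<lambda>d u. tsum G (\<Delta>\<^sub>C c1)
    (\<lambda>p q. \<delta> q d \<odot>\<^bsub>G\<^esub> F p u y))))"
    by ((rule cointegral_gen[symmetric] | rule tsum_cong[OF refl])+) simp_all
  also have "\<dots> = tsum G (\<Delta>\<^sub>C c) (\<lambda>c1 c2. tsum G (\<tau> c2) (\<lambda>x y. tsum G (\<Delta>\<^sub>C c1) (\<lambda>p q. tsum G (lam x)
    (\<lambda>d u. \<delta> q d \<odot>\<^bsub>G\<^esub> F p u y))))"
    by ((rule tsum_swap[of k C A C C] | rule tsum_cong[OF refl])+) simp_all
  also have "\<dots> = tsum G (\<Delta>\<^sub>C c) (\<lambda>c1 c2. tsum G (\<Delta>\<^sub>C c1) (\<lambda>p q. tsum G (\<tau> c2) (\<lambda>x y. tsum G (lam x)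
    (\<lambda>d u. \<delta> q d \<odot>\<^bsub>G\<^esub> F p u y))))"
    by ((rule tsum_swap[of k A A C C] | rule tsum_cong[OF refl])+) simp_all
  also have "\<dots> = tsum G (\<Delta>\<^sub>C c) (\<lambda>p r. tsum G (\<Delta>\<^sub>C r) (\<lambda>q c2. tsum G (\<tau> c2) (\<lambda>x y. tsum G (lam x)
    (\<lambda>d u. \<delta> q d \<odot>\<^bsub>G\<^esub> F p u y))))"
    by (rule coassoc) simp_all
  also have "\<dots> = tsum G (\<Delta>\<^sub>C c) (\<lambda>c1 c2. tsum G (\<kappa> c2) (F c1))"
    by (simp add: tsum_kappa)
  finally show ?thesis .
qed

section \<open>The section of the product with values in \<open>A \<otimes> A\<close>\<close>

definition sec :: "'a \<Rightarrow> ('a \<times> 'a \<Rightarrow>\<^sub>0 int) set"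
  where "sec a = tsum AA (\<rho> a) (\<lambda>x c. tsum AA (\<kappa> c) (\<lambda>y z. (x \<bullet> y) \<boxtimes>\<^bsub>AA\<^esub> z))"

lemma linear_sec: "linear_map k A AA sec"
  unfolding sec_def by simp

declare linear_op(2,3)[OF linear_sec, simp] linear_sec [simp]

lemma tsum_sec:
  assumes F: "bilinear k A A G F" and G[simp]: "module k G" and a: "a \<in> carrier A"
  shows "tsum G (sec a) F = tsum G (\<rho> a) (\<lambda>x c. tsum G (\<kappa> c) (\<lambda>y z. F (x \<bullet> y) z))"
proof -
  note [simp] = bilinear_apply[OF F] a
  show ?thesis by (simp add: sec_def)
qed

text \<open>By \<open>kappa_canonical\<close> the canonical image of \<open>sec a\<close> is
  \<open>p_R\<close> applied to \<open>\<rho> a\<close>, which is \<open>\<rho> a\<close> itself.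
  The counit on \<open>C\<close> turns the canonical image into the product of the two factors, and
  \<open>\<rho> a\<close> into \<open>a\<close>.\<close>

lemma sec_mult:
  assumes a: "a \<in> carrier A" shows "tsum A (sec a) (\<bullet>) = a"
proof -
  note [simp] = a
  have m: "x \<bullet> tsum A t (\<lambda>y c. \<epsilon>\<^sub>C c \<odot>\<^bsub>A\<^esub> y) = tsum A t (\<lambda>y c. \<epsilon>\<^sub>C c \<odot>\<^bsub>A\<^esub> (x \<bullet> y))"
    if "x \<in> carrier A" "t \<in> carrier AC" for x t
  proof -
    have "x \<bullet> tsum A t (\<lambda>y c. \<epsilon>\<^sub>C c \<odot>\<^bsub>A\<^esub> y) = tsum A t (\<lambda>y c. x \<bullet> (\<epsilon>\<^sub>C c \<odot>\<^bsub>A\<^esub> y))"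
      by (rule linear_map_push[of k A C]) (use that in simp_all)
    then show ?thesis using that by (simp add: A.smult_mult_right)
  qed
  have e: "tsum A (\<rho> z) (\<lambda>v d. \<epsilon>\<^sub>C d \<odot>\<^bsub>A\<^esub> (x \<bullet> (y \<bullet> v))) = x \<bullet> (y \<bullet> z)"
    if "x \<in> carrier A" "y \<in> carrier A" "z \<in> carrier A" for x y z
    using m[of "x \<bullet> y" "\<rho> z"] coaction_counit[of z] that by (simp add: A.m_assoc)
  \<comment> \<open>The last factor \<open>z\<close> is expanded by the counit of
    \<open>\<rho>\<close>, so that the canonical map becomes visible.\<close>
  have "tsum A (sec a) (\<bullet>) = tsum A (\<rho> a) (\<lambda>x c. tsum A (\<kappa> c) (\<lambda>y z. tsum A (\<rho> z)
    (\<lambda>v d. \<epsilon>\<^sub>C d \<odot>\<^bsub>A\<^esub> (x \<bullet> (y \<bullet> v)))))"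
    by (simp add: tsum_sec A.m_assoc e)
  also have "\<dots> = tsum A (\<rho> a) (\<lambda>x c. tsum A (\<psi>\<^sub>R (c \<boxtimes>\<^bsub>CA\<^esub> \<one>\<^sub>A)) (\<lambda>y d. \<epsilon>\<^sub>C d \<odot>\<^bsub>A\<^esub> (x \<bullet> y)))"
    by ((rule kappa_canonical | rule tsum_cong[OF refl])+) simp_all
  also have "\<dots> = tsum A (\<rho> (a \<bullet> \<one>\<^sub>A)) (\<lambda>x c. \<epsilon>\<^sub>C c \<odot>\<^bsub>A\<^esub> x)"
    by (rule coaction_mult[symmetric]) simp_all
  finally show ?thesis by (simp add: coaction_counit)
qed

lemma sec_right_colinear:
  assumes F: "trilinear k A A C G F" and G[simp]: "module k G" and a: "a \<in> carrier A"
  shows "tsum G (sec a) (\<lambda>x y. tsum G (\<rho> y) (F x)) = tsum G (\<rho> a) (\<lambda>x c. tsum G (sec x) (\<lambda>y z.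
    F y z c))"
proof -
  note [simp] = trilinear_apply[OF F] a
  have "tsum G (sec a) (\<lambda>x y. tsum G (\<rho> y) (F x)) =
    tsum G (\<rho> a) (\<lambda>x c. tsum G (\<Delta>\<^sub>C c) (\<lambda>c1 c2. tsum G (\<kappa> c1) (\<lambda>y z. F (x \<bullet> y) z c2)))"
    by (simp add: tsum_sec kappa_right_colinear)
  also have "\<dots> = tsum G (\<rho> a) (\<lambda>x c. tsum G (\<rho> x) (\<lambda>v d. tsum G (\<kappa> d) (\<lambda>y z. F (v \<bullet> y) z c)))"
    by (rule coaction_coassoc[symmetric]) simp_all
  also have "\<dots> = tsum G (\<rho> a) (\<lambda>x c. tsum G (sec x) (\<lambda>y z. F y z c))"
    by (simp add: tsum_sec)
  finally show ?thesis .
qed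

section \<open>The algebra of coinvariants\<close>

abbreviation "B \<equiv> coinvariants k A C \<rho>"

lemma B_simps [simp]:
  "\<zero>\<^bsub>B\<^esub> = \<zero>\<^bsub>A\<^esub>" "\<one>\<^bsub>B\<^esub> = \<one>\<^sub>A" "add B = add A" "monoid.mult B = monoid.mult A" "smult B = smult A"
  by (simp_all add: coinvariants_def)

lemma carrier_B: "carrier B = {b \<in> carrier A. \<forall>a \<in> carrier A. \<rho> (b \<bullet> a) = left_mult A AC b (\<rho> a)}"
  by (simp add: coinvariants_def)

lemma B_subset: "b \<in> carrier B \<Longrightarrow> b \<in> carrier A"
  by (simp add: carrier_B)

lemma linear_left_mult:
  "a \<in> carrier A \<Longrightarrow> linear_map k AC AC (left_mult A AC a)"
  unfolding left_mult_def by simp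

text \<open>Testing at the unit is enough, because the entwined module condition expresses the
  coaction of a product with \<open>a\<close> through the coaction of its left factor.\<close>

lemma coinvariantI:
  assumes b: "b \<in> carrier A" and e: "\<rho> b = left_mult A AC b (\<rho> \<one>\<^sub>A)"
  shows "b \<in> carrier B"
proof -
  have "\<rho> (b \<bullet> a) = left_mult A AC b (\<rho> a)" if a: "a \<in> carrier A" for a
  proof -
    note [simp] = a b
    have "tsum AC (\<rho> (b \<bullet> a)) (\<lambda>x y. x \<boxtimes>\<^bsub>AC\<^esub> y) =
      tsum AC (\<rho> b) (\<lambda>x c. tsum AC (\<psi>\<^sub>R (c \<boxtimes>\<^bsub>CA\<^esub> a)) (\<lambda>b' c'. (x \<bullet> b') \<boxtimes>\<^bsub>AC\<^esub> c'))"
      by (rule coaction_mult) simp_all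
    also have "\<dots> = tsum AC (\<rho> \<one>\<^sub>A) (\<lambda>x c. tsum AC (\<psi>\<^sub>R (c \<boxtimes>\<^bsub>CA\<^esub> a)) (\<lambda>b' c'. (b \<bullet> (x \<bullet> b')) \<boxtimes>\<^bsub>AC\<^esub> c'))"
      unfolding e left_mult_def by (simp add: A.m_assoc)
    also have "\<dots> = tsum AC (\<rho> (\<one>\<^sub>A \<bullet> a)) (\<lambda>x c. (b \<bullet> x) \<boxtimes>\<^bsub>AC\<^esub> c)"
      by (rule coaction_mult[symmetric]) simp_all
    finally show ?thesis by (simp add: left_mult_def)
  qed
  then show ?thesis using b by (simp add: carrier_B)
qed

lemma coinvariant_one [simp]: "\<one>\<^sub>A \<in> carrier B"
  by (rule coinvariantI) (simp_all add: left_mult_def)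

text \<open>Coinvariants are the elements where this map agrees with \<open>\<rho>\<close>. Since
  both are linear, \<open>B\<close> is closed under sums and scalars.\<close>

lemma linear_coinvariant_defect:
  "linear_map k A AC (\<lambda>b. left_mult A AC b (\<rho> \<one>\<^sub>A))"
  unfolding left_mult_def by simp

lemma coinvariantD: "b \<in> carrier B \<Longrightarrow> a \<in> carrier A \<Longrightarrow> \<rho> (b \<bullet> a) = left_mult A AC b (\<rho> a)"
  by (simp add: carrier_B)

lemma coinvariantD_one: "b \<in> carrier B \<Longrightarrow> \<rho> b = left_mult A AC b (\<rho> \<one>\<^sub>A)"
  using coinvariantD[of b "\<one>\<^sub>A"] B_subset by simp

lemma coinvariant_smult: "r \<in> carrier k \<Longrightarrow> b \<in> carrier B \<Longrightarrow> r \<odot>\<^bsub>A\<^esub> b \<in> carrier B"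
  by (rule coinvariantI) (simp_all add: B_subset linear_map_smult[OF linear_maps(1)]
    linear_map_smult[OF linear_coinvariant_defect] coinvariantD_one[symmetric])

lemma coinvariant_add: "a \<in> carrier B \<Longrightarrow> b \<in> carrier B \<Longrightarrow> a \<oplus>\<^bsub>A\<^esub> b \<in> carrier B"
  by (rule coinvariantI) (simp_all add: B_subset linear_map_add[OF linear_maps(1)]
    linear_map_add[OF linear_coinvariant_defect] coinvariantD_one[symmetric])

lemma left_mult_mult:
  "a \<in> carrier A \<Longrightarrow> b \<in> carrier A \<Longrightarrow> t \<in> carrier AC \<Longrightarrow>
   left_mult A AC (a \<bullet> b) t = left_mult A AC a (left_mult A AC b t)"
  by (simp add: left_mult_def A.m_assoc)

lemma coinvariant_mult: "a \<in> carrier B \<Longrightarrow> b \<in> carrier B \<Longrightarrow> a \<bullet> b \<in> carrier B"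
  by (rule coinvariantI) (simp_all add: B_subset coinvariantD[of a b] coinvariantD_one[of b] left_mult_mult)

lemma ring_B: "ring B"
proof (rule ringI)
  have neg: "\<ominus>\<^bsub>A\<^esub> b \<in> carrier B" if "b \<in> carrier B" for b
    using coinvariant_smult[of "\<ominus>\<^bsub>k\<^esub> \<one>\<^bsub>k\<^esub>" b] that B_subset[OF that] A.smult_l_minus[of "\<one>\<^bsub>k\<^esub>" b] by simp
  have zero: "\<zero>\<^bsub>A\<^esub> \<in> carrier B"
    using coinvariant_smult[of "\<zero>\<^bsub>k\<^esub>" "\<one>\<^sub>A"] by simp
  show "abelian_group B"
  proof (rule abelian_groupI)
    fix x assume x: "x \<in> carrier B"
    then show "\<exists>y \<in> carrier B. y \<oplus>\<^bsub>B\<^esub> x = \<zero>\<^bsub>B\<^esub>"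
      using neg[OF x] B_subset[OF x] A.l_neg[of x] by auto
  qed (use zero in \<open>auto simp: coinvariant_add B_subset A.M.a_ac\<close>)
  show "monoid B"
    by (rule monoidI) (auto simp: coinvariant_mult B_subset A.m_assoc)
qed (auto simp: B_subset A.l_distr A.r_distr)

sublocale B: ring B by (rule ring_B)

lemma module_B [simp]: "module k B"
  by (rule moduleI)
    (auto simp: A.R.is_cring B.is_abelian_group coinvariant_smult B_subset A.smult_l_distr A.smult_r_distr A.smult_assoc1)

lemma linear_incl: "linear_map k X B f \<Longrightarrow> linear_map k X A f"
  by (auto simp: linear_map_def B_subset Pi_iff)

lemma slice_coinvariant:
  assumes f: "linear_map k A (regular_module k) f" and a: "a \<in> carrier A"
  shows "tsum A (sec a) (\<lambda>x y. f y \<odot>\<^bsub>A\<^esub> x) \<in> carrier B"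
proof -
  note [simp] = a f linear_op(2)[OF f] linear_op(3)[OF f, simplified]
  let ?b = "tsum A (sec a) (\<lambda>x y. f y \<odot>\<^bsub>A\<^esub> x)"
  have b[simp]: "?b \<in> carrier A" by simp
  have "lam ?b = tsum CA (sec a) (\<lambda>x y. lam (f y \<odot>\<^bsub>A\<^esub> x))"
    by (rule linear_map_push[of k A A]) simp_all
  also have "\<dots> = tsum CA (\<rho> a) (\<lambda>x c. tsum CA (\<kappa> c) (\<lambda>y z. f z \<odot>\<^bsub>CA\<^esub> lam (x \<bullet> y)))"
    by (simp add: tsum_sec linear_map_smult[OF linear_lam])
  also have "\<dots> = tsum CA (\<rho> a) (\<lambda>x c. tsum CA (\<kappa> c) (\<lambda>y z. tsum CA (lam y) (\<lambda>d u.
      f z \<odot>\<^bsub>CA\<^esub> tsum CA (\<psi>\<^sub>L (x \<boxtimes>\<^bsub>AC\<^esub> d)) (\<lambda>e v. e \<boxtimes>\<^bsub>CA\<^esub> (v \<bullet> u)))))"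
  proof -
    have "lam (x \<bullet> y) = tsum CA (lam y) (\<lambda>d u. tsum CA (\<psi>\<^sub>L (x \<boxtimes>\<^bsub>AC\<^esub> d)) (\<lambda>e v. e \<boxtimes>\<^bsub>CA\<^esub> (v \<bullet> u)))"
      if "x \<in> carrier A" "y \<in> carrier A" for x y
      using lam_mult[OF bilinear_pure_tensor, of x y] that by simp
    then show ?thesis by (simp add: smult_tsum[of k C A])
  qed
  \<comment> \<open>Left colinearity of \<open>\<kappa>\<close> replaces \<open>lam\<close> on its
    first factor by the first leg of the coproduct of \<open>c\<close>.\<close>
  also have "\<dots> = tsum CA (\<rho> a) (\<lambda>x c. tsum CA (\<Delta>\<^sub>C c) (\<lambda>c1 c2. tsum CA (\<kappa> c2) (\<lambda>u z.
      f z \<odot>\<^bsub>CA\<^esub> tsum CA (\<psi>\<^sub>L (x \<boxtimes>\<^bsub>AC\<^esub> c1)) (\<lambda>e v. e \<boxtimes>\<^bsub>CA\<^esub> (v \<bullet> u)))))"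
    by ((rule kappa_left_colinear | rule tsum_cong[OF refl])+) simp_all
  \<comment> \<open>Coassociativity converts that leg into a coaction on \<open>x\<close>, so that
    \<open>\<psi>\<^sub>L\<close> is now applied to \<open>\<rho> x\<close>.\<close>
  also have "\<dots> = tsum CA (\<rho> a) (\<lambda>x c. tsum CA (\<rho> x) (\<lambda>y d. tsum CA (\<kappa> c) (\<lambda>u z.
      f z \<odot>\<^bsub>CA\<^esub> tsum CA (\<psi>\<^sub>L (y \<boxtimes>\<^bsub>AC\<^esub> d)) (\<lambda>e v. e \<boxtimes>\<^bsub>CA\<^esub> (v \<bullet> u)))))"
    by (rule coaction_coassoc[symmetric]) simp_all
  also have "\<dots> = tsum CA (\<rho> a) (\<lambda>x c. tsum CA (\<kappa> c) (\<lambda>u z. tsum CA (\<rho> x) (\<lambda>y d.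
      tsum CA (\<psi>\<^sub>L ((\<one>\<^sub>A \<bullet> y) \<boxtimes>\<^bsub>AC\<^esub> d)) (\<lambda>e v. f z \<odot>\<^bsub>CA\<^esub> (e \<boxtimes>\<^bsub>CA\<^esub> (v \<bullet> u))))))"
  proof -
    have "tsum CA (\<rho> a) (\<lambda>x c. tsum CA (\<rho> x) (\<lambda>y d. tsum CA (\<kappa> c) (\<lambda>u z.
        f z \<odot>\<^bsub>CA\<^esub> tsum CA (\<psi>\<^sub>L (y \<boxtimes>\<^bsub>AC\<^esub> d)) (\<lambda>e v. e \<boxtimes>\<^bsub>CA\<^esub> (v \<bullet> u))))) =
      tsum CA (\<rho> a) (\<lambda>x c. tsum CA (\<kappa> c) (\<lambda>u z. tsum CA (\<rho> x) (\<lambda>y d.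
        f z \<odot>\<^bsub>CA\<^esub> tsum CA (\<psi>\<^sub>L (y \<boxtimes>\<^bsub>AC\<^esub> d)) (\<lambda>e v. e \<boxtimes>\<^bsub>CA\<^esub> (v \<bullet> u)))))"
      by ((rule tsum_swap[of k A C A A] | rule tsum_cong[OF refl])+) simp_all
    then show ?thesis by (simp add: smult_tsum[of k C A])
  qed
  \<comment> \<open>By \<open>psiL_coaction\<close> at the unit,
    \<open>\<psi>\<^sub>L(\<rho>(x))\<close> is \<open>\<lambda>(1) x\<close>. The factor
    \<open>x\<close> recombines with \<open>u\<close> and \<open>z\<close> to
    \<open>sec a\<close>.\<close>
  also have "\<dots> = tsum CA (\<rho> a) (\<lambda>x c. tsum CA (\<kappa> c) (\<lambda>u z. tsum CA (lam \<one>\<^sub>A) (\<lambda>e v.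
      f z \<odot>\<^bsub>CA\<^esub> (e \<boxtimes>\<^bsub>CA\<^esub> ((v \<bullet> x) \<bullet> u)))))"
    by ((rule psiL_coaction | rule tsum_cong[OF refl])+) simp_all
  also have "\<dots> = tsum CA (sec a) (\<lambda>x z. f z \<odot>\<^bsub>CA\<^esub> tsum CA (lam \<one>\<^sub>A) (\<lambda>e v. e \<boxtimes>\<^bsub>CA\<^esub> (v \<bullet> x)))"
    by (simp add: tsum_sec A.m_assoc smult_tsum[of k C A])
  also have "\<dots> = tsum CA (sec a) (\<lambda>x z. (\<lambda>b. tsum CA (lam \<one>\<^sub>A) (\<lambda>e v. e \<boxtimes>\<^bsub>CA\<^esub> (v \<bullet> b))) (f z \<odot>\<^bsub>A\<^esub> x))"
  proof -
    have "linear_map k A CA (\<lambda>b. tsum CA (lam \<one>\<^sub>A) (\<lambda>e v. e \<boxtimes>\<^bsub>CA\<^esub> (v \<bullet> b)))" by simp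
    from linear_map_smult[OF this] show ?thesis by simp
  qed
  also have "\<dots> = (\<lambda>b. tsum CA (lam \<one>\<^sub>A) (\<lambda>e v. e \<boxtimes>\<^bsub>CA\<^esub> (v \<bullet> b))) ?b"
    by (rule linear_map_push[of k A A, symmetric]) simp_all
  \<comment> \<open>The same rule backwards: \<open>\<lambda>(1)\<close> times the slice is
    \<open>\<psi>\<^sub>L\<close> of the coaction of the slice.\<close>
  also have "\<dots> = tsum CA (\<rho> ?b) (\<lambda>x c. tsum CA (\<psi>\<^sub>L ((\<one>\<^sub>A \<bullet> x) \<boxtimes>\<^bsub>AC\<^esub> c)) (\<lambda>e v. e \<boxtimes>\<^bsub>CA\<^esub> v))"
    using psiL_coaction[OF bilinear_pure_tensor, of "\<one>\<^sub>A" ?b] b by simp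
  also have "\<dots> = \<psi>\<^sub>L (\<rho> ?b)"
  proof -
    have "\<psi>\<^sub>L (tsum AC (\<rho> ?b) (\<lambda>x c. x \<boxtimes>\<^bsub>AC\<^esub> c)) = tsum CA (\<rho> ?b) (\<lambda>x c. \<psi>\<^sub>L (x \<boxtimes>\<^bsub>AC\<^esub> c))"
      by (rule linear_map_push[of k A C]) simp_all
    then show ?thesis by simp
  qed
  finally have "\<psi>\<^sub>R (lam ?b) = \<rho> ?b"
    by (simp add: psiR_psiL p_R_coaction)
  \<comment> \<open>The composite of the entwining maps is \<open>p_R\<close>, which is left linear
    over \<open>A\<close> and fixes the coaction of the unit.\<close>
  moreover have "\<psi>\<^sub>R (lam ?b) = left_mult A AC ?b (\<rho> \<one>\<^sub>A)"
  proof -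
    have "\<psi>\<^sub>L (left_mult A AC ?b (\<rho> \<one>\<^sub>A)) = lam ?b"
      unfolding left_mult_def lam_def
      by (rule linear_map_push[of k A C]) simp_all
    then have "\<psi>\<^sub>R (lam ?b) = p_R k A C \<psi>\<^sub>R (left_mult A AC ?b (\<rho> \<one>\<^sub>A))"
      using psiR_psiL[of "left_mult A AC ?b (\<rho> \<one>\<^sub>A)"] by (simp add: left_mult_def)
    also have "\<dots> = left_mult A AC ?b (p_R k A C \<psi>\<^sub>R (\<rho> \<one>\<^sub>A))"
      using b by (simp add: p_R_eq left_mult_def A.m_assoc)
    finally show ?thesis by (simp add: p_R_coaction)
  qed
  ultimately show ?thesis by (intro coinvariantI b) simp
qed

section \<open>Factorisation of the section through \<open>B \<otimes> A\<close>\<close>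

abbreviation "BA \<equiv> tensor k B A"

lemma linear_B_A [simp]: "linear_map k B A (\<lambda>x. x)"
  by (rule linear_incl[OF linear_id])

lemmas BA_rules = tensor_rules[OF module_B module_A]

lemma tsum_BA_AA:
  assumes F: "bilinear k A A G F" and G[simp]: "module k G" and t: "t \<in> carrier BA"
  shows "tsum G (tsum AA t (\<lambda>b a. b \<boxtimes>\<^bsub>AA\<^esub> a)) F = tsum G t F"
proof -
  note [simp] = bilinear_apply[OF F] t BA_rules B_subset
  show ?thesis by simp
qed

lemma linear_BA_AA: "linear_map k BA AA (\<lambda>t. tsum AA t (\<lambda>b a. b \<boxtimes>\<^bsub>AA\<^esub> a))"
  using BA_rules(3)[OF _ linear_id, of AA] B_subset by simp

lemma sec_left_linear:
  assumes b: "b \<in> carrier B" and a: "a \<in> carrier A"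
  shows "sec (b \<bullet> a) = tsum AA (sec a) (\<lambda>x y. (b \<bullet> x) \<boxtimes>\<^bsub>AA\<^esub> y)"
proof -
  note [simp] = B_subset[OF b] a
  show ?thesis
    by (simp add: tsum_sec) (simp add: sec_def coinvariantD[OF b] left_mult_def A.m_assoc)
qed

context
  assumes A_projective: "projective k A" and C_projective: "projective k C"
begin

text \<open>Tensoring an inclusion over \<open>k\<close> need not preserve injectivity in general;
  here it does because the second factor \<open>A\<close> is projective.\<close>

lemma inj_BA_AA: "inj_on (\<lambda>t. tsum AA t (\<lambda>b a. b \<boxtimes>\<^bsub>AA\<^esub> a)) (carrier BA)"
proof -
  obtain I :: "'a set" and f e where d: "dual_basis k A I f e"
    by (rule projective_dual_basis[OF A_projective])
  show ?thesis
    by (rule injective_tensor[OF module_A module_B module_A d linear_B_A]) simp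
qed

text \<open>Inverting the inclusion, instead of fixing a formula in a dual basis, lets linearity and
  equivariance of \<open>\<sigma>\<close> be inherited from \<open>sec\<close> by
  injectivity.\<close>

definition \<sigma> :: "'a \<Rightarrow> ('a \<times> 'a \<Rightarrow>\<^sub>0 int) set"
  where "\<sigma> a = inv_into (carrier BA) (\<lambda>t. tsum AA t (\<lambda>b a. b \<boxtimes>\<^bsub>AA\<^esub> a)) (sec a)"

lemma sigma:
  assumes a: "a \<in> carrier A"
  shows "\<sigma> a \<in> carrier BA" "tsum AA (\<sigma> a) (\<lambda>b a. b \<boxtimes>\<^bsub>AA\<^esub> a) = sec a"
proof -
  obtain I :: "'a set" and f e where d: "dual_basis k A I f e"
    by (rule projective_dual_basis[OF A_projective])
  have "\<exists>u \<in> carrier BA. tsum AA u (\<lambda>b a. b \<boxtimes>\<^bsub>AA\<^esub> a) = sec a"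
    by (rule submodule_tensor[OF module_A module_B module_A d linear_B_A])
      (use a slice_coinvariant dual_basisD[OF d] in simp_all)
  then have "sec a \<in> (\<lambda>t. tsum AA t (\<lambda>b a. b \<boxtimes>\<^bsub>AA\<^esub> a)) ` carrier BA" by (rule bexE) blast
  then show "\<sigma> a \<in> carrier BA" "tsum AA (\<sigma> a) (\<lambda>b a. b \<boxtimes>\<^bsub>AA\<^esub> a) = sec a"
    unfolding \<sigma>_def by (rule inv_into_into, rule f_inv_into_f)
qed

lemma tsum_sigma:
  assumes "bilinear k A A G F" "module k G" "a \<in> carrier A"
  shows "tsum G (\<sigma> a) F = tsum G (sec a) F"
  using tsum_BA_AA[OF assms(1,2) sigma(1)[OF assms(3)]] sigma(2)[OF assms(3)] by simp

lemma BA_eqI: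
  assumes "t \<in> carrier BA" "u \<in> carrier BA"
    "tsum AA t (\<lambda>b a. b \<boxtimes>\<^bsub>AA\<^esub> a) = tsum AA u (\<lambda>b a. b \<boxtimes>\<^bsub>AA\<^esub> a)"
  shows "t = u"
  using inj_onD[OF inj_BA_AA] assms by blast

lemma linear_sigma: "linear_map k A BA \<sigma>"
proof -
  interpret BA: module k BA by simp
  show ?thesis
    by (rule linear_mapI; (rule BA_eqI)?)
      (simp_all add: sigma linear_map_add[OF linear_BA_AA] linear_map_smult[OF linear_BA_AA]
        linear_map_add[OF linear_sec] linear_map_smult[OF linear_sec])
qed

lemma sigma_left_linear:
  assumes b: "b \<in> carrier B" and a: "a \<in> carrier A"
  shows "\<sigma> (b \<bullet> a) = left_mult A BA b (\<sigma> a)"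
proof -
  note [simp] = B_subset[OF b] a b sigma BA_rules B_subset
  have [simp]: "linear_map k X B g \<Longrightarrow> linear_map k X B
    (\<lambda>x. b \<bullet> g x)" for X :: "('k, 'p, 'q) module_scheme" and g
    using linear_mult(1)[OF B_subset[OF b] linear_incl[of X g]] b
    by (auto simp: linear_map_def coinvariant_mult Pi_iff)
  have [simp]: "x \<in> carrier B \<Longrightarrow> b \<bullet> x \<in> carrier B" for x using coinvariant_mult[OF b] .
  show ?thesis
    by (rule BA_eqI) (simp_all add: left_mult_def sec_left_linear tsum_sigma[symmetric])
qed

text \<open>The identity is tested in \<open>A \<otimes> A \<otimes> C\<close>, where it is
  \<open>sec_right_colinear\<close>. Projectivity of \<open>C\<close> keeps the inclusion of
  \<open>B \<otimes> A\<close> injective after tensoring with \<open>C\<close>.\<close>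

lemma sigma_right_colinear:
  assumes a: "a \<in> carrier A"
  shows "tensor_right_coaction k C BA \<rho> (\<sigma> a) = tsum (tensor k BA C) (\<rho> a) (\<lambda>x c. \<sigma> x \<boxtimes>\<^bsub>tensor k BA C\<^esub> c)"
proof -
  let ?j = "\<lambda>t. tsum AA t (\<lambda>b a. b \<boxtimes>\<^bsub>AA\<^esub> a)"
  let ?BAC = "tensor k BA C" and ?AAC = "tensor k AA C"
  let ?J = "\<lambda>t. tsum ?AAC t (\<lambda>m c. ?j m \<boxtimes>\<^bsub>?AAC\<^esub> c)"
  note [simp] = B_subset a sigma BA_rules linear_op(2,3)[OF linear_sigma] linear_sigma tsum_sigma
  obtain J :: "'c set" and f e where d: "dual_basis k C J f e"
    by (rule projective_dual_basis[OF C_projective])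
  have inj: "inj_on ?J (carrier ?BAC)"
    by (rule injective_tensor[OF _ _ module_C d linear_BA_AA inj_BA_AA]) simp_all
  have "?J (tensor_right_coaction k C BA \<rho> (\<sigma> a)) =
    tsum ?AAC (sec a) (\<lambda>x y. tsum ?AAC (\<rho> y) (\<lambda>z c. (x \<boxtimes>\<^bsub>AA\<^esub> z) \<boxtimes>\<^bsub>?AAC\<^esub> c))"
    by (simp add: tensor_right_coaction_def Let_def)
  also have "\<dots> = tsum ?AAC (\<rho> a) (\<lambda>x c. tsum ?AAC (sec x) (\<lambda>y z. (y \<boxtimes>\<^bsub>AA\<^esub> z) \<boxtimes>\<^bsub>?AAC\<^esub> c))"
    by (rule sec_right_colinear) simp_all
  also have "\<dots> = tsum ?AAC (\<rho> a) (\<lambda>x c. sec x \<boxtimes>\<^bsub>?AAC\<^esub> c)"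
  proof -
    have "tsum ?AAC (sec x) (\<lambda>y z. (y \<boxtimes>\<^bsub>AA\<^esub> z) \<boxtimes>\<^bsub>?AAC\<^esub> c) = sec x \<boxtimes>\<^bsub>?AAC\<^esub> c"
      if "x \<in> carrier A" "c \<in> carrier C" for x c
      using linear_map_push[of k A A AA ?AAC "\<lambda>t. t \<boxtimes>\<^bsub>?AAC\<^esub> c" "\<lambda>y z. y \<boxtimes>\<^bsub>AA\<^esub> z" "sec x"] that
      by simp
    then show ?thesis by simp
  qed
  also have "\<dots> = ?J (tsum ?BAC (\<rho> a) (\<lambda>x c. \<sigma> x \<boxtimes>\<^bsub>?BAC\<^esub> c))"
    by simp
  finally have "?J (tensor_right_coaction k C BA \<rho> (\<sigma> a)) = ?J (tsum ?BAC (\<rho> a) (\<lambda>x c. \<sigma> x \<boxtimes>\<^bsub>?BAC\<^esub> c))" .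
  then show ?thesis
    by (rule inj_onD[OF inj]) (simp_all add: tensor_right_coaction_def Let_def)
qed

end

section \<open>Projectivity of \<open>A\<close> as a left module over the coinvariants\<close>

lemma left_module_B_A: "left_module B (regular_module A)"
proof -
  interpret RA: abelian_group "regular_module A"
    by (rule abelian_groupI) (auto simp: A.M.a_ac intro: exI[of _ "\<ominus>\<^bsub>A\<^esub> _"] A.M.l_neg)
  show ?thesis
    by unfold_locales (auto simp: B_subset A.l_distr A.r_distr A.m_assoc)
qed

lemma finsum_regular_module: "finsum (regular_module A) g U = finsum A g U"
  by (simp add: finsum_def finprod_def)

context
  assumes A_projective: "projective k A" and C_projective: "projective k C"
begin

text \<open>The vectors \<open>e i\<close> of a dual basis over \<open>k\<close> are kept, and the
  functionals are replaced by the slices of \<open>sec\<close>, which take values in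
  \<open>B\<close>. The index set is unchanged, so it stays in the type that
  \<open>projective\<close> prescribes.\<close>

lemma projective_B_A: "projective B (regular_module A)"
proof -
  interpret L: left_module B "regular_module A" by (rule left_module_B_A)
  interpret AA: module k AA by simp
  obtain I :: "'a set" and f e where d: "dual_basis k A I f e"
    by (rule projective_dual_basis[OF A_projective])
  note D = dual_basisD[OF d]
  define b where "b i a = tsum A (sec a) (\<lambda>x y. f i y \<odot>\<^bsub>A\<^esub> x)" for i a
  note [simp] = D(1) linear_op(2)[OF D(1)] D(4)
  have b_lin: "linear_map k A A (b i)" if "i \<in> I" for i
    unfolding b_def using that by simp
  have b_B: "b i a \<in> carrier B" if "i \<in> I" "a \<in> carrier A" for i a
    unfolding b_def by (rule slice_coinvariant[OF D(1)[OF that(1)] that(2)])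
  have b_mult: "b i (c \<bullet> a) = c \<bullet> b i a" if i: "i \<in> I" and c: "c \<in> carrier B" and a: "a \<in> carrier A" for i c a
  proof -
    note [simp] = i B_subset[OF c] a
    have "c \<bullet> b i a = tsum A (sec a) (\<lambda>x y. c \<bullet> (f i y \<odot>\<^bsub>A\<^esub> x))"
      unfolding b_def by (rule linear_map_push[of k A A]) simp_all
    then show ?thesis
      by (simp add: b_def sec_left_linear[OF c a] A.smult_mult_right)
  qed
  \<comment> \<open>The product map applied to the finite expansion of \<open>sec a\<close> returns
    \<open>a\<close> by \<open>sec_mult\<close>. The set \<open>V\<close> contains the support of
    the new coordinates, which is thereby finite.\<close>
  have expand: "\<exists>V. finite V \<and> {i \<in> I. b i a \<noteq> \<zero>\<^bsub>A\<^esub>} \<subseteq> V \<and> V \<subseteq> I \<and> (\<Oplus>\<^bsub>A\<^esub>i \<in> V. b i a \<bullet> e i) = a"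
    if a: "a \<in> carrier A" for a
  proof -
    obtain V where V: "finite V" "V \<subseteq> I" "\<And>i. i \<in> I - V \<Longrightarrow> b i a = \<zero>\<^bsub>A\<^esub>"
      "(\<Oplus>\<^bsub>AA\<^esub>i \<in> V. b i a \<boxtimes>\<^bsub>AA\<^esub> e i) = sec a"
      using tensor_expand[OF module_A module_A d linear_op(3)[OF linear_sec a], folded b_def]
      by (elim exE conjE) simp
    have be: "b i a \<in> carrier A" "e i \<in> carrier A" if "i \<in> V" for i
      using that V(2) B_subset[OF b_B] a D(2) by auto
    have "tsum A (\<Oplus>\<^bsub>AA\<^esub>i \<in> V. b i a \<boxtimes>\<^bsub>AA\<^esub> e i) (\<bullet>) = (\<Oplus>\<^bsub>A\<^esub>i \<in> V. tsum A (b i a \<boxtimes>\<^bsub>AA\<^esub> e i) (\<bullet>))"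
      by (rule linear_map_finsum[OF linear_tsum_tensor[OF module_A module_A module_A]
        AA.abelian_group_axioms A.M.abelian_group_axioms V(1)]) (simp_all add: be)
    also have "\<dots> = (\<Oplus>\<^bsub>A\<^esub>i \<in> V. b i a \<bullet> e i)"
      by (rule finsum_cong_raw) (simp add: be)
    finally have "(\<Oplus>\<^bsub>A\<^esub>i \<in> V. b i a \<bullet> e i) = a"
      using V(4) sec_mult[OF a] by simp
    then show ?thesis using V by blast
  qed
  define \<iota> where "\<iota> a = (\<lambda>i \<in> I. b i a)" for a
  define \<pi> where "\<pi> g = (\<Oplus>\<^bsub>regular_module A\<^esub>i \<in> {i \<in> I. g i \<noteq> \<zero>\<^bsub>B\<^esub>}. g i \<odot>\<^bsub>regular_module A\<^esub> e i)" for g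
  have fin: "finite {i \<in> I. b i a \<noteq> \<zero>\<^bsub>A\<^esub>}" if "a \<in> carrier A" for a
    using expand[OF that] finite_subset by blast
  have io: "linear_map B (regular_module A) (free_module B I) \<iota>"
  proof (rule linear_mapI)
    fix a assume a: "a \<in> carrier (regular_module A)"
    have "{i \<in> I. \<iota> a i \<noteq> \<zero>\<^bsub>A\<^esub>} = {i \<in> I. b i a \<noteq> \<zero>\<^bsub>A\<^esub>}" by (auto simp: \<iota>_def)
    then show "\<iota> a \<in> carrier (free_module B I)"
      using a fin[of a] b_B by (auto simp: free_module_def) (auto simp: \<iota>_def)
  qed (auto simp: \<iota>_def free_module_def fun_eq_iff linear_map_add[OF b_lin] b_mult)
  have pi: "linear_map B (free_module B I) (regular_module A) \<pi>"
    unfolding \<pi>_def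
  proof (rule L.linear_support_sum)
    show "linear_map B (free_module B I) (regular_module B) (\<lambda>g. g i)" if "i \<in> I" for i
      using that by (auto simp: linear_map_def free_module_def)
    show "finite {i \<in> I. g i \<noteq> \<zero>\<^bsub>B\<^esub>}" if "g \<in> carrier (free_module B I)" for g
      using that by (simp add: free_module_def)
    show "e i \<in> carrier (regular_module A)" if "i \<in> I" for i
      using D(2)[OF that] by simp
    show "g \<oplus>\<^bsub>free_module B I\<^esub> h \<in> carrier (free_module B I)"
      if g: "g \<in> carrier (free_module B I)" and h: "h \<in> carrier (free_module B I)" for g h
    proof -
      have "{i \<in> I. (g \<oplus>\<^bsub>free_module B I\<^esub> h) i \<noteq> \<zero>\<^bsub>A\<^esub>} \<subseteq> {i \<in> I. g i \<noteq> \<zero>\<^bsub>A\<^esub>} \<union> {i \<in> I. h i \<noteq> \<zero>\<^bsub>A\<^esub>}"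
        by (auto simp: free_module_def)
      moreover have "finite ({i \<in> I. g i \<noteq> \<zero>\<^bsub>A\<^esub>} \<union> {i \<in> I. h i \<noteq> \<zero>\<^bsub>A\<^esub>})"
        using g h by (simp add: free_module_def)
      ultimately have "finite {i \<in> I. (g \<oplus>\<^bsub>free_module B I\<^esub> h) i \<noteq> \<zero>\<^bsub>A\<^esub>}" by (rule finite_subset)
      moreover have "g \<oplus>\<^bsub>free_module B I\<^esub> h \<in> I \<rightarrow>\<^sub>E carrier B"
        using g h coinvariant_add by (auto simp: free_module_def)
      ultimately show ?thesis by (simp add: free_module_def)
    qed
    show "r \<odot>\<^bsub>free_module B I\<^esub> g \<in> carrier (free_module B I)"
      if r: "r \<in> carrier B" and g: "g \<in> carrier (free_module B I)" for r g
    proof -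
      have "{i \<in> I. (r \<odot>\<^bsub>free_module B I\<^esub> g) i \<noteq> \<zero>\<^bsub>A\<^esub>} \<subseteq> {i \<in> I. g i \<noteq> \<zero>\<^bsub>A\<^esub>}"
        using B_subset[OF r] by (auto simp: free_module_def)
      moreover have "finite {i \<in> I. g i \<noteq> \<zero>\<^bsub>A\<^esub>}"
        using g by (simp add: free_module_def)
      ultimately have "finite {i \<in> I. (r \<odot>\<^bsub>free_module B I\<^esub> g) i \<noteq> \<zero>\<^bsub>A\<^esub>}" by (rule finite_subset)
      moreover have "r \<odot>\<^bsub>free_module B I\<^esub> g \<in> I \<rightarrow>\<^sub>E carrier B"
        using g r coinvariant_mult by (auto simp: free_module_def)
      ultimately show ?thesis by (simp add: free_module_def)
    qed
  qed
  have "\<pi> (\<iota> a) = a" if a: "a \<in> carrier A" for a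
  proof -
    obtain V where V: "finite V" "{i \<in> I. b i a \<noteq> \<zero>\<^bsub>A\<^esub>} \<subseteq> V" "V \<subseteq> I" "(\<Oplus>\<^bsub>A\<^esub>i \<in> V. b i a \<bullet> e i) = a"
      using expand[OF a] by blast
    have "\<pi> (\<iota> a) = (\<Oplus>\<^bsub>regular_module A\<^esub>i \<in> V. \<iota> a i \<odot>\<^bsub>regular_module A\<^esub> e i)"
      unfolding \<pi>_def
      by (rule L.support_sum_superset[OF V(1) _ V(3)]) (use V(2) b_B a D(2) in \<open>auto simp: \<iota>_def\<close>)
    also have "\<dots> = (\<Oplus>\<^bsub>A\<^esub>i \<in> V. b i a \<bullet> e i)"
      unfolding finsum_regular_module by (rule finsum_cong_raw) (use V(3) in \<open>auto simp: \<iota>_def\<close>)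
    finally show ?thesis using V(4) by simp
  qed
  then show ?thesis
    unfolding projective_def using left_module_B_A io pi
    by (intro conjI exI[of _ I] exI[of _ \<iota>] exI[of _ \<pi>] ballI) simp_all
qed

lemma equivariantly_projective_A: "equivariantly_projective k A C \<rho>"
  unfolding equivariantly_projective_def Let_def left_linear_right_colinear_def right_colinear_def
  using projective_B_A linear_sigma[OF A_projective C_projective]
    sigma_right_colinear[OF A_projective C_projective] sigma_left_linear[OF A_projective C_projective]
    tsum_sigma[OF A_projective C_projective, of A "(\<bullet>)"] sec_mult
  by (intro conjI exI[of _ \<sigma>]) simp_all

end

section \<open>The tensor product over the coinvariants and the canonical map on it\<close>

abbreviation "AAB \<equiv> balanced_tensor (carrier B) (\<bullet>) (\<bullet>) A A"

text \<open>A scalar \<open>r\<close> acts through the coinvariant \<open>r \<odot> 1\<close>, which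
  supplies \<open>scalar_in\<close>.\<close>

lemma balanced_pair_AAB: "balanced_pair k (carrier B) (\<bullet>) (\<bullet>) A A"
proof
  fix r assume r: "r \<in> carrier k"
  show "\<exists>s \<in> carrier B. (\<forall>m \<in> carrier A. m \<bullet> s = r \<odot>\<^bsub>A\<^esub> m) \<and> (\<forall>n \<in> carrier A. s \<bullet> n = r \<odot>\<^bsub>A\<^esub> n)"
    by (rule bexI[of _ "r \<odot>\<^bsub>A\<^esub> \<one>\<^sub>A"])
      (use r in \<open>simp_all add: coinvariant_smult A.smult_mult_left A.smult_mult_right\<close>)
qed (simp_all add: B_subset A.smult_mult_left)

lemmas module_AAB [simp] = balanced_pair.module_T[OF balanced_pair_AAB]
  and pure_AAB_closed [simp] = balanced_pair.pure_closed[OF balanced_pair_AAB]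
  and linear_pure_AAB [simp] = bilinear_apply(1,2)[OF balanced_pair.bilinear_pure[OF balanced_pair_AAB]]
  and AAB_eqI = balanced_pair.linear_eqI[OF balanced_pair_AAB]
  and pure_AAB_balanced = balanced_pair.pure_balanced[OF balanced_pair_AAB]
  and linear_tsum_AAB = balanced_pair.linear_tsum[OF balanced_pair_AAB]

lemma tsum_pure_AAB:
  assumes G: "module k G" and f: "bilinear k A A G f"
    and b: "\<forall>m \<in> carrier A. \<forall>s \<in> carrier B. \<forall>n \<in> carrier A. f (m \<bullet> s) n = f m (s \<bullet> n)"
    and m: "m \<in> carrier A" "n \<in> carrier A"
  shows "tsum G (m \<boxtimes>\<^bsub>AAB\<^esub> n) f = f m n"
proof -
  interpret G: module k G by (rule G)
  show ?thesis
    by (rule balanced_pair.tsum_pure[OF balanced_pair_AAB G.abelian_group_axioms bilinear_biadditive[OF f] b m])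
qed

lemma left_mult_AC:
  assumes "linear_map k X AC g" "a \<in> carrier A"
  shows "linear_map k X AC (\<lambda>x. left_mult A AC a (g x))"
  using linear_map_compose[OF assms(1) linear_left_mult[OF assms(2)]] .

lemma left_mult_AC_left:
  assumes "linear_map k X A g" "t \<in> carrier AC"
  shows "linear_map k X AC (\<lambda>x. left_mult A AC (g x) t)"
proof -
  note [simp] = assms(2)
  have "linear_map k A AC (\<lambda>a. left_mult A AC a t)" unfolding left_mult_def by simp
  from linear_map_compose[OF assms(1) this] show ?thesis .
qed

lemma canonical_bilinear: "bilinear k A A AC (\<lambda>a a'. left_mult A AC a (\<rho> a'))"
  by (simp add: left_mult_AC left_mult_AC_left)

text \<open>The defining property of the coinvariants, that they pass through \<open>\<rho>\<close>
  on the left, is exactly what lets the canonical map descend to the tensor product over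
  \<open>B\<close>.\<close>

lemma canonical_balanced:
  "\<forall>m \<in> carrier A. \<forall>s \<in> carrier B. \<forall>n \<in> carrier A.
    left_mult A AC (m \<bullet> s) (\<rho> n) = left_mult A AC m (\<rho> (s \<bullet> n))"
  by (simp add: coinvariantD left_mult_mult B_subset)

abbreviation "can \<equiv> canonical_map k A C \<rho>"

lemma linear_can: "linear_map k AAB AC can"
  unfolding canonical_map_def Let_def
  by (rule linear_tsum_AAB[OF _ canonical_bilinear canonical_balanced]) simp

lemma can_pure: "a \<in> carrier A \<Longrightarrow> a' \<in> carrier A \<Longrightarrow> can (a \<boxtimes>\<^bsub>AAB\<^esub> a') = left_mult A AC a (\<rho> a')"
  unfolding canonical_map_def Let_def
  by (rule tsum_pure_AAB[OF _ canonical_bilinear canonical_balanced]) simp_all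

lemma left_mult_AAB:
  assumes s: "s \<in> carrier A"
  shows "linear_map k AAB AAB (left_mult A AAB s)"
    and "a \<in> carrier A \<Longrightarrow> a' \<in> carrier A \<Longrightarrow> left_mult A AAB s (a \<boxtimes>\<^bsub>AAB\<^esub> a') = (s \<bullet> a) \<boxtimes>\<^bsub>AAB\<^esub> a'"
proof -
  note [simp] = s B_subset
  have b: "bilinear k A A AAB (\<lambda>x y. (s \<bullet> x) \<boxtimes>\<^bsub>AAB\<^esub> y)" by simp
  have bal: "\<forall>x \<in> carrier A. \<forall>c \<in> carrier B. \<forall>y \<in> carrier A.
      (s \<bullet> (x \<bullet> c)) \<boxtimes>\<^bsub>AAB\<^esub> y = (s \<bullet> x) \<boxtimes>\<^bsub>AAB\<^esub> (c \<bullet> y)"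
    by (simp add: A.m_assoc[symmetric] pure_AAB_balanced)
  show "linear_map k AAB AAB (left_mult A AAB s)"
    unfolding left_mult_def by (rule linear_tsum_AAB[OF _ b bal]) simp
  show "a \<in> carrier A \<Longrightarrow> a' \<in> carrier A \<Longrightarrow> left_mult A AAB s (a \<boxtimes>\<^bsub>AAB\<^esub> a') = (s \<bullet> a) \<boxtimes>\<^bsub>AAB\<^esub> a'"
    unfolding left_mult_def by (rule tsum_pure_AAB[OF _ b bal]) simp_all
qed

abbreviation "AABC \<equiv> tensor k AAB C"
abbreviation "ACC \<equiv> tensor k AC C"
abbreviation "\<rho>AAB \<equiv> tensor_right_coaction k C AAB \<rho>"
abbreviation "\<rho>AC \<equiv> tensor_right_coaction k C AC \<Delta>\<^sub>C"

lemma rho_AAB: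
  shows "linear_map k AAB AABC \<rho>AAB"
    and "a \<in> carrier A \<Longrightarrow> a' \<in> carrier A \<Longrightarrow>
      \<rho>AAB (a \<boxtimes>\<^bsub>AAB\<^esub> a') = tsum AABC (\<rho> a') (\<lambda>x c. (a \<boxtimes>\<^bsub>AAB\<^esub> x) \<boxtimes>\<^bsub>AABC\<^esub> c)"
proof -
  note [simp] = B_subset
  have b: "bilinear k A A AABC (\<lambda>m n. tsum AABC (\<rho> n) (\<lambda>x c. (m \<boxtimes>\<^bsub>AAB\<^esub> x) \<boxtimes>\<^bsub>AABC\<^esub> c))" by simp
  have bal: "\<forall>m \<in> carrier A. \<forall>s \<in> carrier B. \<forall>n \<in> carrier A.
      tsum AABC (\<rho> n) (\<lambda>x c. ((m \<bullet> s) \<boxtimes>\<^bsub>AAB\<^esub> x) \<boxtimes>\<^bsub>AABC\<^esub> c) =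
      tsum AABC (\<rho> (s \<bullet> n)) (\<lambda>x c. (m \<boxtimes>\<^bsub>AAB\<^esub> x) \<boxtimes>\<^bsub>AABC\<^esub> c)"
    by (simp add: coinvariantD left_mult_def pure_AAB_balanced)
  show "linear_map k AAB AABC \<rho>AAB"
    unfolding tensor_right_coaction_def Let_def by (rule linear_tsum_AAB[OF _ b bal]) simp
  show "a \<in> carrier A \<Longrightarrow> a' \<in> carrier A \<Longrightarrow>
      \<rho>AAB (a \<boxtimes>\<^bsub>AAB\<^esub> a') = tsum AABC (\<rho> a') (\<lambda>x c. (a \<boxtimes>\<^bsub>AAB\<^esub> x) \<boxtimes>\<^bsub>AABC\<^esub> c)"
    unfolding tensor_right_coaction_def Let_def by (rule tsum_pure_AAB[OF _ b bal]) simp_all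
qed

lemma rho_AC:
  shows "linear_map k AC ACC \<rho>AC"
    and "a \<in> carrier A \<Longrightarrow> c \<in> carrier C \<Longrightarrow>
      \<rho>AC (a \<boxtimes>\<^bsub>AC\<^esub> c) = tsum ACC (\<Delta>\<^sub>C c) (\<lambda>d e. (a \<boxtimes>\<^bsub>AC\<^esub> d) \<boxtimes>\<^bsub>ACC\<^esub> e)"
  unfolding tensor_right_coaction_def Let_def by simp_all

text \<open>On the pure tensor of \<open>a\<close> and \<open>a'\<close> the claim is
  coassociativity of \<open>\<rho>\<close> at \<open>a'\<close>, multiplied by \<open>a\<close> on
  the left.\<close>

lemma can_colinear:
  assumes t: "t \<in> carrier AAB"
  shows "\<rho>AC (can t) = tsum ACC (\<rho>AAB t) (\<lambda>m c. can m \<boxtimes>\<^bsub>ACC\<^esub> c)"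
proof (rule AAB_eqI[OF _ _ _ t])
  note [simp] = linear_op[OF linear_can] linear_op[OF rho_AAB(1)] linear_op[OF rho_AC(1)]
    tensor_rules[OF module_AAB module_C]
  show "linear_map k AAB ACC (\<lambda>t. \<rho>AC (can t))"
    "linear_map k AAB ACC (\<lambda>t. tsum ACC (\<rho>AAB t) (\<lambda>m c. can m \<boxtimes>\<^bsub>ACC\<^esub> c))" "module k ACC" by simp_all
  fix a a' assume [simp]: "a \<in> carrier A" "a' \<in> carrier A"
  have "tsum ACC (\<rho>AAB (a \<boxtimes>\<^bsub>AAB\<^esub> a')) (\<lambda>m c. can m \<boxtimes>\<^bsub>ACC\<^esub> c) =
    tsum ACC (\<rho> a') (\<lambda>x c. left_mult A AC a (\<rho> x) \<boxtimes>\<^bsub>ACC\<^esub> c)"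
    by (simp add: rho_AAB(2) can_pure)
  also have "\<dots> = tsum ACC (\<rho> a') (\<lambda>x c. tsum ACC (\<rho> x) (\<lambda>y d. ((a \<bullet> y) \<boxtimes>\<^bsub>AC\<^esub> d) \<boxtimes>\<^bsub>ACC\<^esub> c))"
  proof -
    have "left_mult A AC a (\<rho> x) \<boxtimes>\<^bsub>ACC\<^esub> c = tsum ACC (\<rho> x) (\<lambda>y d. ((a \<bullet> y) \<boxtimes>\<^bsub>AC\<^esub> d) \<boxtimes>\<^bsub>ACC\<^esub> c)"
      if "x \<in> carrier A" "c \<in> carrier C" for x c
      unfolding left_mult_def by (rule linear_map_push[of k A C AC]) (use that in simp_all)
    then show ?thesis by simp
  qed
  also have "\<dots> = tsum ACC (\<rho> a') (\<lambda>x c. tsum ACC (\<Delta>\<^sub>C c) (\<lambda>d e. ((a \<bullet> x) \<boxtimes>\<^bsub>AC\<^esub> d) \<boxtimes>\<^bsub>ACC\<^esub> e))"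
    by (rule coaction_coassoc) simp_all
  also have "\<dots> = tsum ACC (\<rho> a') (\<lambda>x c. \<rho>AC ((a \<bullet> x) \<boxtimes>\<^bsub>AC\<^esub> c))"
    by (simp add: rho_AC(2))
  also have "\<dots> = \<rho>AC (left_mult A AC a (\<rho> a'))"
    unfolding left_mult_def by (rule linear_map_push[of k A C AC, symmetric]) simp_all
  also have "\<dots> = \<rho>AC (can (a \<boxtimes>\<^bsub>AAB\<^esub> a'))" by (simp add: can_pure)
  finally show "\<rho>AC (can (a \<boxtimes>\<^bsub>AAB\<^esub> a')) = tsum ACC (\<rho>AAB (a \<boxtimes>\<^bsub>AAB\<^esub> a')) (\<lambda>m c. can m \<boxtimes>\<^bsub>ACC\<^esub> c)" ..
qed

lemma can_left_linear:
  assumes s: "s \<in> carrier A" and t: "t \<in> carrier AAB"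
  shows "can (left_mult A AAB s t) = left_mult A AC s (can t)"
proof (rule AAB_eqI[OF _ _ _ t])
  show "linear_map k AAB AC (\<lambda>t. can (left_mult A AAB s t))"
    by (rule linear_map_compose[OF left_mult_AAB(1)[OF s] linear_can])
  show "linear_map k AAB AC (\<lambda>t. left_mult A AC s (can t))"
    by (rule left_mult_AC[OF linear_can s])
qed (use s in \<open>simp_all add: left_mult_AAB(2) can_pure left_mult_mult\<close>)

section \<open>The splitting of the canonical map\<close>

definition can_splitting :: "('a \<times> 'c \<Rightarrow>\<^sub>0 int) set \<Rightarrow> ('a \<times> 'a \<Rightarrow>\<^sub>0 int) set"
  where "can_splitting t = tsum AAB t (\<lambda>a c. tsum AAB (\<kappa> c) (\<lambda>x y. (a \<bullet> x) \<boxtimes>\<^bsub>AAB\<^esub> y))"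

lemma linear_can_splitting: "linear_map k AC AAB can_splitting"
  unfolding can_splitting_def by simp

lemma can_splitting_pure: "a \<in> carrier A \<Longrightarrow> c \<in> carrier C \<Longrightarrow>
    can_splitting (a \<boxtimes>\<^bsub>AC\<^esub> c) = tsum AAB (\<kappa> c) (\<lambda>x y. (a \<bullet> x) \<boxtimes>\<^bsub>AAB\<^esub> y)"
  unfolding can_splitting_def by simp

lemma can_splitting_left_linear:
  assumes s: "s \<in> carrier A" and t: "t \<in> carrier AC"
  shows "can_splitting (left_mult A AC s t) = left_mult A AAB s (can_splitting t)"
proof (rule tensor_linear_eqI[OF module_A module_C _ _ _ _ t])
  show "linear_map k AC AAB (\<lambda>t. can_splitting (left_mult A AC s t))"
    by (rule linear_map_compose[OF linear_left_mult[OF s] linear_can_splitting])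
  show "linear_map k AC AAB (\<lambda>t. left_mult A AAB s (can_splitting t))"
    by (rule linear_map_compose[OF linear_can_splitting left_mult_AAB(1)[OF s]])
  fix a c assume ac[simp]: "a \<in> carrier A" "c \<in> carrier C"
  note [simp] = s
  have "left_mult A AAB s (tsum AAB (\<kappa> c) (\<lambda>x y. (a \<bullet> x) \<boxtimes>\<^bsub>AAB\<^esub> y)) =
    tsum AAB (\<kappa> c) (\<lambda>x y. left_mult A AAB s ((a \<bullet> x) \<boxtimes>\<^bsub>AAB\<^esub> y))"
    by (rule linear_map_push[of k A A AAB]) (simp_all add: left_mult_AAB(1))
  then show "can_splitting (left_mult A AC s (a \<boxtimes>\<^bsub>AC\<^esub> c)) = left_mult A AAB s (can_splitting (a \<boxtimes>\<^bsub>AC\<^esub> c))"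
    by (simp add: can_splitting_pure left_mult_AAB(2) A.m_assoc) (simp add: left_mult_def can_splitting_pure A.m_assoc)
qed simp

text \<open>On pure tensors this is right colinearity of \<open>\<kappa>\<close>, multiplied by
  \<open>a\<close> and read over \<open>B\<close>.\<close>

lemma can_splitting_colinear:
  assumes t: "t \<in> carrier AC"
  shows "\<rho>AAB (can_splitting t) = tsum AABC (\<rho>AC t) (\<lambda>m c. can_splitting m \<boxtimes>\<^bsub>AABC\<^esub> c)"
proof (rule tensor_linear_eqI[OF module_A module_C _ _ _ _ t])
  note [simp] = linear_op[OF linear_can_splitting] linear_op[OF rho_AAB(1)] linear_op[OF rho_AC(1)]
    tensor_rules[OF module_AAB module_C] tensor_rules[OF module_tensor[OF module_A module_C] module_C]
  show "linear_map k AC AABC (\<lambda>t. \<rho>AAB (can_splitting t))"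
    "linear_map k AC AABC (\<lambda>t. tsum AABC (\<rho>AC t) (\<lambda>m c. can_splitting m \<boxtimes>\<^bsub>AABC\<^esub> c))" "module k AABC" by
      simp_all
  fix a c assume [simp]: "a \<in> carrier A" "c \<in> carrier C"
  have "\<rho>AAB (can_splitting (a \<boxtimes>\<^bsub>AC\<^esub> c)) = tsum AABC (\<kappa> c) (\<lambda>x y. \<rho>AAB ((a \<bullet> x) \<boxtimes>\<^bsub>AAB\<^esub> y))"
    unfolding can_splitting_pure[OF \<open>a \<in> carrier A\<close> \<open>c \<in> carrier C\<close>]
    by (rule linear_map_push[of k A A AAB]) simp_all
  also have "\<dots> = tsum AABC (\<kappa> c) (\<lambda>x y. tsum AABC (\<rho> y) (\<lambda>z d. ((a \<bullet> x) \<boxtimes>\<^bsub>AAB\<^esub> z) \<boxtimes>\<^bsub>AABC\<^esub> d))"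
    by (simp add: rho_AAB(2))
  also have "\<dots> = tsum AABC (\<Delta>\<^sub>C c) (\<lambda>d e. tsum AABC (\<kappa> d) (\<lambda>x y. ((a \<bullet> x) \<boxtimes>\<^bsub>AAB\<^esub> y) \<boxtimes>\<^bsub>AABC\<^esub> e))"
    by (rule kappa_right_colinear) simp_all
  also have "\<dots> = tsum AABC (\<Delta>\<^sub>C c) (\<lambda>d e. can_splitting (a \<boxtimes>\<^bsub>AC\<^esub> d) \<boxtimes>\<^bsub>AABC\<^esub> e)"
  proof -
    have "can_splitting (a \<boxtimes>\<^bsub>AC\<^esub> d) \<boxtimes>\<^bsub>AABC\<^esub> e = tsum AABC (\<kappa> d) (\<lambda>x y. ((a \<bullet> x) \<boxtimes>\<^bsub>AAB\<^esub> y) \<boxtimes>\<^bsub>AABC\<^esub> e)"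
      if [simp]: "d \<in> carrier C" "e \<in> carrier C" for d e
      unfolding can_splitting_pure[OF \<open>a \<in> carrier A\<close> that(1)]
      by (rule linear_map_push[of k A A AAB]) simp_all
    then show ?thesis by simp
  qed
  also have "\<dots> = tsum AABC (\<rho>AC (a \<boxtimes>\<^bsub>AC\<^esub> c)) (\<lambda>m c. can_splitting m \<boxtimes>\<^bsub>AABC\<^esub> c)"
    by (simp add: rho_AC(2))
  finally show "\<rho>AAB (can_splitting (a \<boxtimes>\<^bsub>AC\<^esub> c)) = tsum AABC (\<rho>AC (a \<boxtimes>\<^bsub>AC\<^esub> c))
    (\<lambda>m c. can_splitting m \<boxtimes>\<^bsub>AABC\<^esub> c)" .
qed

lemma can_splitting_can:
  assumes proj: "projective k A" "projective k C" and t: "t \<in> carrier AAB"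
  shows "can_splitting (can t) = t"
proof (rule AAB_eqI[OF _ linear_id _ t])
  show "linear_map k AAB AAB (\<lambda>t. can_splitting (can t))"
    by (rule linear_map_compose[OF linear_can linear_can_splitting])
  fix a a' assume [simp]: "a \<in> carrier A" "a' \<in> carrier A"
  note [simp] = BA_rules B_subset sigma[OF proj]
  have "can_splitting (can (a \<boxtimes>\<^bsub>AAB\<^esub> a')) = tsum AAB (\<rho> a') (\<lambda>u c. tsum AAB (\<kappa> c)
    (\<lambda>x y. (a \<bullet> (u \<bullet> x)) \<boxtimes>\<^bsub>AAB\<^esub> y))"
    by (simp add: can_pure) (simp add: left_mult_def can_splitting_def A.m_assoc)
  also have "\<dots> = tsum AAB (sec a') (\<lambda>x y. (a \<bullet> x) \<boxtimes>\<^bsub>AAB\<^esub> y)"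
    by (rule tsum_sec[symmetric]) simp_all
  \<comment> \<open>Passing from \<open>sec\<close> to \<open>\<sigma>\<close> turns the first
    factors into coinvariants, so that the balancing relation over \<open>B\<close> applies to
    them.\<close>
  also have "\<dots> = tsum AAB (\<sigma> a') (\<lambda>x y. (a \<bullet> x) \<boxtimes>\<^bsub>AAB\<^esub> y)"
    by (rule tsum_sigma[OF proj, symmetric]) simp_all
  also have "\<dots> = tsum AAB (\<sigma> a') (\<lambda>x y. a \<boxtimes>\<^bsub>AAB\<^esub> (x \<bullet> y))"
    by (simp add: pure_AAB_balanced)
  also have "\<dots> = a \<boxtimes>\<^bsub>AAB\<^esub> tsum A (\<sigma> a') (\<bullet>)"
    by (rule linear_map_push[of k B A A, symmetric]) simp_all
  also have "tsum A (\<sigma> a') (\<bullet>) = tsum A (sec a') (\<bullet>)"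
    by (rule tsum_sigma[OF proj]) simp_all
  finally show "can_splitting (can (a \<boxtimes>\<^bsub>AAB\<^esub> a')) = a \<boxtimes>\<^bsub>AAB\<^esub> a'" by (simp add: sec_mult)
qed simp

lemma weak_coalgebra_galois_A:
  assumes "projective k A" "projective k C"
  shows "weak_coalgebra_galois k A C \<rho>"
  unfolding weak_coalgebra_galois_def Let_def left_linear_right_colinear_def right_colinear_def
  using assoc_algebra_A is_coalgebra_C comodule_A linear_can can_colinear can_left_linear
    linear_can_splitting can_splitting_colinear can_splitting_left_linear can_splitting_can[OF assms]
  by (intro conjI exI[of _ can_splitting]) simp_all

end

theorem theorem5p1:
  fixes k :: "'k ring" and A :: "('k, 'a) module" and C :: "('k, 'c) coalgebra"
    and \<psi>\<^sub>R :: "('c \<times> 'a \<Rightarrow>\<^sub>0 int) set \<Rightarrow> ('a \<times> 'c \<Rightarrow>\<^sub>0 int) set"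
    and \<psi>\<^sub>L :: "('a \<times> 'c \<Rightarrow>\<^sub>0 int) set \<Rightarrow> ('c \<times> 'a \<Rightarrow>\<^sub>0 int) set"
    and \<rho> :: "'a \<Rightarrow> ('a \<times> 'c \<Rightarrow>\<^sub>0 int) set"
  assumes "cring k"
    and "invertible_weak_entwining k A C \<psi>\<^sub>R \<psi>\<^sub>L"
    and "projective k A"
    and "projective k C"
    and "weak_entwined_module k A C \<psi>\<^sub>R A (\<otimes>\<^bsub>A\<^esub>) \<rho>"
    and "canonical_map k A C \<rho> ` carrier (tensor k A A) = carrier (entwining_coring k A C \<psi>\<^sub>R)"
    and "coseparable k C"
  shows "weak_coalgebra_galois k A C \<rho> \<and> equivariantly_projective k A C \<rho>"
proof -
  interpret E: invertible_weak_entwined_algebra k A C \<psi>\<^sub>R \<psi>\<^sub>L \<rho>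
    by (rule invertible_weak_entwined_algebra.intro) fact+
  obtain \<delta> where \<delta>: "bilinear k C C (regular_module k) \<delta>"
    "\<And>c d. c \<in> carrier C \<Longrightarrow> d \<in> carrier C \<Longrightarrow>
      tsum C (\<Delta>\<^bsub>C\<^esub> c) (\<lambda>c1 c2. \<delta> c2 d \<odot>\<^bsub>C\<^esub> c1) = tsum C (\<Delta>\<^bsub>C\<^esub> d) (\<lambda>d1 d2. \<delta> c d1 \<odot>\<^bsub>C\<^esub> d2)"
    "\<And>c. c \<in> carrier C \<Longrightarrow> tsum (regular_module k) (\<Delta>\<^bsub>C\<^esub> c) \<delta> = \<epsilon>\<^bsub>C\<^esub> c"
    using E.exists_cointegral[OF assms(7)] by blast
  obtain \<tau>\<^sub>0 where \<tau>\<^sub>0: "linear_map k C (tensor k A A) \<tau>\<^sub>0"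
    "\<And>c. c \<in> carrier C \<Longrightarrow> tsum (tensor k A C) (\<tau>\<^sub>0 c) (\<lambda>a a'. left_mult A (tensor k A C) a (\<rho> a')) =
      \<psi>\<^sub>R (c \<boxtimes>\<^bsub>tensor k C A\<^esub> \<one>\<^bsub>A\<^esub>)"
    using E.exists_lift[OF assms(4,6)] by blast
  interpret cointegral_lift k A C \<psi>\<^sub>R \<psi>\<^sub>L \<rho> \<delta> \<tau>\<^sub>0
    by unfold_locales (fact \<delta> \<tau>\<^sub>0)+
  show ?thesis
    using weak_coalgebra_galois_A[OF assms(3,4)] equivariantly_projective_A[OF assms(3,4)] by blast
qed

end
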